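(* Let $\mathrm{w}=(w_k)_{k\ge0}$ be a sequence of non-negative real weights with $w_0>0$ and with $w_k>0$ for some $k\ge 2$. If either $\hat\sigma_{\mathrm{w}}^2=\infty$ or $\nu_{\mathrm{w}}<1$, then $n^{-1/2}\,\mathrm{ht}(\mathrm{T}_{\mathrm{w},n})\to 0$, where the convergence is in both probability and expectation, as $n\to\infty$ along integers $n$ such that $Z_n(\mathrm{w})>0$.
   Context: A plane tree is a rooted, unlabeled finite tree in which the set of children of each node carries a (left-to-right) total order; $v(\mathrm{t})$ is its vertex set and $d_{\mathrm{t}}(v)$ is the number of children of $v$. The weight of $\mathrm{t}$ is $\mathrm{w}(\mathrm{t})=\prod_{v\in v(\mathrm{t})}w_{d_{\mathrm{t}}(v)}$, and $Z_n=Z_n(\mathrm{w})=\sum_{\mathrm{t}:|v(\mathrm{t})|=n}\mathrm{w}(\mathrm{t})$ (sum over plane trees with $n$ vertices). If $Z_n>0$, the simply generated tree $\mathrm{T}_{\mathrm{w},n}$ is the random plane tree with $n$ vertices with $\mathbf{P}(\mathrm{T}_{\mathrm{w},n}=\mathrm{t})=\mathrm{w}(\mathrm{t})/Z_n$. The height $\mathrm{ht}$ is the maximum graph distance from the root to a vertex. Let $\Phi(z)=\sum_{k\ge0}w_kz^k$ and let $\rho=\sup\{s\ge0:\Phi(s)<\infty\}\in[0,\infty]$. For $s\geq 0$ with $\Phi(s)<\infty$ let $\Psi(s)=\frac{s\Phi'(s)}{\Phi(s)}=\frac{\sum_k kw_ks^k}{\sum_k w_ks^k}\in[0,\infty]$;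 if $\Phi(\rho)=\infty$ (including $\rho=\infty$) let $\Psi(\rho)=\lim_{s\uparrow\rho}\Psi(s)$ ($\Psi$ is strictly increasing on $[0,\rho)$). Let $\nu=\nu_{\mathrm{w}}=\Psi(\rho)$. Let $\tau=\rho$ if $\nu\le1$ and $\tau=\Psi^{-1}(1)\in[0,\rho)$ if $\nu>1$. Let $\hat\sigma^2=\hat\sigma_{\mathrm{w}}^2=\tau\Psi'(\tau)\in[0,\infty]$ (with $\Psi'(\tau)$ understood as a left limit, possibly infinite, when $\tau=\rho>0$, and $\hat\sigma^2=0$ when $\tau=0$); equivalently, $\hat\sigma^2$ is the variance of the probability distribution $\hat\mu_k=w_k\tau^k/\Phi(\tau)$, $k\ge0$. *)

theory Defs
  imports "HOL-Probability.Probability"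
begin

section \<open>Plane trees\<close>

datatype plane_tree = Node (children: "plane_tree list")

text \<open>
  A vertex is identified with its Ulam--Harris address: the sequence of (zero-based) positions
  among siblings along the path from the root to it.  In particular the root is \<open>[]\<close>, and the
  graph distance of a vertex from the root is the length of its address.
\<close>

fun subtree_at :: "plane_tree \<Rightarrow> nat list \<Rightarrow> plane_tree option" where
  "subtree_at t [] = Some t"
| "subtree_at t (i # p) =
     (if i < length (children t) then subtree_at (children t ! i) p else None)"

definition vertices :: "plane_tree \<Rightarrow> nat list set" where
  "vertices t = dom (subtree_at t)"

definition num_children :: "plane_tree \<Rightarrow> nat list \<Rightarrow> nat" where
  "num_children t v = length (children (the (subtree_at t v)))"

definition height :: "plane_tree \<Rightarrow> nat" where
  "height t = Max (length ` vertices t)"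

lemma vertices_Node:
  "vertices (Node ts) = insert [] (\<Union>i<length ts. (#) i ` vertices (ts ! i))" (is "?L = ?R")
proof (rule set_eqI)
  fix p show "p \<in> ?L \<longleftrightarrow> p \<in> ?R"
    by (cases p) (auto simp: vertices_def dom_def split: if_splits)
qed

lemma finite_vertices [simp]: "finite (vertices t)"
proof (induction t)
  case (Node ts)
  then show ?case by (auto simp: vertices_Node)
qed

lemma card_vertices_Node:
  "card (vertices (Node ts)) = Suc (\<Sum>i<length ts. card (vertices (ts ! i)))"
proof -
  have "card (\<Union>i<length ts. (#) i ` vertices (ts ! i))
      = (\<Sum>i<length ts. card ((#) i ` vertices (ts ! i)))"
    by (rule card_UN_disjoint) auto
  also have "\<dots> = (\<Sum>i<length ts. card (vertices (ts ! i)))"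
    by (intro sum.cong refl card_image) (auto simp: inj_on_def)
  finally show ?thesis
    unfolding vertices_Node by (subst card_insert_disjoint) auto
qed

lemma card_vertices_pos: "card (vertices t) > 0"
  by (cases t) (simp add: card_vertices_Node)

lemma finite_trees_le: "finite {t. card (vertices t) \<le> n}"
proof (induction n)
  case 0
  have "{t. card (vertices t) \<le> 0} = {}"
    unfolding Collect_empty_eq not_le using card_vertices_pos by blast
  then show ?case by simp
next
  case (Suc n)
  have "{t. card (vertices t) \<le> Suc n}
      \<subseteq> Node ` {ts. set ts \<subseteq> {t. card (vertices t) \<le> n} \<and> length ts \<le> n}"
  proof
    fix t assume t: "t \<in> {t. card (vertices t) \<le> Suc n}"
    obtain ts where ts: "t = Node ts" by (cases t)
    have le: "(\<Sum>i<length ts. card (vertices (ts ! i))) \<le> n"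
      using t by (simp add: ts card_vertices_Node)
    have "(\<Sum>i<length ts. 1) \<le> (\<Sum>i<length ts. card (vertices (ts ! i)))"
      by (rule sum_mono) (use card_vertices_pos in \<open>simp add: Suc_le_eq\<close>)
    then have "length ts \<le> n" using le by simp
    moreover have "card (vertices (ts ! i)) \<le> n" if "i < length ts" for i
      using member_le_sum[of i "{..<length ts}" "\<lambda>i. card (vertices (ts ! i))"] that le by simp
    ultimately show "t \<in> Node ` {ts. set ts \<subseteq> {t. card (vertices t) \<le> n} \<and> length ts \<le> n}"
      unfolding ts by (intro imageI) (auto simp: in_set_conv_nth)
  qed
  moreover have "finite {ts. set ts \<subseteq> {t. card (vertices t) \<le> n} \<and> length ts \<le> n}"
    by (rule finite_lists_length_le[OF Suc.IH])
  ultimately show ?case by (meson finite_imageI finite_subset)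
qed

lemma finite_trees: "finite {t. card (vertices t) = n}"
  by (rule finite_subset[OF _ finite_trees_le[of n]]) auto


section \<open>Simply generated trees\<close>

definition tree_weight :: "(nat \<Rightarrow> real) \<Rightarrow> plane_tree \<Rightarrow> real" where
  "tree_weight w t = (\<Prod>v\<in>vertices t. w (num_children t v))"

definition Z :: "(nat \<Rightarrow> real) \<Rightarrow> nat \<Rightarrow> real" where
  "Z w n = (\<Sum>t | card (vertices t) = n. tree_weight w t)"

text \<open>The law of the simply generated tree; meaningful only if \<open>Z w n > 0\<close>.\<close>

definition sg_tree :: "(nat \<Rightarrow> real) \<Rightarrow> nat \<Rightarrow> plane_tree pmf" where
  "sg_tree w n =
     embed_pmf (\<lambda>t. if card (vertices t) = n then tree_weight w t / Z w n else 0)"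

lemma pmf_sg_tree:
  assumes nonneg: "\<And>k. w k \<ge> 0" and pos: "Z w n > 0"
  shows "pmf (sg_tree w n) t = (if card (vertices t) = n then tree_weight w t / Z w n else 0)"
  unfolding sg_tree_def
proof (rule pmf_embed_pmf)
  have tw: "tree_weight w t \<ge> 0" for t
    unfolding tree_weight_def by (intro prod_nonneg nonneg ballI)
  show "0 \<le> (if card (vertices t) = n then tree_weight w t / Z w n else 0)" for t
    using tw pos by simp
  let ?A = "{t. card (vertices t) = n}"
  have "(\<integral>\<^sup>+t. ennreal (if card (vertices t) = n then tree_weight w t / Z w n else 0)
           \<partial>count_space UNIV)
      = (\<Sum>t\<in>?A. ennreal (if card (vertices t) = n then tree_weight w t / Z w n else 0))"
    by (rule nn_integral_count_space'[OF finite_trees]) auto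
  also have "\<dots> = (\<Sum>t\<in>?A. ennreal (tree_weight w t / Z w n))"
    by (rule sum.cong) auto
  also have "\<dots> = ennreal (\<Sum>t\<in>?A. tree_weight w t / Z w n)"
    using tw pos by (intro sum_ennreal) simp
  also have "(\<Sum>t\<in>?A. tree_weight w t / Z w n) = 1"
    using pos by (simp add: Z_def flip: sum_divide_distrib)
  finally show "(\<integral>\<^sup>+t. ennreal (if card (vertices t) = n then tree_weight w t / Z w n else 0)
           \<partial>count_space UNIV) = 1" by simp
qed


section \<open>Parameters of the weight sequence\<close>

definition Phi :: "(nat \<Rightarrow> real) \<Rightarrow> ennreal \<Rightarrow> ennreal" where
  "Phi w s = (\<Sum>k. ennreal (w k) * s ^ k)"

definition rho :: "(nat \<Rightarrow> real) \<Rightarrow> ennreal" where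
  "rho w = Sup {s. s < \<infinity> \<and> Phi w s < \<infinity>}"

text \<open>The quotient \<open>s * \<Phi>'(s) / \<Phi>(s)\<close>, meaningful where \<open>\<Phi>(s)\<close> is finite.\<close>

definition Psi_quot :: "(nat \<Rightarrow> real) \<Rightarrow> ennreal \<Rightarrow> ennreal" where
  "Psi_quot w s = (\<Sum>k. of_nat k * ennreal (w k) * s ^ k) / Phi w s"

definition Psi :: "(nat \<Rightarrow> real) \<Rightarrow> ennreal \<Rightarrow> ennreal" where
  "Psi w s =
     (if s = rho w \<and> Phi w s = \<infinity> then Lim (at_left s) (Psi_quot w) else Psi_quot w s)"

definition nu :: "(nat \<Rightarrow> real) \<Rightarrow> ennreal" where
  "nu w = Psi w (rho w)"

definition tau :: "(nat \<Rightarrow> real) \<Rightarrow> ennreal" where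
  "tau w = (if nu w \<le> 1 then rho w else (THE s. s < rho w \<and> Psi w s = 1))"

text \<open>
  \<open>Psi\<close> is finite on \<open>[0, rho)\<close>, so the real-valued derivative below is the derivative of
  \<open>Psi\<close> on \<open>(0, rho)\<close>, where it is nonnegative.
\<close>

definition Psi_deriv :: "(nat \<Rightarrow> real) \<Rightarrow> real \<Rightarrow> real" where
  "Psi_deriv w x = deriv (\<lambda>y. enn2real (Psi w (ennreal y))) x"

text \<open>
  The value is \<open>\<tau> * \<Psi>'(\<tau>)\<close>.  If \<open>w 0 > 0\<close> and \<open>w k > 0\<close> for some \<open>k \<ge> 2\<close>, then \<open>rho w = \<infinity>\<close>
  implies \<open>nu w > 1\<close>, hence \<open>tau w\<close> is always finite and \<open>enn2real\<close> loses nothing.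
\<close>

definition sigma_sq :: "(nat \<Rightarrow> real) \<Rightarrow> ennreal" where
  "sigma_sq w =
     (if tau w = 0 then 0
      else if tau w = rho w
        then tau w * Lim (at_left (enn2real (tau w))) (\<lambda>x. ennreal (Psi_deriv w x))
      else tau w * ennreal (Psi_deriv w (enn2real (tau w))))"

end

theory Submission
  imports Defs
begin

text \<open>
  Cut a path from the root to a deepest vertex according to the sizes of the fringe subtrees along
  it: the vertices whose fringe subtree has size in \<open>(m/2, m]\<close> are consecutive. The fringe subtree at
  the first of them is, given its size \<open>k\<close>, a simply generated tree of size \<open>k\<close>, and if it has a
  vertex at height \<open>g\<close> with more than \<open>m/2\<close> descendants, then a uniform vertex of it has height at
  least \<open>g\<close> with probability at least \<open>1/2\<close>. So if a uniform vertex of the tree of size \<open>k\<close> has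
  height at least \<open>\<epsilon> sqrt k\<close> with probability at most \<open>1/4\<close> for large \<open>k\<close>, the length of a segment has
  a geometric tail on the scale \<open>\<epsilon> sqrt m\<close>. There are at most \<open>2n/m\<close> segments of class \<open>m\<close>, and
  summing the maxima over the dyadic values of \<open>m\<close> shows that the expected height is \<open>O(\<epsilon> sqrt n)\<close>.

  By Lagrange inversion, the probability \<open>p g\<close> that a uniform vertex has height at least \<open>g\<close>
  satisfies \<open>(\<Sum>j. (k choose j) l^j p j) = E (\<Prod>v. 1 + l d(v))\<close>, where \<open>d(v)\<close> is the degree of \<open>v\<close>.
  Since \<open>p\<close> is decreasing, for \<open>l = g/(2k)\<close> this gives \<open>p g \<le> 2 E (\<Prod>v. (1 + l d(v))/(1 + l))\<close>. The
  sum of \<open>d(v) - 1\<close> over all \<open>v\<close> is \<open>-1\<close>, so by the concavity of the logarithm the product is small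
  as soon as the sum of the squares of the degrees is at least \<open>A k\<close> with \<open>A\<close> large.
  Large deviation estimates show that this is typical: either the limiting degree distribution has
  infinite variance, or its mean is less than one and a positive proportion of the edges
  comes from vertices of unbounded degree.
\<close>

unbundle fps_syntax and no vec_syntax

section \<open>Generating functions of plane trees\<close>

abbreviation nv :: "plane_tree \<Rightarrow> nat" where
  "nv t \<equiv> card (vertices t)"

lemma nv_Node: "nv (Node ts) = Suc (sum_list (map nv ts))"
  by (simp add: card_vertices_Node sum_list_sum_nth atLeast0LessThan)

lemma num_children_Cons:
  "i < length ts \<Longrightarrow> num_children (Node ts) (i # p) = num_children (ts ! i) p"
  by (simp add: num_children_def)

lemma tree_weight_Node:
  "tree_weight w (Node ts) = w (length ts) * prod_list (map (tree_weight w) ts)"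
proof -
  have "tree_weight w (Node ts)
      = w (length ts) * (\<Prod>v\<in>(\<Union>i<length ts. (#) i ` vertices (ts ! i)). w (num_children (Node ts) v))"
    unfolding tree_weight_def vertices_Node
    by (subst prod.insert) (auto simp: num_children_def)
  also have "(\<Prod>v\<in>(\<Union>i<length ts. (#) i ` vertices (ts ! i)). w (num_children (Node ts) v))
      = (\<Prod>i<length ts. \<Prod>v\<in>(#) i ` vertices (ts ! i). w (num_children (Node ts) v))"
    by (rule prod.UNION_disjoint) auto
  also have "\<dots> = (\<Prod>i<length ts. tree_weight w (ts ! i))"
    unfolding tree_weight_def
    by (auto intro!: prod.cong simp: prod.reindex num_children_Cons)
  also have "\<dots> = prod_list (map (tree_weight w) ts)"
    by (simp add: prod.list_conv_set_nth atLeast0LessThan)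
  finally show ?thesis .
qed

lemma sum_num_children: "(\<Sum>v\<in>vertices t. num_children t v) = nv t - 1"
proof (induction t)
  case (Node ts)
  have "(\<Sum>v\<in>vertices (Node ts). num_children (Node ts) v)
      = length ts + (\<Sum>v\<in>(\<Union>i<length ts. (#) i ` vertices (ts ! i)). num_children (Node ts) v)"
    unfolding vertices_Node by (subst sum.insert) (auto simp: num_children_def)
  also have "(\<Sum>v\<in>(\<Union>i<length ts. (#) i ` vertices (ts ! i)). num_children (Node ts) v)
      = (\<Sum>i<length ts. \<Sum>v\<in>(#) i ` vertices (ts ! i). num_children (Node ts) v)"
    by (rule sum.UNION_disjoint) auto
  also have "\<dots> = (\<Sum>i<length ts. \<Sum>v\<in>vertices (ts ! i). num_children (ts ! i) v)"
    by (auto intro!: sum.cong simp: sum.reindex num_children_Cons)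
  also have "\<dots> = (\<Sum>i<length ts. nv (ts ! i) - 1)"
    by (intro sum.cong refl Node.IH) auto
  also have "length ts + \<dots> = (\<Sum>i<length ts. 1 + (nv (ts ! i) - 1))"
    by (simp add: sum.distrib sum_Suc)
  also have "\<dots> = (\<Sum>i<length ts. nv (ts ! i))"
    by (intro sum.cong refl) (use card_vertices_pos in \<open>simp add: Suc_le_eq\<close>)
  finally show ?case by (simp add: card_vertices_Node)
qed

lemma height_Nil: "height (Node []) = 0"
  by (simp add: height_def vertices_Node)

lemma height_Node:
  assumes "ts \<noteq> []"
  obtains c where "c \<in> set ts" "height (Node ts) \<le> Suc (height c)"
proof -
  have "height (Node ts) \<in> length ` vertices (Node ts)"
    unfolding height_def by (intro Max_in) (auto simp: vertices_Node)
  then obtain p where p: "p \<in> vertices (Node ts)" "height (Node ts) = length p" by auto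
  show thesis
  proof (cases p)
    case Nil
    then show thesis using that[of "hd ts"] p assms by auto
  next
    case (Cons i q)
    with p have iq: "i < length ts" "q \<in> vertices (ts ! i)" by (auto simp: vertices_Node)
    then have "length q \<le> height (ts ! i)" unfolding height_def by (intro Max_ge) auto
    then show thesis using that[of "ts ! i"] p Cons iq by auto
  qed
qed

lemma height_less_nv: "height t < nv t"
proof (induction t)
  case (Node ts)
  show ?case
  proof (cases "ts = []")
    case True
    then show ?thesis by (simp add: height_Nil card_vertices_pos)
  next
    case False
    then obtain c where c: "c \<in> set ts" "height (Node ts) \<le> Suc (height c)"
      by (rule height_Node)
    have "nv c \<le> sum_list (map nv ts)" using c(1) by (intro member_le_sum_list) auto
    then show ?thesis using c Node.IH[OF c(1)] by (simp add: nv_Node)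
  qed
qed

definition forests :: "nat \<Rightarrow> nat \<Rightarrow> plane_tree list set" where
  "forests j n = {ts. length ts = j \<and> sum_list (map nv ts) = n}"

lemma finite_forests: "finite (forests j n)"
proof (rule finite_subset)
  show "forests j n \<subseteq> {ts. set ts \<subseteq> {t. nv t \<le> n} \<and> length ts = j}"
    using member_le_sum_list[where xs = "map nv ts" for ts]
    by (auto simp: forests_def intro: member_le_sum_list)
  show "finite {ts. set ts \<subseteq> {t. nv t \<le> n} \<and> length ts = j}"
    by (rule finite_lists_length_eq[OF finite_trees_le])
qed

lemma length_le_sum_nv: "length ts \<le> sum_list (map nv ts)"
proof (induction ts)
  case (Cons t ts)
  then show ?case using card_vertices_pos[of t] by simp
qed simp

lemma forests_Suc_sum:
  fixes f :: "plane_tree \<Rightarrow> real"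
  shows "(\<Sum>ts\<in>forests (Suc j) n. f (hd ts) * h (tl ts))
    = (Abs_fps (\<lambda>i. \<Sum>t | nv t = i. f t) * Abs_fps (\<lambda>i. \<Sum>ts\<in>forests j i. h ts)) $ n"
proof -
  have "(Abs_fps (\<lambda>i. \<Sum>t | nv t = i. f t) * Abs_fps (\<lambda>i. \<Sum>ts\<in>forests j i. h ts)) $ n
      = (\<Sum>i=0..n. \<Sum>(t, ts)\<in>{t. nv t = i} \<times> forests j (n - i). f t * h ts)"
    by (simp add: fps_mult_nth sum_product sum.cartesian_product)
  also have "\<dots> = (\<Sum>(i, t, ts)\<in>(SIGMA i:{0..n}. {t. nv t = i} \<times> forests j (n - i)). f t * h ts)"
    by (subst sum.Sigma) (auto simp: finite_trees finite_forests split_def)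
  also have "\<dots> = (\<Sum>ts\<in>forests (Suc j) n. f (hd ts) * h (tl ts))"
    by (rule sum.reindex_bij_witness[where i = "\<lambda>ts. (nv (hd ts), hd ts, tl ts)"
          and j = "\<lambda>(i, t, ts). t # ts"])
       (auto simp: forests_def length_Suc_conv)
  finally show ?thesis by simp
qed

text \<open>The coefficient of index \<open>n\<close> is \<open>Z w n\<close> times the expectation
  of \<open>F\<close> under \<open>sg_tree w n\<close>. The unnormalised sums multiply as power
  series and make sense even if \<open>Z w n = 0\<close>.\<close>

definition tree_gf :: "(nat \<Rightarrow> real) \<Rightarrow> (plane_tree \<Rightarrow> real) \<Rightarrow> real fps" where
  "tree_gf w F = Abs_fps (\<lambda>n. \<Sum>t | nv t = n. tree_weight w t * F t)"

abbreviation Tf :: "(nat \<Rightarrow> real) \<Rightarrow> real fps" where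
  "Tf w \<equiv> Abs_fps (Z w)"

lemma Tf_alt: "Abs_fps (\<lambda>i. \<Sum>t | nv t = i. tree_weight w t) = Tf w"
  by (rule fps_ext) (simp add: Z_def)

lemma tree_gf_one: "tree_gf w (\<lambda>_. 1) = Tf w"
  by (simp add: tree_gf_def Z_def[abs_def])

lemma vertices_nonempty [simp]: "vertices t \<noteq> {}"
  using card_vertices_pos[of t] by auto

lemma tree_gf_0: "tree_gf w F $ 0 = 0"
  by (simp add: tree_gf_def)

lemma Z_0: "Z w 0 = 0"
  by (simp add: Z_def)

lemma Tf_power_nth:
  "Tf w ^ j $ n = (\<Sum>ts\<in>forests j n. prod_list (map (tree_weight w) ts))"
proof (induction j arbitrary: n)
  case 0
  have "forests 0 n = (if n = 0 then {[]} else {})" by (auto simp: forests_def)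
  then show ?case by simp
next
  case (Suc j)
  have "(\<Sum>ts\<in>forests (Suc j) n. prod_list (map (tree_weight w) ts))
     = (\<Sum>ts\<in>forests (Suc j) n. tree_weight w (hd ts) * prod_list (map (tree_weight w) (tl ts)))"
    by (intro sum.cong refl) (auto simp: forests_def length_Suc_conv)
  also have "\<dots> = (Tf w * Tf w ^ j) $ n"
    unfolding forests_Suc_sum[where f = "tree_weight w" and h = "\<lambda>ts. prod_list (map (tree_weight w) ts)"]
      Tf_alt Suc.IH[symmetric]
    by (simp add: fps_mult_nth)
  finally show ?case by simp
qed

lemma Tf_power_nth_eq_0: "n < j \<Longrightarrow> Tf w ^ j $ n = 0"
  by (rule startsby_zero_power_prefix[rule_format]) (simp_all add: Z_0)

text \<open>Any of the \<open>j\<close> trees may be the one that carries \<open>F\<close>; the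
  other \<open>j - 1\<close> contribute a factor \<open>Tf w\<close> each.\<close>

lemma forests_marked_sum:
  "(\<Sum>ts\<in>forests j n. prod_list (map (tree_weight w) ts) * sum_list (map F ts))
     = (of_nat j * Tf w ^ (j - 1) * tree_gf w F) $ n"
proof (induction j arbitrary: n)
  case 0
  show ?case by (auto simp: forests_def)
next
  case (Suc j)
  let ?W = "\<lambda>ts. prod_list (map (tree_weight w) ts)"
  have "(\<Sum>ts\<in>forests (Suc j) n. ?W ts * sum_list (map F ts))
     = (\<Sum>ts\<in>forests (Suc j) n. (tree_weight w (hd ts) * F (hd ts)) * ?W (tl ts))
     + (\<Sum>ts\<in>forests (Suc j) n. tree_weight w (hd ts) * (?W (tl ts) * sum_list (map F (tl ts))))"
    unfolding sum.distrib[symmetric]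
    by (intro sum.cong refl) (auto simp: forests_def length_Suc_conv algebra_simps)
  also have "\<dots> = (tree_gf w F * Tf w ^ j) $ n + (Tf w * (of_nat j * Tf w ^ (j - 1) * tree_gf w F)) $ n"
    unfolding forests_Suc_sum[where f = "\<lambda>t. tree_weight w t * F t" and h = ?W]
      forests_Suc_sum[where f = "tree_weight w" and h = "\<lambda>ts. ?W ts * sum_list (map F ts)"]
      Tf_alt Suc.IH tree_gf_def[symmetric] Tf_power_nth[symmetric]
    by (simp add: fps_nth_inverse)
  also have "\<dots> = (of_nat (Suc j) * Tf w ^ (Suc j - 1) * tree_gf w F) $ n"
    unfolding fps_add_nth[symmetric] by (cases j) (simp_all add: algebra_simps)
  finally show ?case .
qed

text \<open>This series counts trees in which a child of the root has been chosen and the subtree at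
  that child has been cut off.\<close>

definition Df :: "(nat \<Rightarrow> real) \<Rightarrow> real fps" where
  "Df w = fps_X * (fps_deriv (Abs_fps w) oo Tf w)"

lemma sum_over_trees_Suc:
  fixes h :: "plane_tree list \<Rightarrow> real"
  shows "(\<Sum>t | nv t = Suc n. h (children t)) = (\<Sum>j\<le>Suc n. \<Sum>ts\<in>forests j n. h ts)"
proof -
  have "(\<Sum>j\<le>Suc n. \<Sum>ts\<in>forests j n. h ts) = (\<Sum>(j, ts)\<in>(SIGMA j:{..Suc n}. forests j n). h ts)"
    by (subst sum.Sigma) (auto simp: finite_forests)
  also have "\<dots> = (\<Sum>t | nv t = Suc n. h (children t))"
    by (rule sum.reindex_bij_witness[where i = "\<lambda>t. (length (children t), children t)"
          and j = "\<lambda>(j, ts). Node ts"])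
       (use length_le_sum_nv in \<open>auto simp: forests_def nv_Node le_SucI split: plane_tree.splits
          dest!: arg_cong[of _ _ nv] intro!: le_SucI\<close>, 
        (metis Suc_inject length_le_sum_nv nv_Node plane_tree.collapse le_SucI)+)
  finally show ?thesis by simp
qed

text \<open>Choosing a child of the root splits the tree into the subtree at that child, which
  carries \<open>F\<close>, and a remainder counted by \<open>Df w\<close>. This turns every
  recursion over children into a multiplication by \<open>Df w\<close>.\<close>

lemma tree_gf_children:
  "tree_gf w (\<lambda>t. sum_list (map F (children t))) = Df w * tree_gf w F"
proof (rule fps_ext)
  fix n
  show "tree_gf w (\<lambda>t. sum_list (map F (children t))) $ n = (Df w * tree_gf w F) $ n"
  proof (cases n)
    case 0
    then show ?thesis by (simp add: tree_gf_0)
  next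
    case (Suc m)
    let ?P = "\<lambda>ts. prod_list (map (tree_weight w) ts)"
    let ?G = "tree_gf w F" and ?T = "Tf w"
    have "tree_gf w (\<lambda>t. sum_list (map F (children t))) $ n
        = (\<Sum>t | nv t = Suc m. (\<lambda>ts. w (length ts) * (?P ts * sum_list (map F ts))) (children t))"
      unfolding tree_gf_def Suc fps_nth_Abs_fps
      by (intro sum.cong refl) (metis (no_types, lifting) mult.assoc plane_tree.collapse tree_weight_Node)
    also have "\<dots> = (\<Sum>j\<le>Suc m. w j * (of_nat j * ?T ^ (j - 1) * ?G) $ m)"
      by (subst sum_over_trees_Suc, unfold forests_marked_sum[symmetric] sum_distrib_left,
          intro sum.cong refl) (simp add: forests_def)
    also have "\<dots> = (\<Sum>j\<le>m. w (Suc j) * (of_nat (Suc j) * ?T ^ j * ?G) $ m)"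
      by (subst sum.atMost_Suc_shift) simp
    also have "\<dots> = (\<Sum>j\<le>m. \<Sum>i=0..m. of_nat (Suc j) * w (Suc j) * (?T ^ j) $ i * ?G $ (m - i))"
    proof (intro sum.cong refl)
      fix j
      have "(of_nat (Suc j) * ?T ^ j * ?G) $ m = of_nat (Suc j) * (?T ^ j * ?G) $ m"
        unfolding mult.assoc fps_of_nat[symmetric] by simp
      then show "w (Suc j) * (of_nat (Suc j) * ?T ^ j * ?G) $ m
          = (\<Sum>i=0..m. of_nat (Suc j) * w (Suc j) * (?T ^ j) $ i * ?G $ (m - i))"
        unfolding fps_mult_nth[of "?T ^ j"] by (simp add: sum_distrib_left mult_ac)
    qed
    also have "\<dots> = (\<Sum>i=0..m. \<Sum>j\<le>m. of_nat (Suc j) * w (Suc j) * (?T ^ j) $ i * ?G $ (m - i))"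
      by (rule sum.swap)
    also have "\<dots> = (\<Sum>i=0..m. (fps_deriv (Abs_fps w) oo ?T) $ i * ?G $ (m - i))"
    proof (intro sum.cong refl)
      fix i assume i: "i \<in> {0..m}"
      have "(\<Sum>j\<le>m. of_nat (Suc j) * w (Suc j) * (?T ^ j) $ i)
          = (\<Sum>j=0..i. of_nat (Suc j) * w (Suc j) * (?T ^ j) $ i)"
        using i by (intro sum.mono_neutral_right) (auto simp: Tf_power_nth_eq_0)
      then show "(\<Sum>j\<le>m. of_nat (Suc j) * w (Suc j) * (?T ^ j) $ i * ?G $ (m - i))
          = (fps_deriv (Abs_fps w) oo ?T) $ i * ?G $ (m - i)"
        by (simp add: fps_compose_nth flip: sum_distrib_right)
    qed
    also have "\<dots> = (Df w * tree_gf w F) $ n"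
      unfolding Df_def Suc mult.assoc by (simp only: fps_X_mult_nth) (simp add: fps_mult_nth)
    finally show ?thesis .
  qed
qed

text \<open>Removing the root leaves an ordered forest with one tree per child.\<close>

lemma Tf_eq: "Tf w = fps_X * (Abs_fps w oo Tf w)"
proof (rule fps_ext)
  fix n
  show "Tf w $ n = (fps_X * (Abs_fps w oo Tf w)) $ n"
  proof (cases n)
    case 0
    then show ?thesis by (simp add: Z_0)
  next
    case (Suc m)
    let ?P = "\<lambda>ts. prod_list (map (tree_weight w) ts)"
    have "Tf w $ n = (\<Sum>t | nv t = Suc m. (\<lambda>ts. w (length ts) * ?P ts) (children t))"
      unfolding Suc fps_nth_Abs_fps Z_def
      by (intro sum.cong refl) (metis plane_tree.collapse tree_weight_Node)
    also have "\<dots> = (\<Sum>j\<le>Suc m. w j * Tf w ^ j $ m)"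
      by (subst sum_over_trees_Suc, unfold Tf_power_nth sum_distrib_left,
          intro sum.cong refl) (simp add: forests_def)
    also have "\<dots> = (\<Sum>j=0..m. w j * Tf w ^ j $ m)"
      by (intro sum.mono_neutral_right) (auto simp: Tf_power_nth_eq_0)
    finally show ?thesis by (simp add: Suc fps_compose_nth)
  qed
qed

section \<open>Lagrange inversion\<close>

locale weights =
  fixes w :: "nat \<Rightarrow> real"
  assumes nonneg: "\<And>k. w k \<ge> 0" and pos0: "w 0 > 0"
begin

abbreviation "\<Phi> \<equiv> Abs_fps w"
abbreviation "T \<equiv> Tf w"
abbreviation "D \<equiv> Df w"

text \<open>The compositional inverse of \<^term>\<open>T\<close>, see \<open>psi_T\<close> and \<open>T_psi\<close>.\<close>

definition \<psi> :: "real fps" where "\<psi> = fps_X * inverse \<Phi>"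

lemma Phi_inverse: "\<Phi> * inverse \<Phi> = 1" "inverse \<Phi> * \<Phi> = 1"
  using pos0 by (simp_all add: inverse_mult_eq_1 inverse_mult_eq_1')

lemma T_0: "T $ 0 = 0"
  by (simp add: Z_0)

lemma psi_0: "\<psi> $ 0 = 0"
  by (simp add: \<psi>_def)

lemma psi_Phi: "\<psi> * \<Phi> = fps_X"
  unfolding \<psi>_def mult.assoc Phi_inverse by simp

text \<open>Divide \<open>T = X \<Phi>(T)\<close> by \<open>\<Phi>(T)\<close>, whose constant term
  is \<open>w 0\<close>.\<close>

lemma psi_T: "\<psi> oo T = fps_X"
proof -
  have nz: "(\<Phi> oo T) $ 0 \<noteq> 0" using pos0 by simp
  have "\<psi> oo T = T * inverse (\<Phi> oo T)"
    unfolding \<psi>_def using T_0 pos0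
    by (subst fps_compose_mult_distrib) (simp_all add: fps_inverse_compose)
  also have "\<dots> = fps_X * ((\<Phi> oo T) * inverse (\<Phi> oo T))"
    by (subst Tf_eq) (simp only: mult.assoc)
  also have "\<dots> = fps_X" by (simp only: inverse_mult_eq_1'[OF nz] mult_1_right)
  finally show ?thesis .
qed

text \<open>The linear coefficient of \<open>\<psi>\<close> is \<open>1 / w 0\<close>, so
  \<open>\<psi>\<close> has a two-sided compositional inverse, and the one-sided inverse
  \<open>T\<close> coincides with it.\<close>

lemma T_psi: "T oo \<psi> = fps_X"
proof -
  have psi1: "\<psi> $ 1 \<noteq> 0" using pos0 by (simp add: \<psi>_def)
  have "T = (fps_inv \<psi> oo \<psi>) oo T"
    using T_0 by (simp add: fps_inv[OF psi_0 psi1])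
  also have "\<dots> = fps_inv \<psi>"
    unfolding fps_compose_assoc[OF T_0 psi_0, symmetric] psi_T by simp
  finally show ?thesis by (simp add: fps_inv[OF psi_0 psi1])
qed

text \<open>Since \<open>\<psi> \<Phi> = X\<close>, with \<open>j = k - m\<close> the left side is
  the coefficient of index \<open>j\<close> of \<open>\<Phi>^j - z \<Phi>' \<Phi>^(j-1)\<close> when
  \<open>j > 0\<close>. It vanishes because \<open>z \<Phi>' \<Phi>^(j-1)\<close> is
  \<open>z (\<Phi>^j)' / j\<close>. So this functional reads off coefficients of a series in powers
  of \<open>\<psi>\<close>.\<close>

lemma psi_power_nth:
  assumes "m \<le> k"
  shows "(\<psi> ^ m * ((1 - \<psi> * fps_deriv \<Phi>) * \<Phi> ^ k)) $ k = (if m = k then 1 else 0)"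
proof -
  obtain j where k: "k = m + j" using assms le_Suc_ex by blast
  have "\<psi> ^ m * ((1 - \<psi> * fps_deriv \<Phi>) * \<Phi> ^ k)
      = (\<psi> * \<Phi>) ^ m * (\<Phi> ^ j - \<psi> * fps_deriv \<Phi> * \<Phi> ^ j)"
    by (simp add: k power_add power_mult_distrib algebra_simps)
  then have *: "(\<psi> ^ m * ((1 - \<psi> * fps_deriv \<Phi>) * \<Phi> ^ k)) $ k
      = (\<Phi> ^ j - \<psi> * fps_deriv \<Phi> * \<Phi> ^ j) $ j"
    by (simp add: psi_Phi k fps_X_power_mult_nth)
  show ?thesis
  proof (cases j)
    case 0
    then show ?thesis using * by (simp add: k psi_0)
  next
    case (Suc i)
    have "\<psi> * fps_deriv \<Phi> * \<Phi> ^ j = (\<psi> * \<Phi>) * (fps_deriv \<Phi> * \<Phi> ^ i)"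
      by (simp add: Suc algebra_simps)
    then have "(\<psi> * fps_deriv \<Phi> * \<Phi> ^ j) $ j = (fps_X * (fps_deriv \<Phi> * \<Phi> ^ i)) $ Suc i"
      by (simp only: psi_Phi Suc)
    then have "real j * (\<psi> * fps_deriv \<Phi> * \<Phi> ^ j) $ j = real (Suc i) * (fps_deriv \<Phi> * \<Phi> ^ i) $ i"
      by (simp only: fps_X_mult_nth Suc) simp
    also have "\<dots> = (fps_const (real (Suc i)) * fps_deriv \<Phi> * \<Phi> ^ i) $ i"
      by (simp only: mult.assoc fps_mult_left_const_nth)
    also have "\<dots> = fps_deriv (\<Phi> ^ Suc i) $ i"
      by (simp only: fps_deriv_power diff_Suc_1)
    also have "\<dots> = real j * (\<Phi> ^ j) $ j" by (simp only: fps_deriv_nth Suc) simp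
    finally show ?thesis using * Suc k by simp
  qed
qed

text \<open>Substituting \<open>\<psi>\<close> for the variable turns the hypothesis into
  \<open>H = C(\<psi>) (1 - \<psi> \<Phi>')\<close>. After expanding \<open>C(\<psi>)\<close> in
  powers of \<open>\<psi>\<close>, \<open>psi_power_nth\<close> picks out
  \<open>C $ k\<close>.\<close>

lemma lagrange_buermann:
  assumes "C * (1 - D) = H oo T"
  shows "C $ k = (H * \<Phi> ^ k) $ k"
proof -
  have D_psi: "D oo \<psi> = \<psi> * fps_deriv \<Phi>"
    unfolding Df_def
    by (simp add: fps_compose_mult_distrib psi_0 T_psi fps_compose_assoc[OF psi_0 T_0, symmetric])
  have "H = (H oo T) oo \<psi>"
    by (simp add: fps_compose_assoc[OF psi_0 T_0, symmetric] T_psi)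
  also have "\<dots> = (C oo \<psi>) * (1 - \<psi> * fps_deriv \<Phi>)"
    unfolding assms[symmetric] 
    by (simp add: fps_compose_mult_distrib[OF psi_0] fps_compose_sub_distrib D_psi)
  finally have H: "H * \<Phi> ^ k = (C oo \<psi>) * ((1 - \<psi> * fps_deriv \<Phi>) * \<Phi> ^ k)"
    by (simp only: mult.assoc)
  define G where "G = (1 - \<psi> * fps_deriv \<Phi>) * \<Phi> ^ k"
  have "(H * \<Phi> ^ k) $ k = (\<Sum>i=0..k. (\<Sum>m=0..i. C $ m * \<psi> ^ m $ i) * G $ (k - i))"
    unfolding H G_def[symmetric] fps_mult_nth[of "C oo \<psi>"] fps_compose_nth ..
  \<comment> \<open>\<open>\<psi>\<close> has no constant term, so \<open>\<psi>^m\<close> has no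
    coefficient below index \<open>m\<close>, and the inner range can be made independent of
    \<open>i\<close>.\<close>
  also have "\<dots> = (\<Sum>i=0..k. (\<Sum>m=0..k. C $ m * \<psi> ^ m $ i) * G $ (k - i))"
  proof (intro sum.cong refl)
    fix i assume "i \<in> {0..k}"
    then have "(\<Sum>m=0..i. C $ m * \<psi> ^ m $ i) = (\<Sum>m=0..k. C $ m * \<psi> ^ m $ i)"
      using psi_0 by (intro sum.mono_neutral_left) (auto intro: startsby_zero_power_prefix[rule_format])
    then show "(\<Sum>m=0..i. C $ m * \<psi> ^ m $ i) * G $ (k - i) = (\<Sum>m=0..k. C $ m * \<psi> ^ m $ i) * G $ (k - i)"
      by simp
  qed
  also have "\<dots> = (\<Sum>i=0..k. \<Sum>m=0..k. C $ m * (\<psi> ^ m $ i * G $ (k - i)))"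
    by (simp add: sum_distrib_right mult.assoc)
  also have "\<dots> = (\<Sum>m=0..k. C $ m * (\<psi> ^ m * G) $ k)"
    unfolding fps_mult_nth[of "\<psi> ^ _"] sum_distrib_left by (rule sum.swap)
  also have "\<dots> = (\<Sum>m=0..k. if m = k then C $ m else 0)"
    unfolding G_def by (intro sum.cong refl) (simp add: psi_power_nth)
  also have "\<dots> = C $ k" by simp
  finally show ?thesis by simp
qed

text \<open>Multiplication by \<^term>\<open>D\<close> attaches a tree as a child of the root of a new one, so
  \<open>B g\<close> counts trees marked at a vertex of height at least \<open>g\<close>.\<close>

definition B :: "nat \<Rightarrow> real fps" where "B g = D ^ g * (fps_X * fps_deriv T)"

lemma B_0_nth: "B 0 $ k = real k * Z w k"
  by (cases k) (simp_all add: B_def)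

text \<open>A marked vertex is the root or lies in the subtree at exactly one child of the root.
  Formally, this is \<open>X\<close> times the derivative of \<open>Tf_eq\<close>.\<close>

lemma XT': "fps_X * fps_deriv T = T + D * (fps_X * fps_deriv T)"
proof -
  have "fps_deriv T = fps_deriv (fps_X * (\<Phi> oo T))"
    by (subst Tf_eq) (rule refl)
  also have "\<dots> = (\<Phi> oo T) + fps_X * ((fps_deriv \<Phi> oo T) * fps_deriv T)"
    using T_0 by (simp add: fps_compose_deriv)
  finally have "fps_X * fps_deriv T = fps_X * (\<Phi> oo T) + fps_X * (fps_X * ((fps_deriv \<Phi> oo T) * fps_deriv T))"
    by (metis distrib_left)
  also have "fps_X * (\<Phi> oo T) = T" by (rule Tf_eq[symmetric])
  also have "fps_X * (fps_X * ((fps_deriv \<Phi> oo T) * fps_deriv T)) = D * (fps_X * fps_deriv T)"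
    unfolding Df_def by (simp only: mult_ac)
  finally show ?thesis .
qed

text \<open>By \<open>XT'\<close>, \<open>B g (1 - D)\<close> equals \<open>D^g T\<close>, a series
  in \<open>T\<close>, so \<open>lagrange_buermann\<close> applies. The \<open>g\<close> factors
  \<open>\<psi>\<close> are cleared with \<open>g\<close> of the \<open>k\<close> factors
  \<open>\<Phi>\<close>.\<close>

lemma B_nth:
  assumes "g \<le> k"
  shows "B g $ k = (fps_X * ((fps_X * fps_deriv \<Phi>) ^ g * \<Phi> ^ (k - g))) $ k"
proof -
  have D: "D = (\<psi> * fps_deriv \<Phi>) oo T"
    unfolding Df_def by (simp add: fps_compose_mult_distrib[OF T_0] psi_T)
  have "B g * (1 - D) = D ^ g * (fps_X * fps_deriv T - D * (fps_X * fps_deriv T))"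
    unfolding B_def by (simp add: algebra_simps)
  also have "fps_X * fps_deriv T - D * (fps_X * fps_deriv T) = T"
    using XT' by (metis add_diff_cancel_right')
  also have "D ^ g * T = (((\<psi> * fps_deriv \<Phi>) ^ g) * fps_X) oo T"
    unfolding D fps_compose_power[OF T_0]
    by (simp only: fps_compose_mult_distrib[OF T_0, of "_ ^ g"] fps_X_fps_compose_startby0[OF T_0])
  finally have "B g $ k = ((\<psi> * fps_deriv \<Phi>) ^ g * fps_X * \<Phi> ^ k) $ k"
    by (rule lagrange_buermann)
  also have "\<Phi> ^ k = \<Phi> ^ g * \<Phi> ^ (k - g)" using assms by (simp flip: power_add)
  also have "(\<psi> * fps_deriv \<Phi>) ^ g * fps_X * (\<Phi> ^ g * \<Phi> ^ (k - g))
      = fps_X * (((\<psi> * \<Phi>) * fps_deriv \<Phi>) ^ g * \<Phi> ^ (k - g))"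
    by (simp add: power_mult_distrib algebra_simps)
  finally show ?thesis by (simp add: psi_Phi)
qed

lemma Z_nth: "real k * Z w k = (fps_X * \<Phi> ^ k) $ k"
  using B_nth[of 0 k] by (simp add: B_0_nth)

end

text \<open>Expanding \<open>(\<Phi> + l z \<Phi>')^k\<close> in Lagrange's formula for the tilted weights relates the height of a
  uniform vertex to the expectation of \<open>\<Prod>v. (1 + l * d v)\<close>.\<close>

lemma (in weights) Z_tilt:
  assumes "l \<ge> 0"
  shows "real k * Z (\<lambda>j. w j * (1 + l * real j)) k = (\<Sum>j\<le>k. real (k choose j) * l ^ j * B j $ k)"
proof -
  interpret w': weights "\<lambda>j. w j * (1 + l * real j)"
    by unfold_locales (use nonneg pos0 assms in auto)
  have eq: "Abs_fps (\<lambda>j. w j * (1 + l * real j)) = fps_const l * (fps_X * fps_deriv \<Phi>) + \<Phi>"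
  proof (rule fps_ext)
    fix n show "Abs_fps (\<lambda>j. w j * (1 + l * real j)) $ n = (fps_const l * (fps_X * fps_deriv \<Phi>) + \<Phi>) $ n"
      by (cases n) (simp_all add: algebra_simps)
  qed
  have "real k * Z (\<lambda>j. w j * (1 + l * real j)) k
      = (\<Sum>j\<le>k. fps_X * (of_nat (k choose j) * (fps_const l * (fps_X * fps_deriv \<Phi>)) ^ j * \<Phi> ^ (k - j))) $ k"
    unfolding w'.Z_nth eq binomial_ring sum_distrib_left ..
  also have "\<dots> = (\<Sum>j\<le>k. real (k choose j) * l ^ j * B j $ k)"
    unfolding fps_sum_nth
  proof (intro sum.cong refl)
    fix j assume "j \<in> {..k}"
    have "fps_X * (of_nat (k choose j) * (fps_const l * (fps_X * fps_deriv \<Phi>)) ^ j * \<Phi> ^ (k - j))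
      = fps_const (real (k choose j) * l ^ j) * (fps_X * ((fps_X * fps_deriv \<Phi>) ^ j * \<Phi> ^ (k - j)))"
      by (simp add: power_mult_distrib fps_const_power[symmetric] fps_of_nat[symmetric]
          fps_const_mult[symmetric] algebra_simps del: fps_const_power fps_const_mult)
    then show "(fps_X * (of_nat (k choose j) * (fps_const l * (fps_X * fps_deriv \<Phi>)) ^ j * \<Phi> ^ (k - j))) $ k
       = real (k choose j) * l ^ j * B j $ k"
      using \<open>j \<in> {..k}\<close> by (simp only: fps_mult_left_const_nth B_nth atMost_iff)
  qed
  finally show ?thesis .
qed

section \<open>Segments of a longest path\<close>

text \<open>\<open>big m g t\<close> is the number of vertices at height \<open>g\<close> whose fringe subtree has more than
  \<open>m / 2\<close> vertices.
  \<open>tops m g t\<close> adds up \<open>big m g\<close> over the maximal fringe subtrees of \<open>t\<close> of size at most \<open>m\<close>.\<close>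

primrec big :: "real \<Rightarrow> nat \<Rightarrow> plane_tree \<Rightarrow> real" where
  "big m 0 = (\<lambda>t. if m < 2 * real (nv t) then 1 else 0)"
| "big m (Suc g) = (\<lambda>t. sum_list (map (big m g) (children t)))"

fun tops :: "real \<Rightarrow> nat \<Rightarrow> plane_tree \<Rightarrow> real" where
  "tops m g (Node ts) =
     (if real (nv (Node ts)) \<le> m then big m g (Node ts) else sum_list (map (tops m g) ts))"

lemma big_nonneg: "big m g t \<ge> 0"
  by (induction g arbitrary: t) (auto intro!: sum_list_nonneg)

lemma nv_child: "c \<in> set (children t) \<Longrightarrow> nv c < nv t"
  using member_le_sum_list[of "nv c" "map nv (children t)"]
  by (cases t) (auto simp: nv_Node)

lemma big_eq_0: "nv t \<le> g \<Longrightarrow> big m g t = 0"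
proof (induction g arbitrary: t)
  case 0
  then show ?case using card_vertices_pos[of t] by simp
next
  case (Suc g)
  then have "big m g c = 0" if "c \<in> set (children t)" for c
    using nv_child[OF that] by simp
  then show ?case by (simp add: sum_list_0 cong: map_cong)
qed

lemma big_small_eq_0: "2 * real (nv t) \<le> m \<Longrightarrow> big m g t = 0"
proof (induction g arbitrary: t)
  case 0
  then show ?case by simp
next
  case (Suc g)
  then have "big m g c = 0" if "c \<in> set (children t)" for c
    using nv_child[OF that] by simp
  then show ?case by (simp add: sum_list_0 cong: map_cong)
qed

lemma tops_nonneg: "tops m g t \<ge> 0"
  by (induction t) (auto intro!: sum_list_nonneg big_nonneg)

lemma tops_le: "real (nv t) \<le> m \<Longrightarrow> tops m g t = big m g t"
  by (cases t) simp

lemma tops_greater: "real (nv t) > m \<Longrightarrow> tops m g t = sum_list (map (tops m g) (children t))"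
  by (cases t) simp

declare tops.simps [simp del] big.simps [simp del]

text \<open>\<open>tops m 0\<close> counts disjoint fringe subtrees, each with more than
  \<open>m / 2\<close> vertices.\<close>

lemma tops_0_le: "m * tops m 0 t \<le> 2 * real (nv t)"
proof (induction t)
  case (Node ts)
  show ?case
  proof (cases "real (nv (Node ts)) \<le> m")
    case True
    then show ?thesis by (simp add: tops_le big.simps)
  next
    case False
    then have "m * tops m 0 (Node ts) = sum_list (map (\<lambda>t. m * tops m 0 t) ts)"
      by (simp add: tops_greater sum_list_const_mult)
    also have "\<dots> \<le> sum_list (map (\<lambda>t. 2 * real (nv t)) ts)"
      by (intro sum_list_mono Node.IH)
    also have "\<dots> = 2 * real (sum_list (map nv ts))"
      by (induction ts) auto
    finally show ?thesis by (simp add: nv_Node)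
  qed
qed

lemma sum_list_ge_member:
  fixes f :: "'a \<Rightarrow> real"
  assumes "\<And>x. f x \<ge> 0" "c \<in> set xs"
  shows "f c \<le> sum_list (map f xs)"
  using assms by (intro member_le_sum_list) auto

text \<open>Along a path to a deepest vertex the sizes of the fringe subtrees decrease; every vertex of
  the path belongs to exactly one dyadic class of sizes, and the vertices of one class are
  consecutive.\<close>

lemma height_le_tops:
  fixes n I N :: nat
  defines "m \<equiv> \<lambda>i. real n / 2 ^ i"
  assumes "nv t \<le> n" "nv t \<le> N"
  shows "real (height t) \<le> m I + (\<Sum>i<I. \<Sum>g<N. min 1 (tops (m i) g t))"
  using assms(2,3)
proof (induction t)
  case (Node ts)
  let ?t = "Node ts"
  let ?L = "\<lambda>t i. \<Sum>g<N. min 1 (tops (m i) g t)"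
  have L0: "?L t i \<ge> 0" for t i
    by (intro sum_nonneg) (simp add: tops_nonneg)
  have m0: "m I \<ge> 0" by (simp add: m_def)
  have mmono: "m j \<le> m i" if "i \<le> j" for i j
    unfolding m_def using that by (intro divide_left_mono) auto
  have msuc: "m (Suc i) = m i / 2" for i by (simp add: m_def)
  show ?case
  proof (cases "real (nv ?t) \<le> m I")
    case True
    then show ?thesis using height_less_nv[of ?t] L0 m0 sum_nonneg[of "{..<I}" "?L ?t"] by force
  next
    case False
    show ?thesis
    proof (cases "ts = []")
      case True
      then show ?thesis using L0 m0 sum_nonneg[of "{..<I}" "?L ?t"] by (simp add: height_Nil)
    next
      case nonempty: False
      obtain c where c: "c \<in> set ts" "height ?t \<le> Suc (height c)"
        using height_Node[OF nonempty] by blast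
      have nvc: "nv c < nv ?t" using nv_child[of c ?t] c(1) by simp
      have IH: "real (height c) \<le> m I + (\<Sum>i<I. ?L c i)"
        using Node.IH[OF c(1)] Node.prems nvc by simp
      \<comment> \<open>\<open>i\<close> is the dyadic class of \<open>?t\<close>, that is,
        \<open>m (Suc i) < nv ?t \<le> m i\<close>. The least index is positive because
        \<open>nv ?t \<le> n = m 0\<close>.\<close>
      define i where "i = (LEAST i. real (nv ?t) > m i) - 1"
      have ex: "real (nv ?t) > m I" using False by simp
      have L: "real (nv ?t) > m (LEAST i. real (nv ?t) > m i)" by (rule LeastI, rule ex)
      have "(LEAST i. real (nv ?t) > m i) \<noteq> 0"
      proof
        assume "(LEAST i. real (nv ?t) > m i) = 0"
        with L have "real (nv ?t) > m 0" by simp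
        then show False using Node.prems(1) by (simp add: m_def)
      qed
      then have Suc_i: "(LEAST i. real (nv ?t) > m i) = Suc i" by (simp add: i_def)
      have i1: "real (nv ?t) > m (Suc i)" using L Suc_i by simp
      have i2: "real (nv ?t) \<le> m i"
        using not_less_Least[of i "\<lambda>i. real (nv ?t) > m i"] Suc_i by simp
      have iI: "i < I" using Least_le[of "\<lambda>i. real (nv ?t) > m i", OF ex] Suc_i by simp
      \<comment> \<open>Passing from \<open>c\<close> to \<open>?t\<close> must gain 1 in class
        \<open>i\<close> and lose nothing elsewhere. For \<open>j < i\<close>, \<open>c\<close> has
        at most \<open>m j / 2\<close> vertices and contributes nothing; for \<open>j > i\<close>,
        \<open>?t\<close> is larger than \<open>m j\<close>, so \<open>tops\<close> descends to the
        children; for \<open>j = i\<close>, the root of \<open>?t\<close> prolongs the segment by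
        one.\<close>
      have step: "?L c j + (if j = i then 1 else 0) \<le> ?L ?t j" if "j < I" for j
      proof -
        consider "j < i" | "j = i" | "j > i" by linarith
        then show ?thesis
        proof cases
          case 1
          have "m i \<le> m (Suc j)" using 1 by (intro mmono) simp
          then have "2 * real (nv ?t) \<le> m j" using i2 msuc[of j] by simp
          then have "2 * real (nv c) \<le> m j" "real (nv c) \<le> m j" using nvc by linarith+
          then have "?L c j = 0" by (simp add: tops_le big_small_eq_0)
          then show ?thesis using 1 L0[of j ?t] by simp
        next
          case 3
          have "m j \<le> m (Suc i)" using 3 by (intro mmono) simp
          then have gt: "real (nv ?t) > m j" using i1 by simp
          have "tops (m j) g c \<le> tops (m j) g ?t" for g
            unfolding tops_greater[OF gt] using c(1) tops_nonneg by (simp add: sum_list_ge_member)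
          then have "?L c j \<le> ?L ?t j" by (intro sum_mono min.mono) auto
          then show ?thesis using 3 by simp
        next
          case 2
          have le: "real (nv c) \<le> m i" using nvc i2 by simp
          obtain N' where N': "N = Suc N'" using Node.prems(2) card_vertices_pos[of ?t]
            by (cases N) auto
          \<comment> \<open>Shifting \<open>g\<close> by one loses the last summand for
            \<open>c\<close>, which is zero because \<open>c\<close> has at most \<open>N'\<close>
            vertices.\<close>
          have "big (m i) N' c = 0" using Node.prems(2) nvc N' by (intro big_eq_0) simp
          then have "?L c i = (\<Sum>g<N'. min 1 (big (m i) g c))"
            by (simp add: N' tops_le[OF le])
          also have "\<dots> \<le> (\<Sum>g<N'. min 1 (big (m i) (Suc g) ?t))"
            using c(1) by (intro sum_mono min.mono) (auto simp: big.simps intro!: sum_list_ge_member big_nonneg)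
          finally have "?L c i + 1 \<le> min 1 (big (m i) 0 ?t) + (\<Sum>g<N'. min 1 (big (m i) (Suc g) ?t))"
            using i1 msuc[of i] by (simp add: big.simps(1))
          also have "\<dots> = ?L ?t i"
            unfolding N' tops_le[OF i2] by (rule sum.lessThan_Suc_shift[symmetric])
          finally show ?thesis using 2 by simp
        qed
      qed
      have "(\<Sum>j<I. ?L c j) + 1 = (\<Sum>j<I. ?L c j + (if j = i then 1 else 0))"
        using iI by (simp add: sum.distrib)
      also have "\<dots> \<le> (\<Sum>j<I. ?L ?t j)"
        by (intro sum_mono step) simp
      finally show ?thesis using IH c(2) by linarith
    qed
  qed
qed

section \<open>Expected length of the segments in one dyadic class\<close>

lemma fps_mult_mono_left:
  fixes F G H :: "real fps"
  assumes "\<And>i. F $ i \<ge> 0" "\<And>i. i \<le> k \<Longrightarrow> G $ i \<le> H $ i"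
  shows "(F * G) $ k \<le> (F * H) $ k"
  unfolding fps_mult_nth using assms by (intro sum_mono mult_left_mono) auto

lemma fps_power_nonneg:
  fixes F :: "real fps"
  assumes "\<And>i. F $ i \<ge> 0"
  shows "(F ^ j) $ k \<ge> 0"
proof (induction j arbitrary: k)
  case (Suc j)
  then show ?case unfolding power_Suc fps_mult_nth using assms by (intro sum_nonneg) auto
qed auto

text \<open>The first \<open>a\<close> terms are at most 1, and the others are bounded by a
  geometric series with sum 2.\<close>

lemma min_sum_geometric: "(\<Sum>j<n. min 1 (2 ^ a / 2 ^ j)) \<le> real a + 2"
proof -
  have "(\<Sum>j<n. min 1 (2 ^ a / 2 ^ j)) \<le> (\<Sum>j<a + n. min 1 (2 ^ a / 2 ^ j :: real))"
    by (intro sum_mono2) auto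
  also have "\<dots> = (\<Sum>j<a. min 1 (2 ^ a / 2 ^ j)) + (\<Sum>j\<in>{a..<a+n}. min 1 (2 ^ a / 2 ^ j))"
    by (subst sum.union_disjoint[symmetric]) (auto intro!: sum.cong)
  also have "\<dots> \<le> (\<Sum>j<a. 1) + (\<Sum>j\<in>{a..<a+n}. (2 ^ a / 2 ^ j))"
    by (intro add_mono sum_mono) auto
  also have "(\<Sum>j\<in>{a..<a+n}. (2 ^ a / 2 ^ j :: real)) = (\<Sum>j<n. (1 / 2) ^ j)"
    by (rule sum.reindex_bij_witness[where i = "\<lambda>j. j + a" and j = "\<lambda>j. j - a"])
       (auto simp: power_diff field_simps)
  also have "\<dots> \<le> 2"
    by (subst geometric_sum) auto
  finally show ?thesis by simp
qed

lemma sum_div_le: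
  fixes f :: "nat \<Rightarrow> real"
  assumes "g > 0" "\<And>j. f j \<ge> 0"
  shows "(\<Sum>i<n. f (i div g)) \<le> real g * (\<Sum>j<n. f j)"
proof -
  have "(\<Sum>i<n. f (i div g)) \<le> (\<Sum>i<n * g. f (i div g))"
    using assms by (intro sum_mono2) auto
  also have "\<dots> = (\<Sum>j<n. \<Sum>i\<in>{j * g..<j * g + g}. f (i div g))"
    by (rule sum.nat_group[symmetric])
  also have "\<dots> = (\<Sum>j<n. \<Sum>i\<in>{j * g..<j * g + g}. f j)"
  proof (intro sum.cong refl arg_cong[of _ _ f])
    fix j i assume "i \<in> {j * g..<j * g + g}"
    then show "i div g = j" using assms(1) by (intro div_nat_eqI) (auto simp: mult.commute)
  qed
  finally show ?thesis by (simp add: sum_distrib_left)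
qed

context weights begin

lemma tree_weight_nonneg: "tree_weight w t \<ge> 0"
  unfolding tree_weight_def by (intro prod_nonneg ballI nonneg)

lemma Z_nonneg: "Z w n \<ge> 0"
  unfolding Z_def by (intro sum_nonneg tree_weight_nonneg)

lemma D_nonneg: "D $ i \<ge> 0"
proof (cases i)
  case (Suc j)
  have "(T ^ a) $ b \<ge> 0" for a b by (intro fps_power_nonneg) (simp add: Z_nonneg)
  then show ?thesis
    by (simp add: Df_def Suc fps_compose_nth sum_nonneg nonneg)
qed (simp add: Df_def)

lemma D_0: "D $ 0 = 0"
  by (simp add: Df_def)

lemma B_Suc: "B (Suc g) = D * B g"
  by (simp add: B_def mult.assoc)

lemma B_nonneg: "B g $ k \<ge> 0"
proof (induction g arbitrary: k)
  case 0
  show ?case by (simp add: B_0_nth Z_nonneg)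
next
  case (Suc g)
  then show ?case by (auto simp: B_Suc fps_mult_nth intro!: sum_nonneg mult_nonneg_nonneg D_nonneg)
qed

text \<open>By \<open>XT'\<close>, \<open>B 0\<close> exceeds \<open>B 1\<close> by the nonnegative
  series \<open>T\<close>; multiplication by \<open>D\<close> propagates the inequality.\<close>

lemma B_antimono_Suc: "B (Suc g) $ k \<le> B g $ k"
proof (induction g arbitrary: k)
  case 0
  have "B 0 = T + B (Suc 0)" unfolding B_Suc using XT' by (simp add: B_def)
  then have "B 0 $ k = Z w k + B (Suc 0) $ k" by simp
  then show ?case using Z_nonneg[of k] by simp
next
  case (Suc g)
  then show ?case unfolding B_Suc[of "Suc g"] B_Suc[of g]
    by (intro fps_mult_mono_left D_nonneg) (simp add: B_Suc)
qed

lemma B_antimono: "g \<le> h \<Longrightarrow> B h $ k \<le> B g $ k"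
  by (rule lift_Suc_antimono_le[of "\<lambda>g. B g $ k"]) (simp_all add: B_antimono_Suc)

lemma tree_gf_mono: "(\<And>t. nv t = k \<Longrightarrow> F t \<le> G t) \<Longrightarrow> tree_gf w F $ k \<le> tree_gf w G $ k"
  by (auto simp: tree_gf_def intro!: sum_mono mult_left_mono tree_weight_nonneg)

lemma tree_gf_big_Suc: "tree_gf w (big m (Suc g)) = D * tree_gf w (big m g)"
  unfolding tree_gf_children[symmetric] by (simp add: big.simps)

lemma tree_gf_big: "tree_gf w (big m (g + h)) = D ^ g * tree_gf w (big m h)"
  by (induction g) (simp_all add: tree_gf_big_Suc mult.assoc)

lemma tree_gf_big_0: "tree_gf w (big m 0) $ k = (if m < 2 * real k then Z w k else 0)"
  by (simp add: tree_gf_def Z_def big.simps)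

lemma tree_gf_big_small: "2 * real k \<le> m \<Longrightarrow> tree_gf w (big m g) $ k = 0"
  by (simp add: tree_gf_def big_small_eq_0)

text \<open>A fringe subtree with \<open>i > m / 2\<close> vertices is counted once on the left,
  whereas marking one of its vertices counts it with weight \<open>2 i / m > 1\<close> on the
  right.\<close>

lemma tree_gf_big_le_B:
  assumes "m > 0"
  shows "tree_gf w (big m g) $ k \<le> 2 / m * B g $ k"
proof -
  have "tree_gf w (big m g) $ k = (D ^ g * tree_gf w (big m 0)) $ k"
    using tree_gf_big[of m g 0] by simp
  also have "\<dots> \<le> (D ^ g * (fps_const (2 / m) * B 0)) $ k"
  proof (intro fps_mult_mono_left fps_power_nonneg D_nonneg)
    fix i show "tree_gf w (big m 0) $ i \<le> (fps_const (2 / m) * B 0) $ i"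
      using assms Z_nonneg[of i] mult_right_mono[of 1 "2 * real i / m" "Z w i"]
      by (auto simp: tree_gf_big_0 B_0_nth field_simps)
  qed
  also have "D ^ g * (fps_const (2 / m) * B 0) = fps_const (2 / m) * B g"
    by (simp add: B_def mult_ac)
  finally show ?thesis by simp
qed

text \<open>Fringe subtrees of a tree of size at most \<open>m\<close> again have size at most
  \<open>m\<close>, so the hypothesis applies to those at height \<open>h\<close>: every
  \<open>g\<close> further generations halve the count of big vertices.\<close>

lemma tree_gf_big_iterate:
  assumes m: "m > 0"
    and core: "\<And>k. m < 2 * real k \<Longrightarrow> real k \<le> m \<Longrightarrow> B g $ k \<le> 1 / 4 * (real k * Z w k)"
    and k: "real k \<le> m"
  shows "tree_gf w (big m h) $ k \<le> 2 * (1 / 2) ^ (h div g) * tree_gf w (big m 0) $ k"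
proof -
  \<comment> \<open>The factor \<open>2 / m\<close> of \<open>tree_gf_big_le_B\<close> times
    \<open>k / 4\<close> is at most \<open>1 / 2\<close>, as \<open>k \<le> m\<close>. For
    \<open>k \<le> m / 2\<close> both sides vanish.\<close>
  have half: "tree_gf w (big m g) $ k \<le> 1 / 2 * tree_gf w (big m 0) $ k" if k: "real k \<le> m" for k
  proof (cases "m < 2 * real k")
    case True
    have "tree_gf w (big m g) $ k \<le> 2 / m * (1 / 4 * (real k * Z w k))"
      using tree_gf_big_le_B[OF m, of g k] core[OF True k] m
        mult_left_mono[of "B g $ k" "1 / 4 * (real k * Z w k)" "2 / m"] by simp
    also have "\<dots> = 1 / 2 * Z w k * (real k / m)" by simp
    also have "\<dots> \<le> 1 / 2 * Z w k * 1"
      using k m Z_nonneg[of k] by (intro mult_left_mono) auto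
    finally show ?thesis using True by (simp add: tree_gf_big_0)
  qed (simp add: tree_gf_big_small tree_gf_big_0)
  have step: "tree_gf w (big m (h + g)) $ k \<le> 1 / 2 * tree_gf w (big m h) $ k" if k: "real k \<le> m" for h k
  proof -
    have "tree_gf w (big m (h + g)) $ k = (D ^ h * tree_gf w (big m g)) $ k"
      by (simp add: tree_gf_big)
    also have "\<dots> \<le> (D ^ h * (fps_const (1 / 2) * tree_gf w (big m 0))) $ k"
      using k half by (intro fps_mult_mono_left fps_power_nonneg D_nonneg) auto
    also have "D ^ h * (fps_const (1 / 2) * tree_gf w (big m 0)) = fps_const (1 / 2) * tree_gf w (big m h)"
      using tree_gf_big[of m h 0] by (simp add: mult_ac)
    finally show ?thesis by simp
  qed
  \<comment> \<open>This treats the remaining \<open>h mod g\<close> generations, which gain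
    nothing; comparing with \<open>B 0\<close> costs the factor 2.\<close>
  have base: "tree_gf w (big m r) $ k \<le> 2 * tree_gf w (big m 0) $ k" for r
  proof (cases "m < 2 * real k")
    case True
    have "tree_gf w (big m r) $ k \<le> 2 / m * B 0 $ k"
      using tree_gf_big_le_B[OF m, of r k] B_antimono[of 0 r k] m
        mult_left_mono[of "B r $ k" "B 0 $ k" "2 / m"] by simp
    also have "\<dots> = 2 * Z w k * (real k / m)" by (simp add: B_0_nth)
    also have "\<dots> \<le> 2 * Z w k * 1"
      using k m Z_nonneg[of k] by (intro mult_left_mono) auto
    finally show ?thesis using True by (simp add: tree_gf_big_0)
  qed (simp add: tree_gf_big_small tree_gf_big_0)
  have "tree_gf w (big m (r + j * g)) $ k \<le> 2 * (1 / 2) ^ j * tree_gf w (big m 0) $ k" for j r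
  proof (induction j)
    case 0
    then show ?case using base[of r] by simp
  next
    case (Suc j)
    have "tree_gf w (big m (r + Suc j * g)) $ k \<le> 1 / 2 * tree_gf w (big m (r + j * g)) $ k"
      using step[OF k, of "r + j * g"] by (simp add: algebra_simps)
    with Suc show ?case by simp
  qed
  from this[of "h mod g" "h div g"] show ?thesis by simp
qed

text \<open>Above size \<open>m\<close> both sides obey the same linear recursion through
  \<open>D\<close>, whose coefficients are nonnegative and whose constant term is zero. So the
  factor \<open>q\<close> is inherited from sizes up to \<open>m\<close>.\<close>

lemma tree_gf_tops_le:
  assumes "q \<ge> 0" and q: "\<And>k. real k \<le> m \<Longrightarrow> tree_gf w (big m g) $ k \<le> q * tree_gf w (big m 0) $ k"
  shows "tree_gf w (tops m g) $ n \<le> q * tree_gf w (tops m 0) $ n"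
proof (induction n rule: less_induct)
  case (less n)
  show ?case
  proof (cases "real n \<le> m")
    case True
    have "tree_gf w (tops m h) $ n = tree_gf w (big m h) $ n" for h
      using True by (simp add: tree_gf_def tops_le)
    then show ?thesis using q[OF True] by simp
  next
    case False
    have eq: "tree_gf w (tops m h) $ n = (D * tree_gf w (tops m h)) $ n" for h
      unfolding tree_gf_children[symmetric] using False by (simp add: tree_gf_def tops_greater)
    have "(D * tree_gf w (tops m g)) $ n = (\<Sum>i=1..n. D $ i * tree_gf w (tops m g) $ (n - i))"
      unfolding fps_mult_nth using D_0 by (subst sum.atLeast_Suc_atMost) auto
    also have "\<dots> \<le> (\<Sum>i=1..n. D $ i * (q * tree_gf w (tops m 0) $ (n - i)))"
      by (intro sum_mono mult_left_mono less D_nonneg) auto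
    also have "\<dots> = q * (\<Sum>i=1..n. D $ i * tree_gf w (tops m 0) $ (n - i))"
      by (simp add: sum_distrib_left mult_ac)
    also have "(\<Sum>i=1..n. D $ i * tree_gf w (tops m 0) $ (n - i)) = (D * tree_gf w (tops m 0)) $ n"
      unfolding fps_mult_nth using D_0 by (subst (2) sum.atLeast_Suc_atMost) auto
    finally show ?thesis unfolding eq[symmetric] .
  qed
qed

lemma tree_gf_tops_0: 
  assumes "m > 0"
  shows "tree_gf w (tops m 0) $ n \<le> 2 * real n / m * Z w n"
proof -
  have "tops m 0 t \<le> 2 * real (nv t) / m" for t
    using tops_0_le[of m t] assms by (simp add: field_simps)
  then have "tree_gf w (tops m 0) $ n \<le> tree_gf w (\<lambda>t. 2 * real (nv t) / m) $ n"
    by (intro tree_gf_mono)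
  also have "\<dots> = 2 * real n / m * Z w n"
    by (simp add: tree_gf_def Z_def sum_distrib_left mult.commute)
  finally show ?thesis .
qed

text \<open>The mean of \<open>tops m h\<close> is at most \<open>2^(a+1) / 2^(h div g)\<close>. The
  minimum with 1 is the better bound until \<open>h\<close> is about \<open>g a\<close>, and
  afterwards the decay is geometric. So the maximum over at most \<open>2^a\<close> segments only
  costs the factor \<open>a + 3\<close>.\<close>

lemma tree_gf_min_tops:
  assumes m: "m > 0" "2 * real n / m \<le> 2 ^ a"
    and g: "g > 0"
    and core: "\<And>k. m < 2 * real k \<Longrightarrow> real k \<le> m \<Longrightarrow> B g $ k \<le> 1 / 4 * (real k * Z w k)"
  shows "(\<Sum>h<n. tree_gf w (\<lambda>t. min 1 (tops m h t)) $ n) \<le> real g * (real a + 3) * Z w n"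
proof -
  have "tree_gf w (\<lambda>t. min 1 (tops m h t)) $ n \<le> min 1 (2 ^ Suc a / 2 ^ (h div g)) * Z w n" for h
  proof -
    have "tree_gf w (\<lambda>t. min 1 (tops m h t)) $ n \<le> tree_gf w (\<lambda>_. 1) $ n"
      by (intro tree_gf_mono) auto
    then have 1: "tree_gf w (\<lambda>t. min 1 (tops m h t)) $ n \<le> Z w n"
      unfolding tree_gf_one by simp
    have "tree_gf w (\<lambda>t. min 1 (tops m h t)) $ n \<le> tree_gf w (tops m h) $ n"
      by (intro tree_gf_mono) auto
    also have "\<dots> \<le> 2 * (1 / 2) ^ (h div g) * tree_gf w (tops m 0) $ n"
      by (intro tree_gf_tops_le tree_gf_big_iterate core m) auto
    also have "\<dots> \<le> 2 * (1 / 2) ^ (h div g) * (2 ^ a * Z w n)"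
      using tree_gf_tops_0[OF m(1), of n] mult_right_mono[OF m(2) Z_nonneg[of n]]
      by (intro mult_left_mono) auto
    also have "\<dots> = 2 ^ Suc a / 2 ^ (h div g) * Z w n" by (simp add: power_divide)
    finally show ?thesis using 1 by (simp add: min_def)
  qed
  then have "(\<Sum>h<n. tree_gf w (\<lambda>t. min 1 (tops m h t)) $ n)
      \<le> (\<Sum>h<n. min 1 (2 ^ Suc a / 2 ^ (h div g)) * Z w n)"
    by (intro sum_mono)
  also have "\<dots> = (\<Sum>h<n. min 1 (2 ^ Suc a / 2 ^ (h div g))) * Z w n"
    by (simp add: sum_distrib_right)
  also have "\<dots> \<le> (real g * (\<Sum>j<n. min 1 (2 ^ Suc a / 2 ^ j))) * Z w n"
    using sum_div_le[OF g, of "\<lambda>j. min 1 (2 ^ Suc a / 2 ^ j)" n]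
    by (intro mult_right_mono Z_nonneg) auto
  also have "\<dots> \<le> real g * (real (Suc a) + 2) * Z w n"
    by (intro mult_right_mono mult_left_mono min_sum_geometric Z_nonneg) auto
  finally show ?thesis by (simp add: add.commute)
qed

end

section \<open>Heights and typical degrees\<close>

lemma tree_gf_add: "tree_gf w (\<lambda>t. F t + G t) $ n = tree_gf w F $ n + tree_gf w G $ n"
  by (simp add: tree_gf_def sum.distrib algebra_simps)

lemma tree_gf_sum: "tree_gf w (\<lambda>t. \<Sum>i\<in>A. F i t) $ n = (\<Sum>i\<in>A. tree_gf w (F i) $ n)"
  unfolding tree_gf_def fps_nth_Abs_fps sum_distrib_left by (rule sum.swap)

lemma tree_gf_const: "tree_gf w (\<lambda>t. c) $ n = c * Z w n"
  by (simp add: tree_gf_def Z_def sum_distrib_left mult.commute)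

lemma dyadic_exists:
  fixes n K :: nat
  assumes "K > 0" "n \<ge> K"
  obtains I where "real K \<le> real n / 2 ^ I" "real n / 2 ^ I < 2 * real K"
proof -
  define J where "J = (LEAST i. real n / 2 ^ i < real K)"
  have "\<exists>i. real n / 2 ^ i < real K"
  proof -
    obtain i where "real n / real K < 2 ^ i" using real_arch_pow[of 2 "real n / real K"] by auto
    then show ?thesis using assms by (auto simp: field_simps)
  qed
  then have J: "real n / 2 ^ J < real K" unfolding J_def by (rule LeastI_ex)
  have "J \<noteq> 0" using J assms by (cases J) auto
  then obtain I where I: "J = Suc I" by (cases J) auto
  have "\<not> real n / 2 ^ I < real K" using not_less_Least[of I "\<lambda>i. real n / 2 ^ i < real K"] I J_def by auto
  then show thesis using that[of I] J I by (simp add: field_simps)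
qed

text \<open>These are the error terms of \<open>height_bound\<close>: the part of the path below all
  classes, and the rounding in each of \<open>O(log n)\<close> classes.\<close>

lemma log_square_over_sqrt: "(\<lambda>n. (2 * real K + (log 2 (real n) + 4)\<^sup>2) / sqrt (real n)) \<longlonglongrightarrow> 0"
proof -
  have 1: "(\<lambda>n. ln (real n) / real n powr (1 / 4)) \<longlonglongrightarrow> 0"
    by (rule lim_ln_over_power) simp
  have 2: "(\<lambda>n. 1 / real n powr (1 / 4)) \<longlonglongrightarrow> 0"
    by (rule lim_1_over_real_power) simp
  have "(\<lambda>n. 2 * real K * (1 / real n powr (1 / 4))\<^sup>2
      + (ln (real n) / real n powr (1 / 4) / ln 2 + 4 * (1 / real n powr (1 / 4)))\<^sup>2) \<longlonglongrightarrow> 2 * real K * 0\<^sup>2 + (0 / ln 2 + 4 * 0)\<^sup>2"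
    by (intro tendsto_intros 1 2) simp
  moreover have "eventually (\<lambda>n. 2 * real K * (1 / real n powr (1 / 4))\<^sup>2
      + (ln (real n) / real n powr (1 / 4) / ln 2 + 4 * (1 / real n powr (1 / 4)))\<^sup>2
      = (2 * real K + (log 2 (real n) + 4)\<^sup>2) / sqrt (real n)) sequentially"
    using eventually_gt_at_top[of 0]
  proof eventually_elim
    case (elim n)
    have "(real n powr (1 / 4))\<^sup>2 = sqrt (real n)"
      using elim by (simp add: powr_half_sqrt[symmetric] powr_power)
    then have s: "sqrt (real n) = (real n powr (1 / 4))\<^sup>2" by simp
    have p: "real n powr (1 / 4) > 0" using elim by simp
    show ?case unfolding s log_def using p
      by (simp add: power_divide add_divide_distrib[symmetric] divide_simps)
  qed
  ultimately show ?thesis by (simp add: tendsto_cong)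
qed

context weights begin

text \<open>Class \<open>i\<close> has size \<open>m i = n / 2^i\<close>, hence at most
  \<open>2^(i+1)\<close> segments, and contributes \<open>\<epsilon> (i + 4) sqrt (n / 2^i)\<close>,
  which is summable in \<open>i\<close>. Rounding \<open>g i\<close> up adds \<open>i + 4\<close>
  per class.\<close>

lemma height_bound:
  fixes K n :: nat and \<epsilon> :: real
  assumes "\<epsilon> > 0" "K > 0" "n \<ge> K"
    and core: "\<And>k g. k \<ge> K \<Longrightarrow> real g \<ge> \<epsilon> * sqrt (real k) \<Longrightarrow> B g $ k \<le> 1 / 4 * (real k * Z w k)"
  shows "tree_gf w (\<lambda>t. real (height t)) $ n
    \<le> (2 * real K + (log 2 (real n) + 4)\<^sup>2 + \<epsilon> * (\<Sum>i. (real i + 4) * sqrt (1 / 2) ^ i) * sqrt (real n)) * Z w n"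
proof -
  \<comment> \<open>Stopping between \<open>K\<close> and \<open>2 K\<close> ensures
    \<open>k > m i / 2 \<ge> m I \<ge> K\<close> for the classes \<open>i < I\<close>, as
    \<open>core\<close> requires, and leaves a remainder of height less than
    \<open>2 K\<close>.\<close>
  obtain I where I: "real K \<le> real n / 2 ^ I" "real n / 2 ^ I < 2 * real K"
    using dyadic_exists assms by blast
  define m where "m i = real n / 2 ^ i" for i :: nat
  define g where "g i = nat \<lceil>\<epsilon> * sqrt (m i)\<rceil>" for i
  let ?S = "\<lambda>i. \<Sum>h<n. tree_gf w (\<lambda>t. min 1 (tops (m i) h t)) $ n"
  have npos: "n > 0" using assms by simp
  have mpos: "m i > 0" for i using npos by (simp add: m_def)
  have "(\<Sum>i<I. ?S i) \<le> (\<Sum>i<I. (\<epsilon> * sqrt (real n) * sqrt (1 / 2) ^ i + 1) * (real i + 4) * Z w n)"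
  proof (intro sum_mono)
    fix i assume "i \<in> {..<I}"
    then have i: "Suc i \<le> I" by simp
    have "m I \<le> m (Suc i)" unfolding m_def using power_increasing[OF i, of "2::real"] by (intro divide_left_mono) auto
    then have mi: "2 * real K \<le> m i" using I(1) by (simp add: m_def)
    have g_pos: "g i > 0" unfolding g_def using assms(1) mpos[of i] by simp
    have g_ge: "real (g i) \<ge> \<epsilon> * sqrt (m i)" unfolding g_def by linarith
    have "?S i \<le> real (g i) * (real (Suc i) + 3) * Z w n"
    proof (intro tree_gf_min_tops core mpos g_pos)
      show "2 * real n / m i \<le> 2 ^ Suc i" using npos by (simp add: m_def)
      fix k assume k: "m i < 2 * real k" "real k \<le> m i"
      show "k \<ge> K" using k mi by linarith
      have "\<epsilon> * sqrt (real k) \<le> \<epsilon> * sqrt (m i)" using k assms(1) by simp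
      then show "\<epsilon> * sqrt (real k) \<le> real (g i)" using g_ge by linarith
    qed
    also have "real (g i) \<le> \<epsilon> * sqrt (m i) + 1"
      unfolding g_def using assms(1) mpos[of i] by (simp add: of_nat_ceiling le_of_int_ceiling)
    also have "sqrt (m i) = sqrt (real n) * sqrt (1 / 2) ^ i"
      by (simp add: m_def real_sqrt_mult[symmetric] real_sqrt_power[symmetric] power_divide)
    finally show "?S i \<le> (\<epsilon> * sqrt (real n) * sqrt (1 / 2) ^ i + 1) * (real i + 4) * Z w n"
      using Z_nonneg by (simp add: mult_right_mono add_ac mult_ac)
  qed
  also have "\<dots> = (\<epsilon> * (\<Sum>i<I. (real i + 4) * sqrt (1 / 2) ^ i) * sqrt (real n) + (\<Sum>i<I. real i + 4)) * Z w n"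
    by (simp add: sum_distrib_left sum_distrib_right algebra_simps sum.distrib)
  finally have S: "(\<Sum>i<I. ?S i) \<le> (\<epsilon> * (\<Sum>i<I. (real i + 4) * sqrt (1 / 2) ^ i) * sqrt (real n) + (\<Sum>i<I. real i + 4)) * Z w n" .
  have "tree_gf w (\<lambda>t. real (height t)) $ n
      \<le> tree_gf w (\<lambda>t. m I + (\<Sum>i<I. \<Sum>h<n. min 1 (tops (m i) h t))) $ n"
    unfolding m_def by (intro tree_gf_mono height_le_tops) auto
  also have "\<dots> = m I * Z w n + (\<Sum>i<I. ?S i)"
    by (simp only: tree_gf_add tree_gf_sum tree_gf_const)
  also have "\<dots> \<le> (m I + (\<Sum>i<I. real i + 4) + \<epsilon> * (\<Sum>i<I. (real i + 4) * sqrt (1 / 2) ^ i) * sqrt (real n)) * Z w n"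
    using S by (simp add: algebra_simps)
  also have "\<dots> \<le> (2 * real K + (log 2 (real n) + 4)\<^sup>2 + \<epsilon> * (\<Sum>i. (real i + 4) * sqrt (1 / 2) ^ i) * sqrt (real n)) * Z w n"
  proof (intro mult_right_mono add_mono Z_nonneg mult_left_mono)
    show "m I \<le> 2 * real K" using I by (simp add: m_def)
    have "2 ^ I \<le> real n / real K" using I(1) assms by (simp add: field_simps)
    also have "\<dots> \<le> real n" using assms by (simp add: field_simps)
    finally have "real I \<le> log 2 (real n)" using npos by (simp add: le_log_iff powr_realpow)
    have "(\<Sum>i<I. real i + 4) \<le> (\<Sum>i<I. real I + 4)" by (intro sum_mono) auto
    also have "\<dots> \<le> (real I + 4) * (real I + 4)" by (simp add: algebra_simps)
    also have "\<dots> \<le> (log 2 (real n) + 4) * (log 2 (real n) + 4)"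
      using \<open>real I \<le> log 2 (real n)\<close> by (intro mult_mono) auto
    finally show "(\<Sum>i<I. real i + 4) \<le> (log 2 (real n) + 4)\<^sup>2" by (simp add: power2_eq_square)
    have sm: "summable (\<lambda>i. (real i + 4) * sqrt (1 / 2) ^ i)"
    proof -
      have "sqrt (1 / 2) < 1" by simp
      then have n: "norm (sqrt (1 / 2)) < 1" by simp
      have "summable (\<lambda>i. of_nat (Suc i) * sqrt (1 / 2) ^ i + 3 * sqrt (1 / 2) ^ i)"
        using n by (intro summable_add summable_mult summable_geometric sums_summable[OF geometric_deriv_sums])
      then show ?thesis by (simp add: algebra_simps)
    qed
    show "(\<Sum>i<I. (real i + 4) * sqrt (1 / 2) ^ i) \<le> (\<Sum>i. (real i + 4) * sqrt (1 / 2) ^ i)"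
      by (intro sum_le_suminf sm) auto
  qed (use assms in auto)
  finally show ?thesis .
qed

lemma height_small:
  assumes core: "\<And>\<epsilon>. \<epsilon> > 0 \<Longrightarrow> \<exists>K. \<forall>k\<ge>K. \<forall>g. real g \<ge> \<epsilon> * sqrt (real k) \<longrightarrow> B g $ k \<le> 1 / 4 * (real k * Z w k)"
    and "\<delta> > 0"
  shows "eventually (\<lambda>n. tree_gf w (\<lambda>t. real (height t)) $ n \<le> \<delta> * sqrt (real n) * Z w n) sequentially"
proof -
  define C where "C = (\<Sum>i. (real i + 4) * sqrt (1 / 2) ^ i)"
  define \<epsilon> where "\<epsilon> = \<delta> / 2 / (\<bar>C\<bar> + 1)"
  have \<epsilon>: "\<epsilon> > 0" using assms by (simp add: \<epsilon>_def)
  have "\<epsilon> * C \<le> \<epsilon> * (\<bar>C\<bar> + 1)" using \<epsilon> by (intro mult_left_mono) auto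
  also have "\<bar>C\<bar> + 1 \<noteq> 0" by linarith
  then have "\<epsilon> * (\<bar>C\<bar> + 1) = \<delta> / 2" unfolding \<epsilon>_def by (rule nonzero_eq_divide_eq[THEN iffD1]) (rule refl)
  finally have C: "\<epsilon> * C \<le> \<delta> / 2" .
  obtain K where K: "\<forall>k\<ge>K. \<forall>g. real g \<ge> \<epsilon> * sqrt (real k) \<longrightarrow> B g $ k \<le> 1 / 4 * (real k * Z w k)"
    using core[OF \<epsilon>] by blast
  have "eventually (\<lambda>n. (2 * real (Suc K) + (log 2 (real n) + 4)\<^sup>2) / sqrt (real n) < \<delta> / 2) sequentially"
    using order_tendstoD(2)[OF log_square_over_sqrt[of "Suc K"], of "\<delta> / 2"] assms(2) by simp
  with eventually_ge_at_top[of "Suc K"] show ?thesis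
  proof eventually_elim
    case (elim n)
    have "2 * real (Suc K) + (log 2 (real n) + 4)\<^sup>2 \<le> \<delta> / 2 * sqrt (real n)"
      using elim by (simp add: pos_divide_less_eq)
    moreover have "\<epsilon> * C * sqrt (real n) \<le> \<delta> / 2 * sqrt (real n)"
      using C by (intro mult_right_mono) auto
    ultimately have "2 * real (Suc K) + (log 2 (real n) + 4)\<^sup>2 + \<epsilon> * C * sqrt (real n) \<le> \<delta> * sqrt (real n)"
      by simp
    from mult_right_mono[OF this Z_nonneg[of n]]
    have "(2 * real (Suc K) + (log 2 (real n) + 4)\<^sup>2 + \<epsilon> * C * sqrt (real n)) * Z w n \<le> \<delta> * sqrt (real n) * Z w n" .
    moreover have "tree_gf w (\<lambda>t. real (height t)) $ n
      \<le> (2 * real (Suc K) + (log 2 (real n) + 4)\<^sup>2 + \<epsilon> * C * sqrt (real n)) * Z w n"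
      unfolding C_def using elim K by (intro height_bound \<epsilon>) auto
    ultimately show ?case by linarith
  qed
qed

end

section \<open>The height of a uniform vertex and the squares of the degrees\<close>

lemma binomial_first_moment:
  "(\<Sum>j\<le>k. real j * (real (k choose j) * l ^ j)) = real k * l * (1 + l) ^ (k - 1)"
proof (cases k)
  case (Suc n)
  have "(\<Sum>j\<le>k. real j * (real (k choose j) * l ^ j))
      = (\<Sum>j\<le>n. real (Suc j) * (real (Suc n choose Suc j) * l ^ Suc j))"
    unfolding Suc by (subst sum.atMost_Suc_shift) simp
  also have "\<dots> = (\<Sum>j\<le>n. real (Suc n) * l * (real (n choose j) * l ^ j * 1 ^ (n - j)))"
  proof (intro sum.cong refl)
    fix j
    have "real (Suc j) * real (Suc n choose Suc j) = real (Suc n) * real (n choose j)"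
      unfolding of_nat_mult[symmetric] by (simp only: Suc_times_binomial_eq mult.commute)
    then have "real (Suc j) * real (Suc n choose Suc j) * l ^ Suc j = real (Suc n) * real (n choose j) * l ^ Suc j"
      by simp
    then show "real (Suc j) * (real (Suc n choose Suc j) * l ^ Suc j)
        = real (Suc n) * l * (real (n choose j) * l ^ j * 1 ^ (n - j))"
      by (simp add: algebra_simps)
  qed
  also have "\<dots> = real (Suc n) * l * (l + 1) ^ n"
    unfolding binomial_ring sum_distrib_left ..
  finally show ?thesis by (simp add: Suc add.commute)
qed simp

text \<open>Markov's inequality for the binomial distribution with success probability
  \<open>l / (1 + l)\<close>, whose mean is at most \<open>k l \<le> g / 2\<close>.\<close>

lemma binomial_lower_half:
  fixes g k :: nat
  assumes "l \<ge> 0" "real k * l \<le> real g / 2" "g > 0"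
  shows "(1 + l) ^ k \<le> 2 * (\<Sum>j\<in>{j. j \<le> k \<and> j \<le> g}. real (k choose j) * l ^ j)"
proof -
  let ?f = "\<lambda>j. real (k choose j) * l ^ j"
  have f: "?f j \<ge> 0" for j using assms by simp
  have "real g * (\<Sum>j\<in>{j. j \<le> k \<and> g < j}. ?f j) \<le> (\<Sum>j\<in>{j. j \<le> k \<and> g < j}. real j * ?f j)"
    unfolding sum_distrib_left using f by (intro sum_mono mult_right_mono) auto
  also have "\<dots> \<le> (\<Sum>j\<le>k. real j * ?f j)"
    using f by (intro sum_mono2) auto
  also have "\<dots> = real k * l * (1 + l) ^ (k - 1)" by (rule binomial_first_moment)
  also have "\<dots> \<le> real g / 2 * (1 + l) ^ k"
    using assms by (intro mult_mono power_increasing) auto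
  finally have A: "(\<Sum>j\<in>{j. j \<le> k \<and> g < j}. ?f j) \<le> (1 + l) ^ k / 2"
    using assms(3) by (simp add: field_simps)
  have "(1 + l) ^ k = (\<Sum>j\<le>k. ?f j)" using binomial_ring[of l 1 k] by (simp add: add.commute)
  also have "{..k} = {j. j \<le> k \<and> j \<le> g} \<union> {j. j \<le> k \<and> g < j}" by auto
  also have "sum ?f \<dots> = sum ?f {j. j \<le> k \<and> j \<le> g} + sum ?f {j. j \<le> k \<and> g < j}"
    by (rule sum.union_disjoint) auto
  finally show ?thesis using A by linarith
qed

text \<open>The ratio is \<open>1 + u\<close>. Its gain over \<open>exp u\<close> is quadratic for
  \<open>0 \<le> u \<le> 1\<close> and linear for \<open>u > 1\<close>, by the second order Taylor
  bound for \<open>exp\<close>.\<close>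

lemma ratio_le_exp:
  fixes l :: real and d :: nat
  assumes "0 \<le> l"
  defines "u \<equiv> l * (real d - 1) / (1 + l)"
  shows "(1 + l * real d) / (1 + l) \<le> exp (u - (if 2 \<le> d then min (u\<^sup>2) u / 6 else 0))"
proof -
  have eq: "(1 + l * real d) / (1 + l) = 1 + u"
    using assms(1) by (simp add: u_def field_simps)
  show ?thesis
  proof (cases "2 \<le> d")
    case True
    then have u: "u \<ge> 0" using assms(1) by (simp add: u_def)
    have "1 + u \<le> exp (u - min (u\<^sup>2) u / 6)"
    proof (cases "u \<le> 1")
      case True
      have u2: "u\<^sup>2 \<le> u" using u True by (simp add: power2_eq_square mult_left_le)
      \<comment> \<open>From \<open>y \<ge> 5 u / 6\<close> the Taylor term is at least
        \<open>25 / 72\<close> of the square of \<open>u\<close>, which makes up for the sixth that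
        \<open>y\<close> subtracts.\<close>
      define y where "y = u - u\<^sup>2 / 6"
      have y: "y \<ge> 5 / 6 * u" using u2 by (simp add: y_def)
      have "(5 / 6 * u)\<^sup>2 \<le> y\<^sup>2" using y u by (intro power_mono) auto
      then have "25 / 36 * u\<^sup>2 \<le> y\<^sup>2" by (simp add: power_mult_distrib power_divide)
      moreover have "u\<^sup>2 \<ge> 0" by simp
      ultimately have "1 + u \<le> 1 + y + y\<^sup>2 / 2" using y_def by linarith
      also have "\<dots> \<le> exp y" using y u by (intro exp_lower_Taylor_quadratic) linarith
      also have "\<dots> = exp (u - min (u\<^sup>2) u / 6)" using u2 by (simp add: y_def)
      finally show ?thesis .
    next
      case False
      then have u2: "u \<le> u\<^sup>2" by (simp add: power2_eq_square)
      moreover have "(5 / 6 * u)\<^sup>2 = 25 / 36 * u\<^sup>2" by (simp add: power_mult_distrib power_divide)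
      ultimately have "1 + u \<le> 1 + 5 / 6 * u + (5 / 6 * u)\<^sup>2 / 2" using u by linarith
      also have "\<dots> \<le> exp (5 / 6 * u)" using u by (intro exp_lower_Taylor_quadratic) simp
      also have "5 / 6 * u = u - min (u\<^sup>2) u / 6" using u2 by simp
      finally show ?thesis .
    qed
    then show ?thesis using True eq by simp
  next
    case False
    then show ?thesis unfolding eq using exp_ge_add_one_self[of u] by simp
  qed
qed

text \<open>The cap at \<open>M\<close> keeps \<open>l * M \<le> 1\<close> while \<open>l\<close> is of order \<open>1 / sqrt n\<close>, so that a vertex of
  degree above \<open>M\<close> is only charged linearly in its degree.\<close>

definition pen :: "nat \<Rightarrow> nat \<Rightarrow> real" where
  "pen M d = (if M < d then real M * real d else if 2 \<le> d then (real d - 1)\<^sup>2 else 0)"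

lemma pen_nonneg: "pen M d \<ge> 0"
  by (simp add: pen_def)

text \<open>For \<open>2 \<le> d\<close> and \<open>d > M\<close> one has
  \<open>u \<ge> l d / 4\<close> and \<open>u \<ge> l M / 4\<close>, where
  \<open>l M / 4 \<le> 1\<close>. So the minimum of \<open>u\<close> and its square is at least
  \<open>l^2 M d / 16\<close>, and the division by 6 gives 96. For \<open>2 \<le> d \<le> M\<close>,
  \<open>u \<le> 1\<close>, and the quadratic gain is more than enough.\<close>

lemma ratio_le_exp_pen:
  assumes l: "0 \<le> l" "l \<le> 1" "l * real M \<le> 1" "M \<ge> 1"
  shows "(1 + l * real d) / (1 + l) \<le> exp (l / (1 + l) * (real d - 1) - l\<^sup>2 / 96 * pen M d)"
proof -
  define u where "u = l * (real d - 1) / (1 + l)"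
  have "l\<^sup>2 / 96 * pen M d \<le> (if 2 \<le> d then min (u\<^sup>2) u / 6 else 0)"
  proof (cases "2 \<le> d")
    case False
    then show ?thesis using l(4) by (simp add: pen_def)
  next
    case True
    then have "l * (real d - 1) \<ge> 0" using l by simp
    then have "l * (real d - 1) / (1 + l) \<ge> l * (real d - 1) / 2" "u \<le> l * (real d - 1)"
      unfolding u_def using l divide_left_mono[of "1 + l" 2 "l * (real d - 1)"]
        divide_left_mono[of 1 "1 + l" "l * (real d - 1)"] by auto
    then have u: "u \<ge> l * (real d - 1) / 2" "u \<le> l * (real d - 1)" by (auto simp: u_def)
    have u0: "u \<ge> 0" using u(1) \<open>l * (real d - 1) \<ge> 0\<close> by linarith
    show ?thesis
    proof (cases "M < d")
      case True
      have "real d \<le> 2 * (real d - 1)" using \<open>2 \<le> d\<close> by simp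
      then have "l * real d \<le> l * (2 * (real d - 1))" using l by (intro mult_left_mono) auto
      also have "\<dots> = 2 * (l * (real d - 1))" by (rule mult.left_commute)
      finally have ud: "u \<ge> l * real d / 4" using u(1) by linarith
      have uM: "u \<ge> l * real M / 4" 
        using ud True l(1) mult_left_mono[of "real M" "real d" l] by simp
      have "l * real d / 4 * (l * real M / 4) \<le> min (u\<^sup>2) u"
      proof -
        have "l * real d / 4 * (l * real M / 4) \<le> u * u"
          using ud uM l u0 by (intro mult_mono) auto
        moreover have "l * real d / 4 * (l * real M / 4) \<le> u * 1"
          using ud l u0 by (intro mult_mono) auto
        ultimately show ?thesis by (simp add: power2_eq_square)
      qed
      then show ?thesis using True \<open>2 \<le> d\<close> by (simp add: pen_def power2_eq_square algebra_simps)
    next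
      case False
      have "l * (real d - 1) \<le> l * real M" using False l by (intro mult_left_mono) auto
      then have "u \<le> 1" using u(2) l(3) by linarith
      then have "u\<^sup>2 \<le> u" using u0 by (simp add: power2_eq_square mult_left_le)
      moreover have "(l * (real d - 1) / 2)\<^sup>2 \<le> u\<^sup>2"
        using u \<open>l * (real d - 1) \<ge> 0\<close> by (intro power_mono) auto
      ultimately have "(l * (real d - 1))\<^sup>2 / 4 \<le> min (u\<^sup>2) u" by (simp add: power_divide)
      moreover have "(l * (real d - 1))\<^sup>2 / 16 \<le> (l * (real d - 1))\<^sup>2 / 4" by simp
      ultimately have "(l * (real d - 1))\<^sup>2 / 16 \<le> min (u\<^sup>2) u" by linarith
      then show ?thesis using False \<open>2 \<le> d\<close> by (simp add: pen_def power_mult_distrib)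
    qed
  qed
  then have "u - (if 2 \<le> d then min (u\<^sup>2) u / 6 else 0) \<le> l / (1 + l) * (real d - 1) - l\<^sup>2 / 96 * pen M d"
    by (simp add: u_def)
  then show ?thesis using ratio_le_exp[OF l(1), of d] unfolding u_def by (meson exp_le_cancel_iff order_trans)
qed

abbreviation vsum :: "(nat \<Rightarrow> real) \<Rightarrow> plane_tree \<Rightarrow> real" where
  "vsum f t \<equiv> (\<Sum>v\<in>vertices t. f (num_children t v))"

lemma tree_weight_mult: "tree_weight (\<lambda>j. w j * h j) t = tree_weight w t * tree_weight h t"
  by (simp add: tree_weight_def prod.distrib)

lemma Z_mult: "Z (\<lambda>j. w j * h j) n = tree_gf w (tree_weight h) $ n"
  by (simp add: Z_def tree_gf_def tree_weight_mult)

lemma tree_weight_exp: "tree_weight (\<lambda>j. exp (f j)) t = exp (vsum f t)"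
  by (simp add: tree_weight_def exp_sum)

lemma vsum_degree_minus_1: "vsum (\<lambda>d. real d - 1) t = - 1"
proof -
  have "vsum (\<lambda>d. real d - 1) t = real (\<Sum>v\<in>vertices t. num_children t v) - real (nv t)"
    by (simp add: sum_subtractf)
  then show ?thesis unfolding sum_num_children using card_vertices_pos[of t] by (simp add: of_nat_diff)
qed

lemma tree_weight_mono:
  assumes "\<And>j. 0 \<le> f j" "\<And>j. f j \<le> g j"
  shows "tree_weight f t \<le> tree_weight g t"
  unfolding tree_weight_def using assms by (intro prod_mono) auto

text \<open>The linear terms in the exponents add up to \<open>- l / (1 + l) \<le> 0\<close>,
  because the degrees minus one sum to \<open>-1\<close>; only the penalties survive.\<close>

lemma tree_weight_ratio_le:
  assumes "0 \<le> l" "l \<le> 1" "l * real M \<le> 1" "M \<ge> 1"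
  shows "tree_weight (\<lambda>d. (1 + l * real d) / (1 + l)) t \<le> exp (- (l\<^sup>2 / 96 * vsum (pen M) t))"
proof -
  have "tree_weight (\<lambda>d. (1 + l * real d) / (1 + l)) t
      \<le> tree_weight (\<lambda>d. exp (l / (1 + l) * (real d - 1) - l\<^sup>2 / 96 * pen M d)) t"
    using assms by (intro tree_weight_mono ratio_le_exp_pen) auto
  also have "\<dots> = exp (l / (1 + l) * vsum (\<lambda>d. real d - 1) t - l\<^sup>2 / 96 * vsum (pen M) t)"
    unfolding tree_weight_exp by (subst sum_subtractf) (simp only: sum_distrib_left)
  also have "\<dots> \<le> exp (- (l\<^sup>2 / 96 * vsum (pen M) t))"
    unfolding vsum_degree_minus_1 using assms by simp
  finally show ?thesis .
qed

context weights begin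

text \<open>Only the terms \<open>j \<le> g\<close> of \<open>Z_tilt\<close> are kept: there
  \<open>B j\<close> dominates \<open>B g\<close>, and they carry at least half of the binomial mass
  \<open>(1 + l)^k\<close>. Dividing by this mass normalises the factor of each of the
  \<open>k\<close> vertices.\<close>

lemma B_le_tilt:
  assumes "l \<ge> 0" "real k * l \<le> real g / 2" "g > 0"
  shows "B g $ k \<le> 2 * real k * tree_gf w (tree_weight (\<lambda>d. (1 + l * real d) / (1 + l))) $ k"
proof -
  have "B g $ k * (1 + l) ^ k \<le> B g $ k * (2 * (\<Sum>j\<in>{j. j \<le> k \<and> j \<le> g}. real (k choose j) * l ^ j))"
    by (intro mult_left_mono binomial_lower_half assms B_nonneg)
  also have "\<dots> = 2 * (\<Sum>j\<in>{j. j \<le> k \<and> j \<le> g}. real (k choose j) * l ^ j * B g $ k)"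
    by (simp add: sum_distrib_left sum_distrib_right mult_ac)
  also have "\<dots> \<le> 2 * (\<Sum>j\<in>{j. j \<le> k \<and> j \<le> g}. real (k choose j) * l ^ j * B j $ k)"
    using assms by (intro mult_left_mono sum_mono B_antimono) auto
  also have "\<dots> \<le> 2 * (\<Sum>j\<le>k. real (k choose j) * l ^ j * B j $ k)"
    using assms by (intro mult_left_mono sum_mono2) (auto intro!: mult_nonneg_nonneg B_nonneg)
  also have "\<dots> = 2 * (real k * Z (\<lambda>j. w j * (1 + l * real j)) k)"
    by (simp only: Z_tilt[OF assms(1)])
  finally have *: "B g $ k \<le> 2 * real k * (Z (\<lambda>j. w j * (1 + l * real j)) k / (1 + l) ^ k)"
    using assms(1) by (simp add: field_simps)
  have "Z (\<lambda>j. w j * (1 + l * real j)) k / (1 + l) ^ k = tree_gf w (tree_weight (\<lambda>d. (1 + l * real d) / (1 + l))) $ k"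
    unfolding Z_mult tree_gf_def fps_nth_Abs_fps sum_divide_distrib
    by (intro sum.cong refl) (simp add: tree_weight_def prod_dividef)
  with * show ?thesis by simp
qed

lemma uniform_vertex_height_of_typical:
  assumes typical: "\<And>A. \<exists>M K. M \<ge> 1 \<and> (\<forall>k\<ge>K.
      tree_gf w (\<lambda>t. if vsum (pen M) t < A * real k then 1 else 0) $ k \<le> 1 / 32 * Z w k)"
    and \<epsilon>: "\<epsilon> > 0"
  shows "\<exists>K. \<forall>k\<ge>K. \<forall>g. real g \<ge> \<epsilon> * sqrt (real k) \<longrightarrow> B g $ k \<le> 1 / 4 * (real k * Z w k)"
proof -
  \<comment> \<open>Chosen so that a total penalty of \<open>A k\<close> gives exactly the factor
    \<open>1 / 32\<close> when \<open>l = \<epsilon> / (2 sqrt k)\<close>.\<close>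
  define A where "A = 384 * ln 32 / \<epsilon>\<^sup>2"
  obtain M K where M: "M \<ge> 1" and K: "\<And>k. k \<ge> K \<Longrightarrow>
      tree_gf w (\<lambda>t. if vsum (pen M) t < A * real k then 1 else 0) $ k \<le> 1 / 32 * Z w k"
    using typical[of A] by blast
  \<comment> \<open>The second bound gives \<open>\<epsilon> M \<le> sqrt k\<close>, hence
    \<open>l M \<le> 1\<close>; \<open>Suc K\<close> ensures \<open>k > 0\<close>.\<close>
  define K' where "K' = max (Suc K) (nat \<lceil>(\<epsilon> * real M)\<^sup>2\<rceil>)"
  show ?thesis
  proof (intro exI[of _ K'] allI impI)
    fix k g assume k: "k \<ge> K'" and g: "\<epsilon> * sqrt (real k) \<le> real g"
    \<comment> \<open>This gives \<open>k l = \<epsilon> sqrt k / 2 \<le> g / 2\<close>, as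
      \<open>B_le_tilt\<close> requires.\<close>
    define l where "l = \<epsilon> / (2 * sqrt (real k))"
    have kpos: "k > 0" "k \<ge> K" using k by (auto simp: K'_def)
    have "(\<epsilon> * real M)\<^sup>2 \<le> real k" using k by (simp add: K'_def)
    then have kM: "\<epsilon> * real M \<le> sqrt (real k)" by (rule real_le_rsqrt)
    have l0: "l > 0" using \<epsilon> kpos by (simp add: l_def)
    have "\<epsilon> * real M \<le> 2 * sqrt (real k)" using kM real_sqrt_ge_zero[of "real k"] by linarith
    then have lM: "l * real M \<le> 1" using kpos by (simp add: l_def)
    have l1: "l \<le> 1" using lM M l0 by (smt (verit) mult_left_le of_nat_1 of_nat_mono mult_le_cancel_left1)
    have "real k * l = \<epsilon> * sqrt (real k) / 2"
      using kpos by (simp add: l_def field_simps real_sqrt_mult_self flip: power2_eq_square)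
    then have kl: "real k * l \<le> real g / 2" using g by simp
    have "\<epsilon> * sqrt (real k) > 0" using \<epsilon> kpos by simp
    then have gpos: "g > 0" using g by (cases g) auto
    have l2: "l\<^sup>2 / 96 * (A * real k) = ln 32"
      using kpos \<epsilon> by (simp add: l_def A_def power_divide power_mult_distrib)
    have pointwise: "tree_weight (\<lambda>d. (1 + l * real d) / (1 + l)) t
        \<le> (if vsum (pen M) t < A * real k then 1 else 0) + 1 / 32" for t
    proof -
      have *: "tree_weight (\<lambda>d. (1 + l * real d) / (1 + l)) t \<le> exp (- (l\<^sup>2 / 96 * vsum (pen M) t))"
        using l0 l1 lM M by (intro tree_weight_ratio_le) auto
      show ?thesis
      proof (cases "vsum (pen M) t < A * real k")
        case True
        have "exp (- (l\<^sup>2 / 96 * vsum (pen M) t)) \<le> 1" by (simp add: sum_nonneg pen_nonneg)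
        with * have "tree_weight (\<lambda>d. (1 + l * real d) / (1 + l)) t \<le> 1" by linarith
        then show ?thesis using True by simp
      next
        case False
        then have "l\<^sup>2 / 96 * vsum (pen M) t \<ge> ln 32" unfolding l2[symmetric] by (intro mult_left_mono) auto
        then have "exp (- (l\<^sup>2 / 96 * vsum (pen M) t)) \<le> exp (- ln 32)" by simp
        then show ?thesis using False * by (simp add: exp_minus)
      qed
    qed
    have "B g $ k \<le> 2 * real k * tree_gf w (tree_weight (\<lambda>d. (1 + l * real d) / (1 + l))) $ k"
      using l0 kl gpos by (intro B_le_tilt) auto
    also have "\<dots> \<le> 2 * real k * (tree_gf w (\<lambda>t. (if vsum (pen M) t < A * real k then 1 else 0) + 1 / 32) $ k)"
      using pointwise by (intro mult_left_mono tree_gf_mono) auto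
    also have "\<dots> \<le> 2 * real k * (1 / 32 * Z w k + 1 / 32 * Z w k)"
      unfolding tree_gf_add tree_gf_const using K[OF kpos(2)] by (intro mult_left_mono add_mono) auto
    also have "\<dots> \<le> 1 / 4 * (real k * Z w k)" using Z_nonneg[of k] by simp
    finally show "B g $ k \<le> 1 / 4 * (real k * Z w k)" .
  qed
qed

end

section \<open>Large deviations\<close>

lemma fps_mult_sums:
  fixes F G :: "real fps"
  assumes F: "\<And>n. F $ n \<ge> 0" "(\<lambda>n. F $ n * x ^ n) sums a"
    and G: "\<And>n. G $ n \<ge> 0" "(\<lambda>n. G $ n * x ^ n) sums b" and x: "x \<ge> 0"
  shows "(\<lambda>n. (F * G) $ n * x ^ n) sums (a * b)"
proof -
  have "(\<lambda>n. \<Sum>i\<le>n. (F $ i * x ^ i) * (G $ (n - i) * x ^ (n - i))) sums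
      ((\<Sum>n. F $ n * x ^ n) * (\<Sum>n. G $ n * x ^ n))"
    using F G x by (intro Cauchy_product_sums) (auto simp: sums_iff abs_mult)
  moreover have "(\<Sum>i\<le>n. (F $ i * x ^ i) * (G $ (n - i) * x ^ (n - i))) = (F * G) $ n * x ^ n" for n
    unfolding fps_mult_nth sum_distrib_right atMost_atLeast0
  proof (intro sum.cong refl)
    fix i assume "i \<in> {0..n}"
    then have "x ^ n = x ^ i * x ^ (n - i)" by (simp flip: power_add)
    then show "(F $ i * x ^ i) * (G $ (n - i) * x ^ (n - i)) = F $ i * G $ (n - i) * x ^ n" by simp
  qed
  ultimately show ?thesis using F G by (simp add: sums_iff)
qed

lemma fps_power_sums:
  fixes F :: "real fps"
  assumes "\<And>n. F $ n \<ge> 0" "(\<lambda>n. F $ n * x ^ n) sums a" "x \<ge> 0"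
  shows "(\<lambda>n. (F ^ j) $ n * x ^ n) sums (a ^ j)"
proof (induction j)
  case 0
  have "(\<lambda>n. (if n = 0 then 1 else 0) * x ^ n) sums (1 :: real)"
    using sums_If_finite_set[of "{0}" "\<lambda>n. x ^ n"] by (simp add: if_distrib[of "\<lambda>y. y * _"] cong: if_cong)
  then show ?case by simp
next
  case (Suc j)
  then show ?case using assms by (auto intro!: fps_mult_sums fps_power_nonneg)
qed

lemma fps_mult_nth_ge:
  fixes F G :: "real fps"
  assumes "\<And>n. F $ n \<ge> 0" "\<And>n. G $ n \<ge> 0"
  shows "F $ i * G $ j \<le> (F * G) $ (i + j)"
proof -
  have "F $ i * G $ (i + j - i) \<le> (\<Sum>l=0..i + j. F $ l * G $ (i + j - l))"
    using assms by (intro member_le_sum[of i "{0..i + j}" "\<lambda>l. F $ l * G $ (i + j - l)"]) auto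
  then show ?thesis by (simp add: fps_mult_nth)
qed

lemma exp_le_quadratic:
  fixes x :: real
  assumes "\<bar>x\<bar> \<le> 1"
  shows "exp x \<le> 1 + x + x\<^sup>2"
proof (cases "x \<ge> 0")
  case True
  then show ?thesis using assms exp_bound[of x] by simp
next
  case False
  \<comment> \<open>The product of \<open>1 - y + y^2\<close> with the lower bound
    \<open>1 + y + y^2 / 2\<close> for \<open>exp y\<close> is at least 1.\<close>
  define y where "y = - x"
  have y: "y \<ge> 0" using False by (simp add: y_def)
  have "(1 - y + y\<^sup>2) * (1 + y + y\<^sup>2 / 2) = 1 + (y * y + y * y * y + y * y * y * y) / 2"
    by (simp add: field_simps power2_eq_square)
  then have "1 \<le> (1 - y + y\<^sup>2) * (1 + y + y\<^sup>2 / 2)" using y by simp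
  also have "\<dots> \<le> (1 - y + y\<^sup>2) * exp y"
  proof (rule mult_left_mono[OF exp_lower_Taylor_quadratic[OF y]])
    have "1 - y + y\<^sup>2 = (1 - y / 2)\<^sup>2 + 3 / 4 * y\<^sup>2" by (simp add: power2_eq_square algebra_simps)
    then show "0 \<le> 1 - y + y\<^sup>2" by simp
  qed
  finally have "exp (- y) * 1 \<le> exp (- y) * ((1 - y + y\<^sup>2) * exp y)"
    by (intro mult_left_mono) auto
  also have "\<dots> = 1 - y + y\<^sup>2" by (simp add: exp_minus)
  finally show ?thesis by (simp add: y_def)
qed

context weights begin

lemma Phi_power_nonneg: "(\<Phi> ^ j) $ k \<ge> 0"
  by (intro fps_power_nonneg) (simp add: nonneg)

lemma Z_pos_nth:
  assumes "n > 0"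
  shows "real n * Z w n = (\<Phi> ^ n) $ (n - 1)"
  using assms Z_nth[of n] by (cases n) simp_all

text \<open>By Lagrange's formula \<open>n Z_n\<close> is one coefficient of
  \<open>\<Phi>^n\<close>, and a single term of this nonnegative series is at most its value
  \<open>P^n\<close> at \<open>s\<close>.\<close>

lemma Z_upper:
  assumes "(\<lambda>k. w k * s ^ k) sums P" "s > 0" "n > 0"
  shows "real n * Z w n \<le> s * (P / s) ^ n"
proof -
  have sums: "(\<lambda>k. (\<Phi> ^ n) $ k * s ^ k) sums (P ^ n)"
    using assms nonneg by (intro fps_power_sums) auto
  have "(\<Phi> ^ n) $ (n - 1) * s ^ (n - 1) \<le> P ^ n"
    using sum_le_suminf[of "\<lambda>k. (\<Phi> ^ n) $ k * s ^ k" "{n - 1}"] sums assms Phi_power_nonneg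
    by (auto simp: sums_iff)
  moreover have "s ^ n = s * s ^ (n - 1)" using assms by (cases n) auto
  ultimately show ?thesis
    unfolding Z_pos_nth[OF assms(3)] using assms by (simp add: power_divide field_simps)
qed

text \<open>Evaluate \<open>T = X \<Phi>(T)\<close> at \<open>y\<close>, comparing the partial sums
  of \<open>\<Phi>(x)\<close> with \<open>x / y\<close> coefficient by coefficient. Convergence of
  \<open>T\<close> at \<open>y\<close> thus yields a point \<open>x\<close> with
  \<open>\<Phi>(x) / x \<le> 1 / y\<close>.\<close>

lemma Phi_le_of_summable_T:
  assumes y: "y > 0" and T: "(\<lambda>n. Z w n * y ^ n) sums x"
  shows "summable (\<lambda>k. w k * x ^ k)" "(\<Sum>k. w k * x ^ k) \<le> x / y" "x > 0"
proof -
  have "Z w 1 = (\<Phi> ^ 1) $ 0" using Z_pos_nth[of 1] by simp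
  then have "Z w 1 * y ^ 1 > 0" using pos0 y by simp
  moreover have "(\<Sum>n\<in>{1}. Z w n * y ^ n) \<le> suminf (\<lambda>n. Z w n * y ^ n)"
    using T y Z_nonneg by (intro sum_le_suminf) (auto simp: sums_iff)
  ultimately show x: "x > 0" using T by (simp add: sums_iff)
  have Tj: "(\<lambda>n. (T ^ j) $ n * y ^ n) sums (x ^ j)" for j
    using T y Z_nonneg by (intro fps_power_sums) auto
  have bound: "(\<Sum>j\<le>J. w j * x ^ j) \<le> x / y" for J
  proof -
    have 1: "(\<lambda>n. \<Sum>j\<le>J. w j * ((T ^ j) $ n * y ^ n)) sums (\<Sum>j\<le>J. w j * x ^ j)"
      by (intro sums_sum sums_mult Tj)
    have "(\<lambda>n. Z w (Suc n) * y ^ Suc n) sums (x - Z w 0 * y ^ 0)"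
      using T by (subst sums_Suc_iff) simp
    then have "(\<lambda>n. Z w (Suc n) * y ^ Suc n / y) sums (x / y)"
      by (intro sums_divide) (simp add: Z_0)
    then have 2: "(\<lambda>n. Z w (Suc n) * y ^ n) sums (x / y)" using y by simp
    show ?thesis
    proof (rule sums_le[OF _ 1 2])
      fix n
      have "(\<Sum>j\<le>J. w j * (T ^ j) $ n) = (\<Sum>j\<in>{..J} \<inter> {0..n}. w j * (T ^ j) $ n)"
        by (intro sum.mono_neutral_right) (auto simp: Tf_power_nth_eq_0)
      also have "\<dots> \<le> (\<Sum>j\<in>{0..n}. w j * (T ^ j) $ n)"
        by (intro sum_mono2) (auto intro!: mult_nonneg_nonneg nonneg fps_power_nonneg simp: Z_nonneg)
      also have "\<dots> = (\<Phi> oo T) $ n" by (simp add: fps_compose_nth)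
      also have "\<dots> = T $ Suc n" by (subst (2) Tf_eq) simp
      finally have "(\<Sum>j\<le>J. w j * (T ^ j) $ n) * y ^ n \<le> Z w (Suc n) * y ^ n"
        using y by (intro mult_right_mono) auto
      then show "(\<Sum>j\<le>J. w j * ((T ^ j) $ n * y ^ n)) \<le> Z w (Suc n) * y ^ n"
        by (simp add: sum_distrib_right mult.assoc)
    qed
  qed
  have pos: "\<And>k. w k * x ^ k \<ge> 0" using nonneg x by simp
  show sm: "summable (\<lambda>k. w k * x ^ k)"
  proof (rule summableI_nonneg_bounded[OF pos])
    fix n
    have "(\<Sum>i<n. w i * x ^ i) \<le> (\<Sum>i\<le>n. w i * x ^ i)" using pos by (intro sum_mono2) auto
    then show "(\<Sum>i<n. w i * x ^ i) \<le> x / y" using bound[of n] by linarith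
  qed
  show "(\<Sum>k. w k * x ^ k) \<le> x / y"
  proof (rule suminf_le_const[OF sm])
    fix n
    have "(\<Sum>i<n. w i * x ^ i) \<le> (\<Sum>i\<le>n. w i * x ^ i)" using pos by (intro sum_mono2) auto
    then show "(\<Sum>i<n. w i * x ^ i) \<le> x / y" using bound[of n] by linarith
  qed
qed

text \<open>If all diagonal coefficients were below \<open>z^(-m)\<close>, then \<open>Z_n\<close>
  would be \<open>O(z^(-n))\<close> and \<open>T\<close> would converge at \<open>y < z\<close>, so
  that \<open>Phi_le_of_summable_T\<close> would produce a point violating
  \<open>big\<close>.\<close>

lemma exists_large_diagonal:
  assumes a: "a \<ge> 2" "w a > 0" and z: "0 < y" "y < z"
    and big: "\<And>x. x > 0 \<Longrightarrow> summable (\<lambda>k. w k * x ^ k) \<Longrightarrow> (\<Sum>k. w k * x ^ k) > x / y"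
  shows "\<exists>m>0. (\<Phi> ^ m) $ m * z ^ m \<ge> 1"
proof (rule ccontr)
  assume "\<not> ?thesis"
  then have less: "(\<Phi> ^ m) $ m * z ^ m < 1" if "m > 0" for m using that by (meson not_le)
  \<comment> \<open>Multiplication by \<open>\<Phi>^(a-1)\<close> moves the coefficient of index
    \<open>n - 1\<close> of \<open>\<Phi>^n\<close> to the diagonal. One factor \<open>w a\<close>
    and \<open>a - 2\<close> factors \<open>w 0\<close> have total degree \<open>a\<close>, so
    \<open>c\<close> is positive.\<close>
  define c where "c = (\<Phi> ^ (a - 1)) $ a"
  have "\<Phi> $ a * (\<Phi> ^ (a - 2)) $ 0 \<le> (\<Phi> * \<Phi> ^ (a - 2)) $ (a + 0)"
    by (intro fps_mult_nth_ge Phi_power_nonneg) (simp add: nonneg)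
  moreover have "a - 1 = Suc (a - 2)" using a by simp
  then have "\<Phi> * \<Phi> ^ (a - 2) = \<Phi> ^ (a - 1)" by simp
  ultimately have "w a * w 0 ^ (a - 2) \<le> c" by (simp add: c_def fps_power_zeroth)
  moreover have "w a * w 0 ^ (a - 2) > 0" using a pos0 by simp
  ultimately have c: "c > 0" by linarith
  have Zb: "Z w n * z ^ n \<le> 1 / (c * z ^ (a - 1))" if n: "n > 0" for n
  proof -
    have "(\<Phi> ^ n) $ (n - 1) * c \<le> (\<Phi> ^ n * \<Phi> ^ (a - 1)) $ ((n - 1) + a)"
      unfolding c_def by (intro fps_mult_nth_ge Phi_power_nonneg)
    also have "\<Phi> ^ n * \<Phi> ^ (a - 1) = \<Phi> ^ (n + a - 1)" using n a by (simp flip: power_add)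
    also have "(n - 1) + a = n + a - 1" using n a by simp
    finally have "real n * Z w n * c \<le> (\<Phi> ^ (n + a - 1)) $ (n + a - 1)"
      by (simp add: Z_pos_nth[OF n])
    moreover have "1 * (Z w n * c) \<le> real n * (Z w n * c)"
      using n c Z_nonneg[of n] by (intro mult_right_mono) auto
    ultimately have "Z w n * c \<le> (\<Phi> ^ (n + a - 1)) $ (n + a - 1)" by simp
    then have "Z w n * c * z ^ (n + a - 1) \<le> (\<Phi> ^ (n + a - 1)) $ (n + a - 1) * z ^ (n + a - 1)"
      using z by (intro mult_right_mono) auto
    also have "\<dots> \<le> 1" using less[of "n + a - 1"] n a by simp
    also have "z ^ (n + a - 1) = z ^ n * z ^ (a - 1)" using a by (simp flip: power_add)
    finally show ?thesis using c z by (simp add: field_simps)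
  qed
  have "summable (\<lambda>n. Z w n * y ^ n)"
  proof (rule summable_comparison_test'[where N = 1])
    show "summable (\<lambda>n. 1 / (c * z ^ (a - 1)) * (y / z) ^ n)"
      using z by (intro summable_mult summable_geometric) auto
    fix n :: nat assume "1 \<le> n"
    then have "Z w n * z ^ n * (y / z) ^ n \<le> 1 / (c * z ^ (a - 1)) * (y / z) ^ n"
      using z by (intro mult_right_mono Zb) auto
    then show "norm (Z w n * y ^ n) \<le> 1 / (c * z ^ (a - 1)) * (y / z) ^ n"
      using z Z_nonneg[of n] by (simp add: power_divide)
  qed
  then obtain x where x: "(\<lambda>n. Z w n * y ^ n) sums x" by (auto simp: summable_def)
  show False using Phi_le_of_summable_T[OF z(1) x] big[of x] by simp
qed

text \<open>Powers of \<open>\<Phi>\<close> are supermultiplicative on the diagonal, as in Fekete's lemma; the residue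
  classes modulo \<open>m\<close> take care of those \<open>n\<close> for which there are no trees.\<close>

lemma Z_lower:
  assumes m: "m > 0" "(\<Phi> ^ m) $ m * z ^ m \<ge> 1" and z: "z > 0"
  shows "\<exists>c>0. \<forall>n. Z w n > 0 \<longrightarrow> real n * Z w n * z ^ n \<ge> c"
proof -
  have "\<exists>c>0. \<forall>n. Z w n > 0 \<and> n mod m = r \<longrightarrow> real n * Z w n * z ^ n \<ge> c" for r
  proof (cases "\<exists>n. Z w n > 0 \<and> n mod m = r")
    case False
    then show ?thesis by (intro exI[of _ 1]) auto
  next
    case True
    define n0 where "n0 = (LEAST n. Z w n > 0 \<and> n mod m = r)"
    have n0: "Z w n0 > 0" "n0 mod m = r" using LeastI_ex[OF True] by (auto simp: n0_def)
    have n0_pos: "n0 > 0" using n0 Z_0 by (cases n0) auto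
    show ?thesis
    proof (intro exI[of _ "real n0 * Z w n0 * z ^ n0"] conjI allI impI)
      show "real n0 * Z w n0 * z ^ n0 > 0" using n0 n0_pos z by simp
      fix n assume n: "Z w n > 0 \<and> n mod m = r"
      then have "n0 \<le> n" unfolding n0_def by (intro Least_le)
      then have "m dvd n - n0" using n n0 by (simp add: mod_eq_dvd_iff_nat[symmetric])
      then obtain q where "n - n0 = m * q" by (rule dvdE)
      then have q: "n = q * m + n0" using \<open>n0 \<le> n\<close> by (simp add: mult.commute)
      have "real n0 * Z w n0 * z ^ n0 \<le> real (q * m + n0) * Z w (q * m + n0) * z ^ (q * m + n0)"
      proof (induction q)
        case (Suc q)
        define k where "k = q * m + n0"
        have k: "k > 0" using n0_pos by (simp add: k_def)
        have "(\<Phi> ^ m) $ m * (\<Phi> ^ k) $ (k - 1) \<le> (\<Phi> ^ m * \<Phi> ^ k) $ (m + (k - 1))"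
          by (intro fps_mult_nth_ge Phi_power_nonneg)
        also have "\<dots> = (\<Phi> ^ (m + k)) $ (m + k - 1)" using k by (simp flip: power_add)
        finally have *: "(\<Phi> ^ m) $ m * (real k * Z w k) \<le> real (m + k) * Z w (m + k)"
          using k by (simp add: Z_pos_nth del: of_nat_add)
        have "1 * (real k * Z w k * z ^ k) \<le> ((\<Phi> ^ m) $ m * z ^ m) * (real k * Z w k * z ^ k)"
          using m z Z_nonneg[of k] by (intro mult_right_mono) auto
        also have "\<dots> = (\<Phi> ^ m) $ m * (real k * Z w k) * z ^ (m + k)" by (simp add: power_add)
        also have "\<dots> \<le> real (m + k) * Z w (m + k) * z ^ (m + k)"
          using * z by (intro mult_right_mono) auto
        finally show ?case using Suc by (simp add: k_def add.assoc)
      qed simp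
      then show "real n0 * Z w n0 * z ^ n0 \<le> real n * Z w n * z ^ n" by (simp add: q)
    qed
  qed
  then obtain c where c: "\<And>r. c r > 0" "\<And>r n. Z w n > 0 \<Longrightarrow> n mod m = r \<Longrightarrow> real n * Z w n * z ^ n \<ge> c r"
    by metis
  show ?thesis
  proof (intro exI[of _ "Min (c ` {..<m})"] conjI allI impI)
    show "Min (c ` {..<m}) > 0" using m c by (subst Min_gr_iff) auto
    fix n assume "Z w n > 0"
    moreover have "Min (c ` {..<m}) \<le> c (n mod m)" using m by (intro Min_le) auto
    ultimately show "Min (c ` {..<m}) \<le> real n * Z w n * z ^ n" using c(2)[of n "n mod m"] by simp
  qed
qed

text \<open>Chernoff's method with the weights tilted by \<open>exp (\<theta> g)\<close>. By
  \<open>max\<close> the point \<open>s\<close> minimises \<open>\<Phi>(x) / x\<close>, so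
  \<open>n Z_n\<close> is at least of order \<open>z^(-n)\<close> for every \<open>z > s / P\<close>
  whenever \<open>Z_n > 0\<close>, while \<open>Z_upper\<close> at the same \<open>s\<close> bounds
  the tilted sum. A negative \<open>g\<close> gives lower deviations.\<close>

lemma large_deviation:
  fixes g :: "nat \<Rightarrow> real"
  assumes a: "a \<ge> 2" "w a > 0" and s: "s > 0" "(\<lambda>k. w k * s ^ k) sums P"
    and max: "\<And>x. x > 0 \<Longrightarrow> summable (\<lambda>k. w k * x ^ k) \<Longrightarrow> (\<Sum>k. w k * x ^ k) / x \<ge> P / s"
    and g: "\<And>k. \<bar>g k\<bar> \<le> G" "(\<Sum>k. g k * (w k * s ^ k)) < b * P" and \<eta>: "\<eta> > 0"
  shows "eventually (\<lambda>n. tree_gf w (\<lambda>t. if vsum g t \<ge> b * real n then 1 else 0) $ n \<le> \<eta> * Z w n) sequentially"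
proof -
  define p where "p k = w k * s ^ k" for k
  have p: "p k \<ge> 0" for k using nonneg s by (simp add: p_def)
  have p_sums: "p sums P" using s by (simp add: p_def[abs_def])
  have p_sm: "summable p" and Pp: "P = suminf p" using p_sums by (auto simp: sums_iff)
  have "p 0 > 0" using pos0 by (simp add: p_def)
  then have Ppos: "P > 0" unfolding Pp by (intro suminf_pos2[OF p_sm p])
  have G: "G \<ge> 0" using g(1)[of 0] by linarith
  have gp_sm: "summable (\<lambda>k. g k * p k)"
  proof (rule summable_comparison_test'[where N = 0])
    show "summable (\<lambda>k. G * p k)" using p_sm by (rule summable_mult)
    show "norm (g n * p n) \<le> G * p n" for n
      using g(1)[of n] p[of n] by (simp add: abs_mult mult_right_mono)
  qed
  define \<mu> where "\<mu> = (\<Sum>k. g k * p k) / P"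
  have \<mu>: "\<mu> < b" using g(2) Ppos by (simp add: \<mu>_def p_def field_simps)
  \<comment> \<open>The first bound makes \<open>\<theta> g\<close> at most 1 in absolute value, for
    \<open>exp_le_quadratic\<close>; the second keeps the quadratic error
    \<open>\<theta> G^2\<close> below the gap \<open>b - \<mu>\<close>.\<close>
  define \<theta> where "\<theta> = min (1 / (G + 1)) ((b - \<mu>) / (2 * (G\<^sup>2 + 1)))"
  have \<theta>: "\<theta> > 0" using G \<mu> by (simp add: \<theta>_def add_nonneg_pos)
  have "\<theta> * G \<le> 1 / (G + 1) * G" using G by (intro mult_right_mono) (auto simp: \<theta>_def)
  also have "\<dots> \<le> 1" using G by simp
  finally have \<theta>G: "\<theta> * G \<le> 1" .
  have "\<theta> * G\<^sup>2 \<le> (b - \<mu>) / (2 * (G\<^sup>2 + 1)) * (G\<^sup>2 + 1)"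
    using \<theta> \<mu> by (intro mult_mono) (auto simp: \<theta>_def)
  also have "\<dots> = (b - \<mu>) / 2"
  proof -
    have "x / (2 * y) * y = x / 2" if "y \<noteq> 0" for x y :: real using that by simp
    moreover have "G\<^sup>2 + 1 > 0" by (intro add_nonneg_pos) auto
    ultimately show ?thesis by (metis less_irrefl)
  qed
  finally have \<theta>G2: "\<theta> * G\<^sup>2 < b - \<mu>" using \<mu> by simp
  let ?w = "\<lambda>k. w k * exp (\<theta> * g k)"
  interpret tw: weights ?w by unfold_locales (use nonneg pos0 in auto)
  have exp_le: "exp (\<theta> * g k) \<le> 1 + \<theta> * g k + \<theta>\<^sup>2 * G\<^sup>2" for k
  proof -
    have "\<bar>\<theta> * g k\<bar> \<le> \<theta> * G" using g(1)[of k] \<theta> by (simp add: abs_mult)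
    then have "exp (\<theta> * g k) \<le> 1 + \<theta> * g k + (\<theta> * g k)\<^sup>2" and "(\<theta> * g k)\<^sup>2 \<le> (\<theta> * G)\<^sup>2"
      using \<theta>G by (auto intro: exp_le_quadratic simp: abs_le_square_iff[symmetric])
    then show ?thesis by (simp add: power_mult_distrib)
  qed
  have up_sums: "(\<lambda>k. (p k + \<theta> * (g k * p k)) + \<theta>\<^sup>2 * G\<^sup>2 * p k) sums ((P + \<theta> * (\<mu> * P)) + \<theta>\<^sup>2 * G\<^sup>2 * P)"
    using gp_sm Ppos by (intro sums_add sums_mult p_sums) (simp add: \<mu>_def sums_iff)
  have up: "exp (\<theta> * g k) * p k \<le> (p k + \<theta> * (g k * p k)) + \<theta>\<^sup>2 * G\<^sup>2 * p k" for k
    using mult_right_mono[OF exp_le[of k] p[of k]] by (simp add: algebra_simps)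
  have e_sm: "summable (\<lambda>k. exp (\<theta> * g k) * p k)"
    by (rule summable_comparison_test'[where N = 0, OF sums_summable[OF up_sums]]) (use up p in \<open>simp add: abs_mult\<close>)
  define Q where "Q = (\<Sum>k. exp (\<theta> * g k) * p k)"
  have Q_sums: "(\<lambda>k. ?w k * s ^ k) sums Q"
    using e_sm by (simp add: Q_def sums_iff p_def mult_ac)
  have "exp (\<theta> * g 0) * p 0 > 0" using \<open>p 0 > 0\<close> by simp
  then have Qpos: "Q > 0" unfolding Q_def using p by (intro suminf_pos2[OF e_sm]) auto
  have "Q \<le> (P + \<theta> * (\<mu> * P)) + \<theta>\<^sup>2 * G\<^sup>2 * P"
    unfolding Q_def using sums_le[OF up summable_sums[OF e_sm] up_sums] .
  also have "\<dots> = P * (1 + \<theta> * (\<mu> + \<theta> * G\<^sup>2))" by (simp add: power2_eq_square algebra_simps)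
  also have "\<dots> < P * (1 + \<theta> * b)"
    using Ppos \<theta> \<theta>G2 by (intro mult_strict_left_mono add_strict_left_mono) auto
  also have "\<dots> \<le> P * exp (\<theta> * b)"
    using Ppos exp_ge_add_one_self[of "\<theta> * b"] by (intro mult_left_mono) auto
  finally have QP: "Q < P * exp (\<theta> * b)" .
  have RR: "s / P < s * exp (\<theta> * b) / Q" using QP s Qpos Ppos by (simp add: field_simps)
  \<comment> \<open>\<open>y > s / P\<close> puts \<open>1 / y\<close> below the minimum of
    \<open>\<Phi>(x) / x\<close>, \<open>z > y\<close> gives the lower bound on \<open>Z_n\<close>,
    and the upper bound on \<open>z\<close> makes the ratio \<open>q\<close> below less than
    1.\<close>
  then obtain y where y: "s / P < y" "y < s * exp (\<theta> * b) / Q" using dense by blast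
  then obtain z where z: "y < z" "z < s * exp (\<theta> * b) / Q" using dense by blast
  have ypos: "y > 0" using y(1) s Ppos by (meson divide_pos_pos less_trans)
  have zpos: "z > 0" using ypos z by simp
  have big: "(\<Sum>k. w k * x ^ k) > x / y" if "x > 0" "summable (\<lambda>k. w k * x ^ k)" for x
  proof -
    have "1 / y < P / s" using y(1) ypos s Ppos by (simp add: field_simps)
    also have "\<dots> \<le> (\<Sum>k. w k * x ^ k) / x" using max that by simp
    finally show ?thesis using that by (simp add: field_simps)
  qed
  obtain m where m: "m > 0" "(\<Phi> ^ m) $ m * z ^ m \<ge> 1"
    using exists_large_diagonal[OF a ypos z(1) big] by blast
  obtain c where c: "c > 0" "\<And>n. Z w n > 0 \<Longrightarrow> real n * Z w n * z ^ n \<ge> c"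
    using Z_lower[OF m zpos] by blast
  define q where "q = z * Q / (s * exp (\<theta> * b))"
  have q: "0 < q" "q < 1"
    using z(2) zpos Qpos s by (auto simp: q_def field_simps)
  have main: "tree_gf w (\<lambda>t. if vsum g t \<ge> b * real n then 1 else 0) $ n \<le> s / c * q ^ n * Z w n" if n: "n > 0" for n
  proof (cases "Z w n > 0")
    case False
    then have "Z w n = 0" using Z_nonneg[of n] by simp
    moreover have "tree_gf w (\<lambda>t. if vsum g t \<ge> b * real n then 1 else 0) $ n \<le> tree_gf w (\<lambda>t. 1) $ n"
      by (intro tree_gf_mono) auto
    ultimately show ?thesis by (simp add: tree_gf_const)
  next
    case True
    have "tree_gf w (\<lambda>t. if vsum g t \<ge> b * real n then 1 else 0) $ n
        \<le> tree_gf w (\<lambda>t. exp (- (\<theta> * b * real n)) * tree_weight (\<lambda>k. exp (\<theta> * g k)) t) $ n"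
    proof (intro tree_gf_mono)
      fix t
      show "(if vsum g t \<ge> b * real n then 1 else 0)
          \<le> exp (- (\<theta> * b * real n)) * tree_weight (\<lambda>k. exp (\<theta> * g k)) t"
      proof (cases "vsum g t \<ge> b * real n")
        case True
        then have "\<theta> * (b * real n) \<le> \<theta> * vsum g t" using \<theta> by (intro mult_left_mono) auto
        then show ?thesis using True by (simp add: tree_weight_exp sum_distrib_left flip: exp_add)
      next
        case False
        then show ?thesis by (simp add: tree_weight_exp)
      qed
    qed
    also have "\<dots> = exp (- (\<theta> * b * real n)) * Z ?w n"
      unfolding Z_mult by (simp add: tree_gf_def sum_distrib_left mult_ac)
    finally have 1: "real n * tree_gf w (\<lambda>t. if vsum g t \<ge> b * real n then 1 else 0) $ n
        \<le> exp (- (\<theta> * b * real n)) * (real n * Z ?w n)"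
      using n by (simp add: mult_left_mono)
    also have "\<dots> \<le> exp (- (\<theta> * b * real n)) * (s * (Q / s) ^ n)"
      using tw.Z_upper[OF Q_sums s(1) n] by (intro mult_left_mono) auto
    also have "exp (- (\<theta> * b * real n)) = (1 / exp (\<theta> * b)) ^ n"
      by (simp add: exp_minus exp_of_nat_mult[symmetric] power_divide field_simps)
    also have "(1 / exp (\<theta> * b)) ^ n * (s * (Q / s) ^ n) = s * (q / z) ^ n"
      using zpos s by (simp add: q_def power_mult_distrib[symmetric] mult.commute)
    also have "\<dots> = s * q ^ n / z ^ n" by (simp add: power_divide)
    also have "\<dots> \<le> s * q ^ n / z ^ n * (real n * Z w n * z ^ n / c)"
    proof -
      have "1 \<le> real n * Z w n * z ^ n / c" using c(1) c(2)[OF True] by simp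
      from mult_left_mono[OF this, of "s * q ^ n / z ^ n"] show ?thesis using s q zpos by simp
    qed
    also have "\<dots> = real n * (s / c * q ^ n * Z w n)" using zpos by simp
    finally show ?thesis using n by (simp only: mult_le_cancel_left_pos of_nat_0_less_iff)
  qed
  have "(\<lambda>n. s / c * q ^ n) \<longlonglongrightarrow> s / c * 0"
    using q by (intro tendsto_intros LIMSEQ_power_zero) auto
  then have "eventually (\<lambda>n. s / c * q ^ n < \<eta>) sequentially"
    using \<eta> by (auto dest: order_tendstoD)
  with eventually_gt_at_top[of 0] show ?thesis
  proof eventually_elim
    case (elim n)
    then have "s / c * q ^ n * Z w n \<le> \<eta> * Z w n" using Z_nonneg[of n] by (intro mult_right_mono) auto
    then show ?case using main[OF elim(1)] by linarith
  qed
qed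

end

section \<open>Typical degrees\<close>

context weights begin

text \<open>When the radius of convergence is zero, there is no tilt. Instead, \<open>b\<close> vertices of degree \<open>a\<close> are
  replaced by \<open>a\<close> vertices of degree \<open>b\<close> and \<open>b - a\<close> leaves, where \<open>w b\<close> is very large.\<close>

lemma Z_marked_degree_le:
  fixes a b :: nat
  assumes b: "b \<ge> a" "b > 0" "w b > 0" and \<kappa>: "0 < \<kappa>" "\<kappa> \<le> 1" "w a ^ b \<le> \<kappa> ^ b * (w b ^ a * w 0 ^ (b - a))"
    and n: "n > 0"
  shows "real n * Z (\<lambda>k. w k * (if k = a then 2 else 1)) n \<le> (1 / \<kappa>) ^ b * (1 + \<kappa>) ^ n * (real n * Z w n)"
proof -
  let ?w = "\<lambda>k. w k * (if k = a then 2 else 1)"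
  interpret tw: weights ?w by unfold_locales (use nonneg pos0 in auto)
  \<comment> \<open>\<open>Q\<close> is the total weight of the sequences of \<open>b\<close>
    degrees with sum \<open>a b\<close>; one of them has \<open>a\<close> entries \<open>b\<close>
    and \<open>b - a\<close> entries 0.\<close>
  define Q where "Q = (\<Phi> ^ b) $ (a * b)"
  have "w b ^ a * w 0 ^ (b - a) = (\<Phi> $ b) ^ a * (\<Phi> ^ (b - a)) $ 0" by (simp add: fps_power_zeroth)
  also have "(\<Phi> $ b) ^ a \<le> (\<Phi> ^ a) $ (a * b)"
  proof (induction a)
    case (Suc i)
    have "\<Phi> $ b * (\<Phi> $ b) ^ i \<le> \<Phi> $ b * (\<Phi> ^ i) $ (i * b)"
      using Suc nonneg by (intro mult_left_mono) auto
    also have "\<dots> \<le> (\<Phi> * \<Phi> ^ i) $ (b + i * b)"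
      by (intro fps_mult_nth_ge Phi_power_nonneg) (simp add: nonneg)
    finally show ?case by simp
  qed simp
  also have "(\<Phi> ^ a) $ (a * b) * (\<Phi> ^ (b - a)) $ 0 \<le> (\<Phi> ^ a * \<Phi> ^ (b - a)) $ (a * b + 0)"
    by (intro fps_mult_nth_ge Phi_power_nonneg)
  also have "\<Phi> ^ a * \<Phi> ^ (b - a) = \<Phi> ^ b" using b by (simp flip: power_add)
  finally have Q: "w b ^ a * w 0 ^ (b - a) \<le> Q"
    using Phi_power_nonneg by (simp add: Q_def mult_right_mono)
  have "w b ^ a * w 0 ^ (b - a) > 0" using b pos0 by simp
  then have Qpos: "Q > 0" using Q by linarith
  have wQ: "w a ^ b \<le> \<kappa> ^ b * Q"
    using \<kappa>(1) by (intro order_trans[OF \<kappa>(3)] mult_left_mono Q) auto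
  have Qq: "Q ^ q \<le> (\<Phi> ^ (b * q)) $ (a * b * q)" for q
  proof (induction q)
    case (Suc q)
    have "Q * Q ^ q \<le> Q * (\<Phi> ^ (b * q)) $ (a * b * q)" using Suc Qpos by (intro mult_left_mono) auto
    also have "\<dots> \<le> (\<Phi> ^ b * \<Phi> ^ (b * q)) $ (a * b + a * b * q)"
      unfolding Q_def by (intro fps_mult_nth_ge Phi_power_nonneg)
    finally show ?case by (simp add: power_add algebra_simps)
  qed simp
  have wr: "w a ^ r \<le> (\<Phi> ^ r) $ (a * r)" for r
  proof (induction r)
    case (Suc r)
    have "w a * w a ^ r \<le> \<Phi> $ a * (\<Phi> ^ r) $ (a * r)" using Suc nonneg by (auto intro!: mult_left_mono)
    also have "\<dots> \<le> (\<Phi> * \<Phi> ^ r) $ (a + a * r)"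
      by (intro fps_mult_nth_ge Phi_power_nonneg) (simp add: nonneg)
    finally show ?case by simp
  qed simp
  \<comment> \<open>With \<open>j\<close> positions reserved for degree \<open>a\<close>, this is
    the total weight of the other \<open>n - j\<close> degrees, whose sum is
    \<open>n - 1 - a j\<close>.\<close>
  let ?V = "\<lambda>j. (fps_X * (fps_X ^ (a * j) * \<Phi> ^ (n - j))) $ n"
  have V: "w a ^ j * ?V j \<le> (1 / \<kappa>) ^ b * \<kappa> ^ j * (real n * Z w n)" if j: "j \<le> n" for j
  proof (cases "a * j \<le> n - 1")
    case False
    then have "?V j = 0" using n by (cases n) (simp_all add: fps_X_power_mult_nth)
    then show ?thesis using \<kappa> Z_nonneg by simp
  next
    case True
    \<comment> \<open>Each of the \<open>q\<close> full blocks of \<open>b\<close> degrees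
      \<open>a\<close> is exchanged for \<open>Q\<close>, which gains \<open>\<kappa>^b\<close>. The
      \<open>r < b\<close> left over are kept, at the cost of the constant
      \<open>(1 / \<kappa>)^b\<close>.\<close>
    define q r where "q = j div b" and "r = j mod b"
    have jqr: "j = b * q + r" by (simp add: q_def r_def)
    define i where "i = n - 1 - a * j"
    have V_eq: "?V j = (\<Phi> ^ (n - j)) $ i"
      using True n by (cases n) (simp_all add: fps_X_power_mult_nth i_def)
    have "Q ^ q * w a ^ r * ?V j \<le> (\<Phi> ^ (b * q)) $ (a * b * q) * (\<Phi> ^ r) $ (a * r) * (\<Phi> ^ (n - j)) $ i"
      unfolding V_eq using Qq wr Qpos nonneg Phi_power_nonneg
      by (intro mult_mono) (auto intro!: mult_nonneg_nonneg)
    also have "\<dots> \<le> (\<Phi> ^ (b * q) * \<Phi> ^ r) $ (a * b * q + a * r) * (\<Phi> ^ (n - j)) $ i"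
      by (intro mult_right_mono fps_mult_nth_ge Phi_power_nonneg)
    also have "\<dots> \<le> (\<Phi> ^ (b * q) * \<Phi> ^ r * \<Phi> ^ (n - j)) $ (a * b * q + a * r + i)"
      by (intro fps_mult_nth_ge Phi_power_nonneg) (simp add: Phi_power_nonneg flip: power_add)
    also have "\<Phi> ^ (b * q) * \<Phi> ^ r * \<Phi> ^ (n - j) = \<Phi> ^ n"
      using j by (simp add: jqr flip: power_add)
    also have "a * b * q + a * r + i = n - 1"
      using True by (simp add: i_def jqr algebra_simps)
    also have "(\<Phi> ^ n) $ (n - 1) = real n * Z w n" using n by (simp add: Z_pos_nth)
    finally have le: "Q ^ q * w a ^ r * ?V j \<le> real n * Z w n" .
    have Vn: "?V j \<ge> 0" unfolding V_eq by (rule Phi_power_nonneg)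
    have "w a ^ j * ?V j = (w a ^ b) ^ q * (w a ^ r * ?V j)"
      by (simp add: jqr power_add power_mult)
    also have "\<dots> \<le> (\<kappa> ^ b * Q) ^ q * (w a ^ r * ?V j)"
      using wQ nonneg Vn by (intro mult_right_mono power_mono) auto
    also have "\<dots> = \<kappa> ^ (b * q) * (Q ^ q * w a ^ r * ?V j)"
      by (simp add: power_mult_distrib power_mult)
    also have "\<dots> \<le> \<kappa> ^ (b * q) * (real n * Z w n)"
      using le \<kappa> by (intro mult_left_mono) auto
    also have "\<kappa> ^ (b * q) \<le> (1 / \<kappa>) ^ b * \<kappa> ^ j"
    proof -
      have "r \<le> b" using b by (simp add: r_def less_imp_le)
      then have "\<kappa> ^ b \<le> \<kappa> ^ r" using \<kappa> by (intro power_decreasing) auto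
      then have "1 \<le> (1 / \<kappa>) ^ b * \<kappa> ^ r" using \<kappa> by (simp add: power_divide)
      then have "\<kappa> ^ (b * q) * 1 \<le> \<kappa> ^ (b * q) * ((1 / \<kappa>) ^ b * \<kappa> ^ r)"
        using \<kappa> by (intro mult_left_mono) auto
      also have "\<dots> = (1 / \<kappa>) ^ b * \<kappa> ^ j" by (simp add: jqr power_add)
      finally show ?thesis by simp
    qed
    finally show ?thesis using Z_nonneg by (simp add: mult_right_mono)
  qed
  have eq: "Abs_fps ?w = fps_const (w a) * fps_X ^ a + \<Phi>"
    by (rule fps_ext) (simp add: fps_X_power_nth)
  have "real n * Z ?w n
      = (\<Sum>j\<le>n. fps_X * (of_nat (n choose j) * (fps_const (w a) * fps_X ^ a) ^ j * \<Phi> ^ (n - j))) $ n"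
    unfolding tw.Z_nth eq binomial_ring sum_distrib_left ..
  also have "\<dots> = (\<Sum>j\<le>n. real (n choose j) * (w a ^ j * ?V j))"
    unfolding fps_sum_nth
  proof (intro sum.cong refl)
    fix j
    have "fps_X * (of_nat (n choose j) * (fps_const (w a) * fps_X ^ a) ^ j * \<Phi> ^ (n - j))
      = fps_const (real (n choose j) * w a ^ j) * (fps_X * (fps_X ^ (a * j) * \<Phi> ^ (n - j)))"
      by (simp add: power_mult_distrib fps_const_power[symmetric] fps_of_nat[symmetric] power_mult
          fps_const_mult[symmetric] mult_ac del: fps_const_power fps_const_mult)
    then show "(fps_X * (of_nat (n choose j) * (fps_const (w a) * fps_X ^ a) ^ j * \<Phi> ^ (n - j))) $ n
       = real (n choose j) * (w a ^ j * ?V j)"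
      by (simp only: fps_mult_left_const_nth mult.assoc)
  qed
  also have "\<dots> \<le> (\<Sum>j\<le>n. real (n choose j) * ((1 / \<kappa>) ^ b * \<kappa> ^ j * (real n * Z w n)))"
    using V by (intro sum_mono mult_left_mono) auto
  also have "\<dots> = (1 / \<kappa>) ^ b * (real n * Z w n) * (\<Sum>j\<le>n. real (n choose j) * \<kappa> ^ j * 1 ^ (n - j))"
    by (simp add: sum_distrib_left mult_ac)
  also have "\<dots> = (1 / \<kappa>) ^ b * (real n * Z w n) * (\<kappa> + 1) ^ n"
    unfolding binomial_ring ..
  finally show ?thesis by (simp add: mult_ac add.commute)
qed

lemma zero_radius_large_weight:
  assumes r0: "\<And>x. x > 0 \<Longrightarrow> \<not> summable (\<lambda>k. w k * x ^ k)" and L: "L > 0"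
  shows "\<exists>b\<ge>N. w b \<ge> L ^ b"
proof (rule ccontr)
  assume "\<not> ?thesis"
  then have less: "\<And>b. b \<ge> N \<Longrightarrow> w b < L ^ b" by (meson not_le)
  have "summable (\<lambda>k. w k * (1 / (2 * L)) ^ k)"
  proof (rule summable_comparison_test'[where N = N])
    show "summable (\<lambda>k. (1 / 2 :: real) ^ k)" by (rule summable_geometric) simp
    fix k assume "N \<le> k"
    then have "w k * (1 / (2 * L)) ^ k \<le> L ^ k * (1 / (2 * L)) ^ k"
      using less[of k] L by (intro mult_right_mono) auto
    also have "\<dots> = (1 / 2) ^ k" using L by (simp flip: power_mult_distrib)
    finally show "norm (w k * (1 / (2 * L)) ^ k) \<le> (1 / 2) ^ k" using nonneg L by simp
  qed
  then show False using r0[of "1 / (2 * L)"] L by simp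
qed

text \<open>Markov's inequality for 2 to the power of the number of vertices of degree
  \<open>a\<close>. Doubling the weight of degree \<open>a\<close> increases \<open>Z_n\<close> by
  at most a constant times \<open>(1 + \<kappa>)^n\<close>, and \<open>\<kappa>\<close> is chosen
  with \<open>1 + \<kappa> < 2^c\<close>.\<close>

lemma few_vertices_of_degree:
  assumes r0: "\<And>x. x > 0 \<Longrightarrow> \<not> summable (\<lambda>k. w k * x ^ k)" and a: "a \<ge> 1"
    and c: "c > 0" and \<eta>: "\<eta> > 0"
  shows "eventually (\<lambda>n. tree_gf w (\<lambda>t. if vsum (\<lambda>d. if d = a then 1 else 0) t \<ge> c * real n then 1 else 0) $ n
    \<le> \<eta> * Z w n) sequentially"
proof -
  define \<kappa> where "\<kappa> = min 1 ((2 powr c - 1) / 2)"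
  have "2 powr c > 1" using c by simp
  moreover have "\<kappa> \<le> (2 powr c - 1) / 2" unfolding \<kappa>_def by (rule min.cobounded2)
  moreover have "1 + x < y" if "1 < y" "x \<le> (y - 1) / 2" for x y :: real using that by argo
  ultimately have "1 + \<kappa> < 2 powr c" by blast
  with \<open>2 powr c > 1\<close> have \<kappa>: "0 < \<kappa>" "\<kappa> \<le> 1" "1 + \<kappa> < 2 powr c"
    by (simp_all add: \<kappa>_def)
  \<comment> \<open>\<open>L\<close> absorbs \<open>w a\<close> and the surplus powers of
    \<open>w 0\<close>. Because \<open>L \<ge> 1\<close> and \<open>a \<ge> 1\<close>,
    \<open>L^b \<le> w b\<close> implies \<open>L^b \<le> (w b)^a\<close>.\<close>
  define L where "L = max 1 (max 1 (w a) * max 1 (w 0) / (\<kappa> * w 0))"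
  have L: "L \<ge> 1" by (simp add: L_def)
  obtain b where b: "b \<ge> a" "w b \<ge> L ^ b"
    using zero_radius_large_weight[OF r0, of L a] L by force
  have bpos: "b > 0" using a b by simp
  have wb: "w b > 0" using b L by (smt (verit) zero_less_power)
  have ineq: "w a ^ b \<le> \<kappa> ^ b * (w b ^ a * w 0 ^ (b - a))"
  proof -
    have "max 1 (w a) * max 1 (w 0) / (\<kappa> * w 0) \<le> L" by (simp add: L_def)
    then have "max 1 (w a) * max 1 (w 0) \<le> \<kappa> * L * w 0"
      using \<kappa> pos0 by (simp add: pos_divide_le_eq mult_ac)
    then have "(max 1 (w a) * max 1 (w 0)) ^ b \<le> (\<kappa> * L * w 0) ^ b"
      by (intro power_mono) auto
    then have 1: "max 1 (w a) ^ b * max 1 (w 0) ^ b \<le> \<kappa> ^ b * L ^ b * w 0 ^ b"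
      by (simp add: power_mult_distrib)
    have "L ^ b \<le> w b ^ a"
    proof -
      have "L ^ b = (L ^ b) ^ 1" by simp
      also have "\<dots> \<le> (L ^ b) ^ a" using a L by (intro power_increasing) auto
      also have "\<dots> \<le> w b ^ a" using b L by (intro power_mono) auto
      finally show ?thesis .
    qed
    then have 2: "\<kappa> ^ b * L ^ b * w 0 ^ b \<le> \<kappa> ^ b * w b ^ a * w 0 ^ b"
      using \<kappa> pos0 by (intro mult_right_mono mult_left_mono) auto
    have "w a ^ b * w 0 ^ a \<le> max 1 (w a) ^ b * max 1 (w 0) ^ b"
    proof (intro mult_mono)
      show "w a ^ b \<le> max 1 (w a) ^ b" using nonneg by (intro power_mono) auto
      have "w 0 ^ a \<le> max 1 (w 0) ^ a" using pos0 by (intro power_mono) auto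
      also have "\<dots> \<le> max 1 (w 0) ^ b" using b by (intro power_increasing) auto
      finally show "w 0 ^ a \<le> max 1 (w 0) ^ b" .
    qed (use pos0 nonneg in auto)
    also note 1
    also note 2
    also have "w 0 ^ b = w 0 ^ (b - a) * w 0 ^ a" using b by (simp flip: power_add)
    finally have "w a ^ b * w 0 ^ a \<le> \<kappa> ^ b * (w b ^ a * w 0 ^ (b - a)) * w 0 ^ a"
      by (simp add: mult_ac)
    then show ?thesis using pos0 by simp
  qed
  define q where "q = (1 + \<kappa>) / 2 powr c"
  have q: "0 < q" "q < 1" using \<kappa> by (auto simp: q_def)
  have main: "tree_gf w (\<lambda>t. if vsum (\<lambda>d. if d = a then 1 else 0) t \<ge> c * real n then 1 else 0) $ n
      \<le> (1 / \<kappa>) ^ b * q ^ n * Z w n" if n: "n > 0" for n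
  proof -
    let ?h = "\<lambda>d. if d = a then 2 else 1 :: real"
    have h: "?h = (\<lambda>d. exp (ln 2 * (if d = a then 1 else 0)))" by auto
    have th: "tree_weight ?h t = 2 powr (vsum (\<lambda>d. if d = a then 1 else 0) t)" for t
      unfolding h tree_weight_exp sum_distrib_left[symmetric] by (simp add: powr_def mult.commute)
    have "tree_gf w (\<lambda>t. if vsum (\<lambda>d. if d = a then 1 else 0) t \<ge> c * real n then 1 else 0) $ n
       \<le> tree_gf w (\<lambda>t. (1 / 2 powr c) ^ n * tree_weight ?h t) $ n"
    proof (intro tree_gf_mono)
      fix t
      have e: "(1 / 2 powr c) ^ n = 2 powr (- (c * real n))"
        by (simp add: power_divide powr_minus_divide powr_power mult.commute)
      show "(if vsum (\<lambda>d. if d = a then 1 else 0) t \<ge> c * real n then 1 else 0)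
          \<le> (1 / 2 powr c) ^ n * tree_weight ?h t"
        unfolding e th powr_add[symmetric] by (auto intro!: ge_one_powr_ge_zero)
    qed
    also have "\<dots> = (1 / 2 powr c) ^ n * Z (\<lambda>k. w k * ?h k) n"
      unfolding Z_mult by (simp add: tree_gf_def sum_distrib_left mult_ac)
    also have "\<dots> \<le> (1 / 2 powr c) ^ n * ((1 / \<kappa>) ^ b * (1 + \<kappa>) ^ n * Z w n)"
    proof (intro mult_left_mono)
      have "real n * Z (\<lambda>k. w k * ?h k) n \<le> real n * ((1 / \<kappa>) ^ b * (1 + \<kappa>) ^ n * Z w n)"
        using Z_marked_degree_le[OF b(1) bpos wb \<kappa>(1,2) ineq n] by (simp add: mult_ac)
      then show "Z (\<lambda>k. w k * ?h k) n \<le> (1 / \<kappa>) ^ b * (1 + \<kappa>) ^ n * Z w n"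
        using n by (simp only: mult_le_cancel_left_pos of_nat_0_less_iff)
    qed auto
    also have "\<dots> = (1 / \<kappa>) ^ b * q ^ n * Z w n"
      by (simp add: q_def power_divide)
    finally show ?thesis .
  qed
  have "(\<lambda>n. (1 / \<kappa>) ^ b * q ^ n) \<longlonglongrightarrow> (1 / \<kappa>) ^ b * 0"
    using q by (intro tendsto_intros LIMSEQ_power_zero) auto
  then have "eventually (\<lambda>n. (1 / \<kappa>) ^ b * q ^ n < \<eta>) sequentially"
    using \<eta> by (auto dest: order_tendstoD)
  with eventually_gt_at_top[of 0] show ?thesis
  proof eventually_elim
    case (elim n)
    then have "(1 / \<kappa>) ^ b * q ^ n * Z w n \<le> \<eta> * Z w n" using Z_nonneg[of n] by (intro mult_right_mono) auto
    then show ?case using main[OF elim(1)] by linarith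
  qed
qed

text \<open>\<open>M\<close> may depend on \<open>A\<close> but not on \<open>k\<close>, so that
  \<open>l M \<le> 1\<close> for large \<open>k\<close> when \<open>l\<close> is of order
  \<open>1 / sqrt k\<close>.\<close>

definition typical :: bool where
  "typical \<longleftrightarrow> (\<forall>A. \<exists>M\<ge>1. eventually (\<lambda>k.
      tree_gf w (\<lambda>t. if vsum (pen M) t < A * real k then 1 else 0) $ k \<le> 1 / 32 * Z w k) sequentially)"

lemma vsum_mono: "(\<And>d. f d \<le> g d) \<Longrightarrow> vsum f t \<le> vsum g t"
  by (intro sum_mono)

text \<open>For some \<open>M\<close> the second moment truncated at \<open>M\<close> exceeds
  \<open>A P\<close>. The truncated square is bounded, so \<open>large_deviation\<close> for its
  negative shows that its sum over the vertices is rarely below \<open>A k\<close>.\<close>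

lemma typical_infinite_variance:
  assumes a: "a \<ge> 2" "w a > 0" and s: "s > 0" "(\<lambda>k. w k * s ^ k) sums P"
    and max: "\<And>x. x > 0 \<Longrightarrow> summable (\<lambda>k. w k * x ^ k) \<Longrightarrow> (\<Sum>k. w k * x ^ k) / x \<ge> P / s"
    and var: "\<not> summable (\<lambda>k. (real k)\<^sup>2 * (w k * s ^ k))"
  shows typical
  unfolding typical_def
proof (intro allI)
  fix A
  let ?h = "\<lambda>M k. if 2 \<le> k \<and> k \<le> M then (real k - 1)\<^sup>2 else 0"
  have pnn: "w k * s ^ k \<ge> 0" for k using nonneg s by simp
  have "\<exists>M. (\<Sum>k\<le>M. ?h M k * (w k * s ^ k)) > A * P"
  proof (rule ccontr)
    assume "\<not> ?thesis"
    then have le: "(\<Sum>k\<le>M. ?h M k * (w k * s ^ k)) \<le> A * P" for M by (meson not_le)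
    have "summable (\<lambda>k. (real k)\<^sup>2 * (w k * s ^ k))"
    proof (rule summableI_nonneg_bounded)
      fix n
      have "(\<Sum>k<n. (real k)\<^sup>2 * (w k * s ^ k)) \<le> (\<Sum>k\<le>n. (real k)\<^sup>2 * (w k * s ^ k))"
        using pnn by (intro sum_mono2) auto
      also have "\<dots> \<le> (\<Sum>k\<le>n. 4 * (?h n k * (w k * s ^ k)) + w k * s ^ k)"
      proof (intro sum_mono)
        fix k assume k: "k \<in> {..n}"
        have "(real k)\<^sup>2 \<le> 4 * ?h n k + 1"
        proof (cases "2 \<le> k")
          case True
          then have "(real k)\<^sup>2 \<le> (2 * (real k - 1))\<^sup>2" by (intro power_mono) auto
          also have "(2 * (real k - 1))\<^sup>2 = 4 * (real k - 1)\<^sup>2" by (simp only: power_mult_distrib) simp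
          finally show ?thesis using True k by simp
        next
          case False
          then have "k = 0 \<or> k = 1" by auto
          then show ?thesis by auto
        qed
        then show "(real k)\<^sup>2 * (w k * s ^ k) \<le> 4 * (?h n k * (w k * s ^ k)) + w k * s ^ k"
          using mult_right_mono[OF _ pnn[of k]] by (fastforce simp: distrib_right)
      qed
      also have "\<dots> = 4 * (\<Sum>k\<le>n. ?h n k * (w k * s ^ k)) + (\<Sum>k\<le>n. w k * s ^ k)"
        by (simp add: sum.distrib sum_distrib_left)
      also have "\<dots> \<le> 4 * (A * P) + P"
        using le[of n] s pnn sum_le_suminf[of "\<lambda>k. w k * s ^ k" "{..n}"]
        by (intro add_mono mult_left_mono) (auto simp: sums_iff)
      finally show "(\<Sum>k<n. (real k)\<^sup>2 * (w k * s ^ k)) \<le> 4 * (A * P) + P" .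
    qed (use pnn in auto)
    with var show False by simp
  qed
  then obtain M0 where M0: "(\<Sum>k\<le>M0. ?h M0 k * (w k * s ^ k)) > A * P" by blast
  define M where "M = max 1 M0"
  have hM: "?h M k = ?h M0 k" for k by (auto simp: M_def)
  let ?g = "\<lambda>k. - ?h M k"
  have "(\<lambda>k. ?g k * (w k * s ^ k)) sums (\<Sum>k\<le>M0. ?g k * (w k * s ^ k))"
    by (rule sums_finite) (auto simp: M_def)
  then have mean: "(\<Sum>k. ?g k * (w k * s ^ k)) < (- A) * P"
    using M0 by (simp only: sums_iff hM sum_negf mult_minus_left)
  have "\<bar>?g k\<bar> \<le> (real M)\<^sup>2" for k
    by (auto intro!: power_mono)
  from large_deviation[OF a s max this mean, of "1 / 32"]
  have ev: "eventually (\<lambda>n. tree_gf w (\<lambda>t. if vsum ?g t \<ge> - A * real n then 1 else 0) $ n \<le> 1 / 32 * Z w n) sequentially"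
    by simp
  show "\<exists>M\<ge>1. eventually (\<lambda>k.
      tree_gf w (\<lambda>t. if vsum (pen M) t < A * real k then 1 else 0) $ k \<le> 1 / 32 * Z w k) sequentially"
  proof (intro exI[of _ M] conjI)
    show "M \<ge> 1" by (simp add: M_def)
    from ev show "eventually (\<lambda>k.
      tree_gf w (\<lambda>t. if vsum (pen M) t < A * real k then 1 else 0) $ k \<le> 1 / 32 * Z w k) sequentially"
    proof eventually_elim
      case (elim k)
      have "tree_gf w (\<lambda>t. if vsum (pen M) t < A * real k then 1 else 0) $ k
          \<le> tree_gf w (\<lambda>t. if vsum ?g t \<ge> - A * real k then 1 else 0) $ k"
      proof (rule tree_gf_mono)
        fix t
        have "vsum (?h M) t \<le> vsum (pen M) t" by (intro vsum_mono) (auto simp: pen_def)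
        then show "(if vsum (pen M) t < A * real k then 1 else 0) \<le> (if vsum ?g t \<ge> - A * real k then 1 else 0 :: real)"
          by (simp add: sum_negf)
      qed
      with elim show ?case by linarith
    qed
  qed
qed

text \<open>All degrees sum to \<open>k - 1\<close>. If those up to \<open>M\<close> account for
  less than \<open>(1 - \<eta>) k\<close>, the larger ones account for more than
  \<open>\<eta> k - 1\<close>, and \<open>pen M\<close> charges them \<open>M\<close> times their
  value.\<close>

lemma typical_of_small_degrees:
  assumes \<eta>: "\<eta> > 0"
    and ev: "\<And>M. eventually (\<lambda>k. tree_gf w (\<lambda>t.
      if vsum (\<lambda>d. if d \<le> M then real d else 0) t \<ge> (1 - \<eta>) * real k then 1 else 0) $ k \<le> 1 / 32 * Z w k) sequentially"
  shows typical
  unfolding typical_def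
proof (intro allI)
  fix A
  \<comment> \<open>Half of \<open>\<eta> k\<close>, multiplied by \<open>M\<close>, covers
    \<open>A k\<close>; the other half absorbs the \<open>-1\<close> once
    \<open>k \<ge> 2 / \<eta>\<close>.\<close>
  define M where "M = max 1 (nat \<lceil>2 * A / \<eta>\<rceil>)"
  have M: "M \<ge> 1" by (simp add: M_def)
  have "2 * A / \<eta> \<le> real M" unfolding M_def by linarith
  then have MA: "A \<le> real M * \<eta> / 2" using \<eta> by (simp add: field_simps)
  let ?g = "\<lambda>d. if d \<le> M then real d else 0"
  show "\<exists>M\<ge>1. eventually (\<lambda>k.
      tree_gf w (\<lambda>t. if vsum (pen M) t < A * real k then 1 else 0) $ k \<le> 1 / 32 * Z w k) sequentially"
  proof (intro exI[of _ M] conjI M)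
    show "eventually (\<lambda>k.
      tree_gf w (\<lambda>t. if vsum (pen M) t < A * real k then 1 else 0) $ k \<le> 1 / 32 * Z w k) sequentially"
      using ev[of M] eventually_ge_at_top[of "nat \<lceil>2 / \<eta>\<rceil>"]
    proof eventually_elim
      case (elim k)
      have "2 / \<eta> \<le> real k" using elim(2) by linarith
      then have k: "1 \<le> \<eta> * real k / 2" using \<eta> by (simp add: field_simps)
      have "tree_gf w (\<lambda>t. if vsum (pen M) t < A * real k then 1 else 0) $ k
          \<le> tree_gf w (\<lambda>t. if vsum ?g t \<ge> (1 - \<eta>) * real k then 1 else 0) $ k"
      proof (rule tree_gf_mono)
        fix t assume t: "nv t = k"
        have "vsum ?g t \<ge> (1 - \<eta>) * real k" if small: "vsum (pen M) t < A * real k"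
        proof -
          have "real M * vsum (\<lambda>d. real d) t \<le> vsum (\<lambda>d. real M * ?g d + pen M d) t"
            unfolding sum_distrib_left by (intro sum_mono) (auto simp: pen_def)
          also have "\<dots> = real M * vsum ?g t + vsum (pen M) t"
            by (simp add: sum.distrib sum_distrib_left)
          also have "vsum (\<lambda>d. real d) t = real k - 1"
            using vsum_degree_minus_1[of t] t by (simp add: sum_subtractf)
          finally have "real M * (real k - 1) < real M * vsum ?g t + A * real k"
            using small by linarith
          also have "A * real k \<le> real M * \<eta> / 2 * real k" using MA by (intro mult_right_mono) auto
          also have "real M * vsum ?g t + real M * \<eta> / 2 * real k = real M * (vsum ?g t + \<eta> * real k / 2)"
            by (simp add: algebra_simps)
          finally have "real k - 1 < vsum ?g t + \<eta> * real k / 2"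
            using M by simp
          then show ?thesis using k by (simp add: algebra_simps)
        qed
        then show "(if vsum (pen M) t < A * real k then 1 else 0) \<le> (if vsum ?g t \<ge> (1 - \<eta>) * real k then 1 else 0 :: real)"
          by simp
      qed
      with elim show ?case by linarith
    qed
  qed
qed

text \<open>Discarding the degrees above \<open>M\<close> only lowers the mean, so half of the gap
  between the mean and 1 serves as \<open>\<eta>\<close> for all \<open>M\<close> at once.\<close>

lemma typical_subcritical:
  assumes a: "a \<ge> 2" "w a > 0" and s: "s > 0" "(\<lambda>k. w k * s ^ k) sums P"
    and max: "\<And>x. x > 0 \<Longrightarrow> summable (\<lambda>k. w k * x ^ k) \<Longrightarrow> (\<Sum>k. w k * x ^ k) / x \<ge> P / s"
    and mean: "summable (\<lambda>k. real k * (w k * s ^ k))" "(\<Sum>k. real k * (w k * s ^ k)) < P"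
  shows typical
proof -
  define m where "m = (\<Sum>k. real k * (w k * s ^ k))"
  have pnn: "w k * s ^ k \<ge> 0" for k using nonneg s by simp
  have "0 \<le> m" unfolding m_def using pnn by (intro suminf_nonneg mean) auto
  then have P: "P > 0" using mean by (simp add: m_def)
  define \<eta> where "\<eta> = (1 - m / P) / 2"
  have \<eta>: "\<eta> > 0" using mean P by (simp add: \<eta>_def m_def)
  have m_less: "m < (1 - \<eta>) * P"
    using mean P by (simp add: \<eta>_def m_def[symmetric] field_simps)
  show ?thesis
  proof (rule typical_of_small_degrees[OF \<eta>])
    fix M
    let ?g = "\<lambda>d. if d \<le> M then real d else 0"
    have "(\<Sum>k. ?g k * (w k * s ^ k)) \<le> m"
      unfolding m_def using pnn
      by (intro suminf_le mean summable_comparison_test'[OF mean(1), where N = 0]) auto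
    then have 1: "(\<Sum>k. ?g k * (w k * s ^ k)) < (1 - \<eta>) * P" using m_less by linarith
    have "\<bar>?g k\<bar> \<le> real M" for k by auto
    from large_deviation[OF a s max this 1, of "1 / 32"]
    show "eventually (\<lambda>k. tree_gf w (\<lambda>t. if vsum ?g t \<ge> (1 - \<eta>) * real k then 1 else 0) $ k \<le> 1 / 32 * Z w k) sequentially"
      by simp
  qed
qed

lemma typical_zero_radius:
  assumes r0: "\<And>x. x > 0 \<Longrightarrow> \<not> summable (\<lambda>k. w k * x ^ k)"
  shows typical
proof (rule typical_of_small_degrees[of "1 / 2"])
  fix M
  let ?g = "\<lambda>d. if d \<le> M then real d else 0"
  let ?N = "\<lambda>a t. vsum (\<lambda>d. if d = a then 1 else 0) t"
  \<comment> \<open>If every degree from 1 to \<open>M\<close> occurs at most \<open>c k\<close>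
    times, these degrees sum to at most \<open>M^2 c k < k / 2\<close>.\<close>
  define c where "c = 1 / (2 * (real M + 1)\<^sup>2)"
  have c: "c > 0" by (simp add: c_def)
  have "eventually (\<lambda>k. \<forall>a\<in>{1..M}. tree_gf w (\<lambda>t. if ?N a t \<ge> c * real k then 1 else 0) $ k
      \<le> 1 / (32 * (real M + 1)) * Z w k) sequentially"
    by (intro eventually_ball_finite ballI few_vertices_of_degree r0 c) auto
  then show "eventually (\<lambda>k. tree_gf w (\<lambda>t. if vsum ?g t \<ge> (1 - 1 / 2) * real k then 1 else 0) $ k \<le> 1 / 32 * Z w k) sequentially"
    using eventually_gt_at_top[of 0]
  proof eventually_elim
    case (elim k)
    have "tree_gf w (\<lambda>t. if vsum ?g t \<ge> (1 - 1 / 2) * real k then 1 else 0) $ k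
        \<le> tree_gf w (\<lambda>t. \<Sum>a\<in>{1..M}. if ?N a t \<ge> c * real k then 1 else 0) $ k"
    proof (rule tree_gf_mono)
      fix t
      have "\<exists>a\<in>{1..M}. ?N a t \<ge> c * real k" if big: "vsum ?g t \<ge> (1 - 1 / 2) * real k"
      proof (rule ccontr)
        assume "\<not> ?thesis"
        then have less: "\<And>a. a \<in> {1..M} \<Longrightarrow> ?N a t \<le> c * real k" by (meson less_imp_le not_le)
        have "?g d = (\<Sum>a\<in>{1..M}. real a * (if d = a then 1 else 0))" for d
          by (auto simp: if_distrib sum.delta' cong: if_cong)
        then have "vsum ?g t = (\<Sum>a\<in>{1..M}. real a * ?N a t)"
          by (simp only: sum_distrib_left) (rule sum.swap)
        also have "\<dots> \<le> (\<Sum>a\<in>{1..M}. real M * (c * real k))"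
          using less c by (intro sum_mono mult_mono) (auto intro!: sum_nonneg)
        also have "\<dots> = real M * real M * c * real k" by simp
        also have "\<dots> < 1 / 2 * real k"
        proof (intro mult_strict_right_mono)
          have "real M * real M < (real M + 1)\<^sup>2" by (simp add: power2_eq_square algebra_simps)
          then show "real M * real M * c < 1 / 2" by (simp add: c_def divide_simps)
        qed (use elim in auto)
        finally show False using big by simp
      qed
      then show "(if vsum ?g t \<ge> (1 - 1 / 2) * real k then 1 else 0)
          \<le> (\<Sum>a\<in>{1..M}. if ?N a t \<ge> c * real k then 1 else 0 :: real)"
        using member_le_sum[of _ "{1..M}" "\<lambda>a. if ?N a t \<ge> c * real k then 1 else 0 :: real"]
        by (fastforce intro: sum_nonneg)
    qed
    also have "\<dots> = (\<Sum>a\<in>{1..M}. tree_gf w (\<lambda>t. if ?N a t \<ge> c * real k then 1 else 0) $ k)"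
      by (rule tree_gf_sum)
    also have "\<dots> \<le> (\<Sum>a\<in>{1..M}. 1 / (32 * (real M + 1)) * Z w k)"
      using elim by (intro sum_mono) auto
    also have "\<dots> = real M / (real M + 1) * (1 / 32 * Z w k)" by simp
    also have "\<dots> \<le> 1 * (1 / 32 * Z w k)"
      using Z_nonneg by (intro mult_right_mono) auto
    finally show ?case by simp
  qed
qed simp

lemma typical_imp_height_small:
  assumes typical "\<delta> > 0"
  shows "eventually (\<lambda>n. tree_gf w (\<lambda>t. real (height t)) $ n \<le> \<delta> * sqrt (real n) * Z w n) sequentially"
proof (rule height_small[OF uniform_vertex_height_of_typical assms(2)])
  fix A
  show "\<exists>M K. M \<ge> 1 \<and> (\<forall>k\<ge>K.
      tree_gf w (\<lambda>t. if vsum (pen M) t < A * real k then 1 else 0) $ k \<le> 1 / 32 * Z w k)"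
    using assms(1) unfolding typical_def eventually_sequentially by blast
qed

end

section \<open>The parameters of the weight sequence\<close>

text \<open>Stated through \<open>x f'(x)\<close>, which replaces the coefficients
  \<open>c n\<close> by \<open>n * c n\<close>, so that it can be applied to \<open>phi\<close> and
  then to \<open>phi1\<close>.\<close>

lemma power_series_deriv:
  fixes c :: "nat \<Rightarrow> real"
  assumes sm: "\<And>x. 0 \<le> x \<Longrightarrow> x < r \<Longrightarrow> summable (\<lambda>n. c n * x ^ n)" and x: "0 < x" "x < r"
  shows "summable (\<lambda>n. real n * c n * x ^ n)"
    and "((\<lambda>x. \<Sum>n. c n * x ^ n) has_real_derivative (\<Sum>n. real n * c n * x ^ n) / x) (at x)"
proof -
  obtain K where K: "x < K" "K < r" using x dense by blast
  have smK: "summable (\<lambda>n. c n * K ^ n)" using sm[of K] K x by simp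
  have d: "summable (\<lambda>n. diffs c n * x ^ n)"
    by (rule termdiff_converges[of x K]) (use K x powser_insidea[OF smK] in \<open>auto intro: summable_norm_cancel\<close>)
  have shift: "(\<lambda>n. real (Suc n) * c (Suc n) * x ^ Suc n) sums ((\<Sum>n. diffs c n * x ^ n) * x)"
    using sums_mult2[OF summable_sums[OF d], of x] by (simp add: diffs_def mult_ac)
  then have s: "(\<lambda>n. real n * c n * x ^ n) sums ((\<Sum>n. diffs c n * x ^ n) * x)"
    by (subst (asm) sums_Suc_iff) simp
  then show "summable (\<lambda>n. real n * c n * x ^ n)" by (rule sums_summable)
  have "(\<Sum>n. diffs c n * x ^ n) = (\<Sum>n. real n * c n * x ^ n) / x"
    using s x by (simp add: sums_iff)
  moreover have "((\<lambda>x. \<Sum>n. c n * x ^ n) has_real_derivative (\<Sum>n. diffs c n * x ^ n)) (at x)"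
    by (rule termdiffs_strong[OF smK]) (use K x in auto)
  ultimately show "((\<lambda>x. \<Sum>n. c n * x ^ n) has_real_derivative (\<Sum>n. real n * c n * x ^ n) / x) (at x)"
    by simp
qed

lemma power_series_continuous_on:
  fixes c :: "nat \<Rightarrow> real"
  assumes "\<And>n. c n \<ge> 0" "summable (\<lambda>n. c n * r ^ n)"
  shows "continuous_on {0..r} (\<lambda>x. \<Sum>n. c n * x ^ n)"
proof (rule uniform_limit_theorem)
  show "uniform_limit {0..r} (\<lambda>n x. \<Sum>i<n. c i * x ^ i) (\<lambda>x. \<Sum>i. c i * x ^ i) sequentially"
    by (rule Weierstrass_m_test[OF _ assms(2)]) (use assms(1) in \<open>auto simp: abs_mult intro!: mult_left_mono power_mono\<close>)
  show "eventually (\<lambda>n. continuous_on {0..r} (\<lambda>x. \<Sum>i<n. c i * x ^ i)) sequentially"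
    by (intro always_eventually allI continuous_intros)
qed simp

lemma suminf_ennreal_finite_iff:
  assumes "\<And>n. f n \<ge> 0"
  shows "(\<Sum>n. ennreal (f n)) < \<infinity> \<longleftrightarrow> summable f"
  using assms by (auto simp: suminf_ennreal2 intro: summable_suminf_not_top dest: less_imp_neq)

context weights begin

text \<open>\<open>phi1\<close> and \<open>phi2\<close> arise by applying \<open>x d/dx\<close> once
  and twice, so \<open>phi1 / phi\<close> is the function \<open>\<Psi>\<close> inside the disc of
  convergence.\<close>

definition phi :: "real \<Rightarrow> real" where "phi x = (\<Sum>k. w k * x ^ k)"
definition phi1 :: "real \<Rightarrow> real" where "phi1 x = (\<Sum>k. real k * w k * x ^ k)"
definition phi2 :: "real \<Rightarrow> real" where "phi2 x = (\<Sum>k. real k * (real k * w k) * x ^ k)"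

lemma Phi_ennreal: "x \<ge> 0 \<Longrightarrow> Phi w (ennreal x) = (\<Sum>k. ennreal (w k * x ^ k))"
  by (simp add: Phi_def ennreal_mult nonneg ennreal_power)

lemma Psi_num_ennreal:
  "x \<ge> 0 \<Longrightarrow> (\<Sum>k. of_nat k * ennreal (w k) * ennreal x ^ k) = (\<Sum>k. ennreal (real k * w k * x ^ k))"
  by (simp add: ennreal_mult nonneg ennreal_power ennreal_of_nat_eq_real_of_nat)

lemma Phi_finite_iff: "x \<ge> 0 \<Longrightarrow> Phi w (ennreal x) < \<infinity> \<longleftrightarrow> summable (\<lambda>k. w k * x ^ k)"
  unfolding Phi_ennreal by (rule suminf_ennreal_finite_iff) (simp add: nonneg)

lemma summable_imp_le_rho: "x \<ge> 0 \<Longrightarrow> summable (\<lambda>k. w k * x ^ k) \<Longrightarrow> ennreal x \<le> rho w"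
  unfolding rho_def by (rule Sup_upper) (simp add: Phi_finite_iff[unfolded infinity_ennreal_def])

lemma summable_mono:
  assumes "0 \<le> x" "x \<le> y" "\<And>k. c k \<ge> 0" "summable (\<lambda>k. c k * y ^ k)"
  shows "summable (\<lambda>k. c k * x ^ k :: real)"
  by (rule summable_comparison_test'[OF assms(4), where N = 0])
     (use assms in \<open>auto simp: abs_mult intro!: mult_left_mono power_mono\<close>)

lemma less_rho_imp_summable:
  assumes "x \<ge> 0" "ennreal x < rho w"
  shows "summable (\<lambda>k. w k * x ^ k)"
proof -
  obtain s where s: "s < \<infinity>" "Phi w s < \<infinity>" "ennreal x < s"
    using assms(2) unfolding rho_def less_Sup_iff by auto
  obtain y where y: "s = ennreal y" "y \<ge> 0" using s(1) by (cases s) auto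
  have "x \<le> y" using s(3) y assms(1) by (simp add: ennreal_less_iff)
  then show ?thesis
    using summable_mono[of x y w] assms(1) nonneg s(2) y Phi_finite_iff by simp
qed

lemma summable_k:
  assumes "x \<ge> 0" "ennreal x < rho w"
  shows "summable (\<lambda>k. real k * w k * x ^ k)"
proof -
  obtain t where t: "ennreal x < t" "t < rho w" using assms(2) dense by blast
  obtain r where r: "t = ennreal r" "r \<ge> 0" using t(2) by (cases t) auto
  have xr: "x < r" using t r assms by (simp add: ennreal_less_iff)
  obtain z where z: "x < z" "z < r" using xr dense by blast
  have "summable (\<lambda>k. real k * w k * z ^ k)"
  proof (rule power_series_deriv(1))
    fix y assume "0 \<le> y" "y < r"
    then have "ennreal y < rho w" using t(2) r by (metis ennreal_less_iff order.strict_trans)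
    then show "summable (\<lambda>k. w k * y ^ k)" using \<open>0 \<le> y\<close> by (rule less_rho_imp_summable[rotated])
  qed (use z assms in auto)
  then show ?thesis by (rule summable_mono[rotated 3]) (use z assms nonneg in auto)
qed

lemma phi_pos:
  assumes "x \<ge> 0" "summable (\<lambda>k. w k * x ^ k)"
  shows "phi x > 0"
  unfolding phi_def by (rule suminf_pos2[OF assms(2), of 0]) (use assms nonneg pos0 in auto)

lemma Psi_quot_eq:
  assumes "x \<ge> 0" "summable (\<lambda>k. w k * x ^ k)" "summable (\<lambda>k. real k * w k * x ^ k)"
  shows "Psi_quot w (ennreal x) = ennreal (phi1 x / phi x)"
proof -
  have "(\<Sum>k. ennreal (real k * w k * x ^ k)) = ennreal (phi1 x)"
    unfolding phi1_def using assms nonneg by (intro suminf_ennreal2) auto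
  moreover have "(\<Sum>k. ennreal (w k * x ^ k)) = ennreal (phi x)"
    unfolding phi_def using assms nonneg by (intro suminf_ennreal2) auto
  moreover have "phi1 x \<ge> 0" unfolding phi1_def using assms nonneg by (intro suminf_nonneg) auto
  ultimately show ?thesis
    unfolding Psi_quot_def Phi_ennreal[OF assms(1)] Psi_num_ennreal[OF assms(1)]
    using phi_pos[OF assms(1,2)] by (simp add: divide_ennreal)
qed

lemma Psi_quot_less_rho:
  "x \<ge> 0 \<Longrightarrow> ennreal x < rho w \<Longrightarrow> Psi_quot w (ennreal x) = ennreal (phi1 x / phi x)"
  by (intro Psi_quot_eq less_rho_imp_summable summable_k)

text \<open>A form of Chebyshev's sum inequality: with \<open>q = x / y < 1\<close> and
  \<open>m\<close> the mean at \<open>y\<close>, \<open>(k - m) (q^k - q^m) \<le> 0\<close> for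
  every \<open>k\<close>. Averaging with the weights at \<open>y\<close> bounds the mean at
  \<open>x\<close> by \<open>m\<close>.\<close>

lemma mean_mono:
  assumes x: "0 \<le> x" "x < y" and y: "ennreal y < rho w"
  shows "phi1 x / phi x \<le> phi1 y / phi y"
proof -
  have y0: "y > 0" using x by simp
  have xr: "ennreal x < rho w" using x y by (metis ennreal_less_iff order.strict_trans)
  have smx: "summable (\<lambda>k. w k * x ^ k)" "summable (\<lambda>k. real k * w k * x ^ k)"
    using less_rho_imp_summable summable_k x xr by auto
  have smy: "summable (\<lambda>k. w k * y ^ k)" "summable (\<lambda>k. real k * w k * y ^ k)"
    using less_rho_imp_summable[of y] summable_k[of y] y0 y by auto
  have fx: "phi x > 0" and fy: "phi y > 0" using phi_pos smx smy x y0 by auto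
  define m where "m = phi1 y / phi y"
  have "phi1 y \<ge> 0" unfolding phi1_def using smy nonneg y0 by (intro suminf_nonneg) auto
  then have m0: "m \<ge> 0" using fy by (simp add: m_def)
  show ?thesis
  proof (cases "x = 0")
    case True
    then have "phi1 x = 0" unfolding phi1_def by (simp add: power_0_left if_distrib cong: if_cong)
    then show ?thesis using m0 by (simp add: m_def)
  next
    case False
    define q where "q = x / y"
    have q: "0 < q" "q < 1" using x y0 False by (auto simp: q_def)
    have xq: "x ^ k = q ^ k * y ^ k" for k using y0 by (simp add: q_def power_divide)
    have "(real k - m) * q ^ k \<le> (real k - m) * q powr m" for k
    proof (cases "real k \<ge> m")
      case True
      then have "q ^ k \<le> q powr m" using q powr_mono'[of m "real k" q] by (simp add: powr_realpow)
      then show ?thesis using True by (intro mult_left_mono) auto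
    next
      case False
      then have "q powr m \<le> q ^ k" using q powr_mono'[of "real k" m q] by (simp add: powr_realpow)
      then show ?thesis using False by (intro mult_left_mono_neg) auto
    qed
    then have "(real k - m) * q ^ k * (w k * y ^ k) \<le> (real k - m) * q powr m * (w k * y ^ k)" for k
      using nonneg y0 by (intro mult_right_mono) auto
    then have term_le: "real k * w k * x ^ k - m * (w k * x ^ k)
        \<le> q powr m * (real k * w k * y ^ k - m * (w k * y ^ k))" for k
      by (simp add: xq algebra_simps)
    have "phi1 x - m * phi x \<le> q powr m * (phi1 y - m * phi y)"
    proof (rule sums_le)
      show "(\<lambda>k. real k * w k * x ^ k - m * (w k * x ^ k)) sums (phi1 x - m * phi x)"
        unfolding phi1_def phi_def by (intro sums_diff sums_mult summable_sums smx)
      show "(\<lambda>k. q powr m * (real k * w k * y ^ k - m * (w k * y ^ k))) sums (q powr m * (phi1 y - m * phi y))"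
        unfolding phi1_def phi_def by (intro sums_diff sums_mult summable_sums smy)
    qed (rule term_le)
    also have "phi1 y - m * phi y = 0" using fy by (simp add: m_def)
    finally have "phi1 x \<le> m * phi x" by simp
    then show ?thesis using fx by (simp add: m_def[symmetric] pos_divide_le_eq)
  qed
qed

text \<open>With \<open>q = x / y\<close>, Bernoulli's inequality
  \<open>q^k \<ge> 1 + k (q - 1)\<close> summed over \<open>k\<close> gives
  \<open>phi x \<ge> phi y + (q - 1) phi1 y \<ge> q phi y\<close>. Only the moments at
  \<open>y\<close> itself enter, so \<open>y\<close> may be the radius of convergence.\<close>

lemma phi_ratio:
  assumes x: "0 < x" "x \<le> y" and smy: "summable (\<lambda>k. w k * y ^ k)" "summable (\<lambda>k. real k * w k * y ^ k)"
    and mean: "phi1 y \<le> phi y"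
  shows "phi y / y \<le> phi x / x"
proof -
  define q where "q = x / y"
  have q: "0 < q" "q \<le> 1" using x by (auto simp: q_def)
  have smx: "summable (\<lambda>k. w k * x ^ k)" using x nonneg smy by (intro summable_mono[of x y]) auto
  have term_le: "w k * y ^ k + (q - 1) * (real k * w k * y ^ k) \<le> w k * x ^ k" for k
  proof -
    have "1 + real k * (q - 1) \<le> (1 + (q - 1)) ^ k" using q by (intro Bernoulli_inequality) auto
    then have "(1 + real k * (q - 1)) * (w k * y ^ k) \<le> q ^ k * (w k * y ^ k)"
      using nonneg x by (intro mult_right_mono) auto
    then show ?thesis using x by (simp add: q_def power_divide algebra_simps)
  qed
  have "phi y + (q - 1) * phi1 y \<le> phi x"
  proof (rule sums_le)
    show "(\<lambda>k. w k * y ^ k + (q - 1) * (real k * w k * y ^ k)) sums (phi y + (q - 1) * phi1 y)"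
      unfolding phi1_def phi_def by (intro sums_add sums_mult summable_sums smy)
    show "(\<lambda>k. w k * x ^ k) sums phi x" unfolding phi_def by (intro summable_sums smx)
  qed (rule term_le)
  moreover have "(q - 1) * phi y \<le> (q - 1) * phi1 y" using mean q by (intro mult_left_mono_neg) auto
  ultimately have "q * phi y \<le> phi x" by (simp add: algebra_simps)
  then show ?thesis using x by (simp add: q_def field_simps)
qed

lemma Lim_Psi_quot:
  assumes "rho w > 0"
  shows "Lim (at_left (rho w)) (Psi_quot w) = (SUP s\<in>{..<rho w}. Psi_quot w s)" (is "_ = ?L")
proof (rule tendsto_Lim)
  show "\<not> trivial_limit (at_left (rho w))"
    unfolding trivial_limit_def eventually_at_left[OF assms] using dense by blast
  have mono: "Psi_quot w s \<le> Psi_quot w t" if st: "s < t" "t < rho w" for s t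
  proof -
    have "t < \<infinity>" "s < \<infinity>" using st by (auto intro: less_le_trans)
    then obtain x y where xy: "s = ennreal x" "x \<ge> 0" "t = ennreal y" "y \<ge> 0" by (cases s; cases t) auto
    then have "x < y" using st by (simp add: ennreal_less_iff)
    then show ?thesis using st xy mean_mono[of x y] Psi_quot_less_rho[of x] Psi_quot_less_rho[of y]
      by (auto intro!: ennreal_leI)
  qed
  show "(Psi_quot w \<longlongrightarrow> ?L) (at_left (rho w))"
  proof (rule order_tendstoI)
    fix a assume "a < ?L"
    then obtain s where s: "s < rho w" "a < Psi_quot w s" unfolding less_SUP_iff by auto
    then show "eventually (\<lambda>t. a < Psi_quot w t) (at_left (rho w))"
      unfolding eventually_at_left[OF assms] using mono by (intro exI[of _ s]) (auto intro: less_le_trans)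
  next
    fix a assume "?L < a"
    then show "eventually (\<lambda>t. Psi_quot w t < a) (at_left (rho w))"
      unfolding eventually_at_left[OF assms] using assms
      by (intro exI[of _ 0]) (auto intro: le_less_trans[OF SUP_upper])
  qed
qed

text \<open>A mean of at most 1 below \<open>rho w\<close> forces \<open>phi y \<le> C y\<close> by
  \<open>phi_ratio\<close>. The term \<open>w a y^a\<close> with \<open>a \<ge> 2\<close> then
  excludes an infinite radius, and the bounds on partial sums pass to the endpoint.\<close>

lemma rho_real:
  assumes a: "a \<ge> 2" "w a > 0" and "rho w \<noteq> 0"
    and le1: "\<And>x. x > 0 \<Longrightarrow> ennreal x < rho w \<Longrightarrow> phi1 x \<le> phi x"
  shows "\<exists>r>0. rho w = ennreal r \<and> summable (\<lambda>k. w k * r ^ k) \<and> summable (\<lambda>k. real k * w k * r ^ k) \<and> phi1 r \<le> phi r"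
proof -
  have "0 < rho w" using assms(3) by (simp add: zero_less_iff_neq_zero)
  then obtain t where t: "0 < t" "t < rho w" using dense by blast
  then obtain x0 where x0: "t = ennreal x0" "x0 > 0" by (cases t) (auto simp: ennreal_less_zero_iff)
  define C where "C = phi x0 / x0"
  have bound: "phi y \<le> C * y" if y: "x0 \<le> y" "ennreal y < rho w" for y
    using phi_ratio[of x0 y] x0 y le1[of y] less_rho_imp_summable[of y] summable_k[of y]
    by (simp add: C_def field_simps)
  have partial: "(\<Sum>k\<in>A. w k * y ^ k) \<le> phi y" if "finite A" "0 < y" "ennreal y < rho w" for A y
    unfolding phi_def using that nonneg by (intro sum_le_suminf less_rho_imp_summable) auto
  have "rho w \<noteq> \<infinity>"
  proof
    assume inf: "rho w = \<infinity>"
    define y where "y = max x0 (max 1 (C / w a + 1))"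
    have y: "y \<ge> x0" "y \<ge> 1" "y > C / w a" "y > 0" using x0 by (auto simp: y_def)
    have "w a * y ^ a \<le> C * y" using partial[of "{a}" y] bound[of y] y inf by simp
    moreover have "y * y \<le> y ^ a"
      using a y power_increasing[of 2 a y] by (simp add: power2_eq_square)
    then have "w a * (y * y) \<le> w a * y ^ a" using a by (intro mult_left_mono) auto
    ultimately have "w a * y * y \<le> C * y" by (simp add: mult.assoc)
    then have "w a * y \<le> C" using y by simp
    then show False using y a by (simp add: field_simps)
  qed
  then obtain r where r: "rho w = ennreal r" "r > 0"
    using \<open>0 < rho w\<close> by (cases "rho w") (auto simp: ennreal_less_zero_iff)
  have x0r: "x0 < r" using t x0 r by (simp add: ennreal_less_iff)
  have lim: "(\<Sum>k<n. c k * r ^ k) \<le> B"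
    if "\<And>y. x0 \<le> y \<Longrightarrow> y < r \<Longrightarrow> (\<Sum>k<n. c k * y ^ k) \<le> B" for c :: "nat \<Rightarrow> real" and n B
  proof (rule tendsto_upperbound)
    show "((\<lambda>y. \<Sum>k<n. c k * y ^ k) \<longlongrightarrow> (\<Sum>k<n. c k * r ^ k)) (at_left r)"
      by (intro tendsto_intros)
    show "eventually (\<lambda>y. (\<Sum>k<n. c k * y ^ k) \<le> B) (at_left r)"
      unfolding eventually_at_left[OF x0r] using that x0r by (intro exI[of _ x0]) auto
  qed simp
  have C0: "C > 0" using phi_pos[of x0] x0 t less_rho_imp_summable[of x0] by (simp add: C_def)
  have sm: "summable (\<lambda>k. w k * r ^ k)"
  proof (rule summableI_nonneg_bounded)
    fix n
    show "(\<Sum>k<n. w k * r ^ k) \<le> C * r"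
    proof (rule lim)
      fix y assume y: "x0 \<le> y" "y < r"
      then have "(\<Sum>k<n. w k * y ^ k) \<le> C * y"
        using partial[of "{..<n}" y] bound[of y] x0 r by (auto simp: ennreal_less_iff)
      also have "\<dots> \<le> C * r" using y C0 by simp
      finally show "(\<Sum>k<n. w k * y ^ k) \<le> C * r" .
    qed
  qed (use nonneg r in auto)
  have part1: "(\<Sum>k<n. real k * w k * r ^ k) \<le> phi r" for n
  proof (rule lim)
    fix y assume y: "x0 \<le> y" "y < r"
    then have yr: "ennreal y < rho w" using r x0 by (simp add: ennreal_less_iff)
    have "(\<Sum>k<n. real k * w k * y ^ k) \<le> phi1 y"
      unfolding phi1_def using y x0 nonneg yr by (intro sum_le_suminf summable_k) auto
    also have "\<dots> \<le> phi y" using le1 y yr x0 by simp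
    also have "\<dots> \<le> phi r"
      unfolding phi_def using y x0 r nonneg yr
      by (intro suminf_le mult_left_mono power_mono sm less_rho_imp_summable) auto
    finally show "(\<Sum>k<n. real k * w k * y ^ k) \<le> phi r" .
  qed
  have sm1: "summable (\<lambda>k. real k * w k * r ^ k)"
    by (rule summableI_nonneg_bounded[OF _ part1]) (use nonneg r in auto)
  have "phi1 r \<le> phi r" unfolding phi1_def by (rule suminf_le_const[OF sm1 part1])
  then show ?thesis using r sm sm1 by blast
qed

lemma Psi_less_rho: "s < rho w \<Longrightarrow> Psi w s = Psi_quot w s"
  by (auto simp: Psi_def)

lemma phi1_le_phi_if_Psi_quot_le_1:
  assumes "x \<ge> 0" "ennreal x < rho w" "Psi_quot w (ennreal x) \<le> 1"
  shows "phi1 x \<le> phi x"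
proof -
  have "phi x > 0" using assms by (intro phi_pos less_rho_imp_summable)
  moreover have "ennreal (phi1 x / phi x) \<le> ennreal 1" using assms by (simp add: Psi_quot_less_rho)
  ultimately show ?thesis by (simp add: ennreal_le_iff)
qed

text \<open>For \<open>rho_real\<close> the mean must be at most 1 below \<open>rho w\<close>. If
  \<open>\<Phi>\<close> is infinite at \<open>rho w\<close>, then \<open>nu w\<close> is the
  supremum of the means. Otherwise the mean at \<open>rho w\<close> itself is at most 1, and
  \<open>(phi1 x - phi x) / x\<close> is increasing.\<close>

lemma nu_le_1_cases:
  assumes a: "a \<ge> 2" "w a > 0" and nu: "nu w \<le> 1" and rho: "rho w \<noteq> 0"
  shows "\<exists>r>0. rho w = ennreal r \<and> summable (\<lambda>k. w k * r ^ k) \<and> summable (\<lambda>k. real k * w k * r ^ k)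
    \<and> phi1 r \<le> phi r \<and> nu w = ennreal (phi1 r / phi r)"
proof -
  have le1: "phi1 x \<le> phi x" if x: "x > 0" "ennreal x < rho w" for x
  proof (cases "Phi w (rho w) = \<infinity>")
    case True
    then have "nu w = (SUP s\<in>{..<rho w}. Psi_quot w s)"
      using Lim_Psi_quot rho by (simp add: nu_def Psi_def zero_less_iff_neq_zero)
    then have "Psi_quot w (ennreal x) \<le> nu w" using x(2) by (simp add: SUP_upper)
    then show ?thesis using nu x by (intro phi1_le_phi_if_Psi_quot_le_1) auto
  next
    case False
    have "rho w \<noteq> \<infinity>"
    proof
      assume inf: "rho w = \<infinity>"
      have "(\<Sum>k\<in>{a}. ennreal (w k) * \<infinity> ^ k) \<le> Phi w \<infinity>"
        unfolding Phi_def by (intro sum_le_suminf) auto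
      moreover have "ennreal (w a) * \<infinity> ^ a = \<infinity>"
        using a by (simp add: ennreal_mult_eq_top_iff ennreal_top_eq_mult_iff)
      ultimately have "\<infinity> \<le> Phi w \<infinity>" by simp
      then show False using False inf top.extremum_unique[of "Phi w \<infinity>"] by simp
    qed
    then obtain r where r: "rho w = ennreal r" "r \<ge> 0" by (cases "rho w") auto
    have sm: "summable (\<lambda>k. w k * r ^ k)" using False r Phi_finite_iff[of r] by (simp add: less_top)
    have nu_eq: "nu w = Psi_quot w (ennreal r)" using False r by (simp add: nu_def Psi_def)
    have phir: "Phi w (ennreal r) = ennreal (phi r)"
      unfolding Phi_ennreal[OF r(2)] phi_def using sm nonneg r by (intro suminf_ennreal2) auto
    have sm1: "summable (\<lambda>k. real k * w k * r ^ k)"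
    proof (rule ccontr)
      assume n: "\<not> ?thesis"
      have "\<not> (\<Sum>k. ennreal (real k * w k * r ^ k)) < \<infinity>"
        by (subst suminf_ennreal_finite_iff) (use n nonneg r(2) in auto)
      then have "(\<Sum>k. ennreal (real k * w k * r ^ k)) = \<infinity>"
        by (metis infinity_ennreal_def top.not_eq_extremum)
      then have "Psi_quot w (ennreal r) = \<infinity> / ennreal (phi r)"
        unfolding Psi_quot_def Psi_num_ennreal[OF r(2)] phir by simp
      then have "nu w = \<infinity>" using nu_eq by (simp add: ennreal_top_divide)
      then show False using le_less_trans[OF nu ennreal_one_less_top] by simp
    qed
    have "phi1 r \<le> phi r"
      using nu nu_eq Psi_quot_eq[OF r(2) sm sm1] phi_pos[OF r(2) sm] by (simp add: ennreal_le_1)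
    have xr: "x < r" using x r by (simp add: ennreal_less_iff)
    \<comment> \<open>Every term \<open>(k - 1) w k x^(k-1)\<close> is nondecreasing in
      \<open>x\<close>; for \<open>k = 0\<close> it is \<open>- w 0 / x\<close>.\<close>
    have bnd: "real k * w k * x ^ k - w k * x ^ k \<le> x / r * (real k * w k * r ^ k - w k * r ^ k)" for k
    proof (cases k)
      case 0
      have "x / r * w 0 \<le> 1 * w 0" using xr x pos0 by (intro mult_right_mono) auto
      then show ?thesis using 0 by simp
    next
      case (Suc j)
      have "x ^ j \<le> r ^ j" using xr x by (intro power_mono) auto
      then have "x ^ k \<le> x / r * r ^ k" using Suc xr x by (simp add: mult_left_mono)
      then have "(real k - 1) * w k * x ^ k \<le> (real k - 1) * w k * (x / r * r ^ k)"
        using Suc nonneg by (intro mult_left_mono) auto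
      then show ?thesis by (simp add: algebra_simps)
    qed
    have "phi1 x - phi x \<le> x / r * (phi1 r - phi r)"
    proof (rule sums_le)
      show "(\<lambda>k. real k * w k * x ^ k - w k * x ^ k) sums (phi1 x - phi x)"
        unfolding phi1_def phi_def
        by (intro sums_diff summable_sums summable_k less_rho_imp_summable less_imp_le x)
      show "(\<lambda>k. x / r * (real k * w k * r ^ k - w k * r ^ k)) sums (x / r * (phi1 r - phi r))"
        unfolding phi1_def phi_def by (intro sums_diff sums_mult summable_sums sm sm1)
    qed (rule bnd)
    also have "\<dots> \<le> 0" using \<open>phi1 r \<le> phi r\<close> xr x by (intro mult_nonneg_nonpos) auto
    finally show ?thesis by simp
  qed
  obtain r where r: "r > 0" "rho w = ennreal r" "summable (\<lambda>k. w k * r ^ k)"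
    "summable (\<lambda>k. real k * w k * r ^ k)" "phi1 r \<le> phi r"
    using rho_real[OF a rho le1] by blast
  have "Phi w (rho w) < \<infinity>" using r Phi_finite_iff[of r] by simp
  then have "nu w = Psi_quot w (ennreal r)" using r by (auto simp: nu_def Psi_def)
  also have "\<dots> = ennreal (phi1 r / phi r)" using r by (intro Psi_quot_eq) auto
  finally show ?thesis using r by blast
qed

text \<open>This supplies the hypothesis \<open>max\<close> of \<open>large_deviation\<close> at
  \<open>s = r\<close>; beyond \<open>r\<close> the series diverges.\<close>

lemma minimizer:
  assumes r: "r > 0" "rho w = ennreal r" "summable (\<lambda>k. w k * r ^ k)"
    "summable (\<lambda>k. real k * w k * r ^ k)" "phi1 r \<le> phi r"
    and x: "x > 0" "summable (\<lambda>k. w k * x ^ k)"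
  shows "(\<Sum>k. w k * x ^ k) / x \<ge> phi r / r"
proof -
  have "x \<le> r" using summable_imp_le_rho[of x] x r by simp
  then show ?thesis using phi_ratio[of x r] r x by (simp add: phi_def)
qed

text \<open>Since \<open>Psi_deriv\<close> is real-valued, it suffices that \<open>tau w\<close>
  lies strictly below \<open>rho w\<close>. As \<open>tau w\<close> is a definite description, this
  requires existence and uniqueness of the solution of \<open>\<Psi> = 1\<close>.\<close>

lemma sigma_finite_nu_gt_1:
  assumes a: "a \<ge> 2" "w a > 0" and nu: "nu w > 1"
  shows "sigma_sq w \<noteq> \<infinity>"
proof -
  have uniq: "s = t" if "s < rho w" "Psi w s = 1" "t < rho w" "Psi w t = 1" for s t
  proof -
    have less: "\<not> s < t" if st: "s < t" "t < rho w" "Psi w s = 1" "Psi w t = 1" for s t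
    proof
      assume "s < t"
      have "s < rho w" using st by simp
      have "t < \<infinity>" "s < \<infinity>" using st by (auto intro: less_le_trans)
      then obtain x y where xy: "s = ennreal x" "x \<ge> 0" "t = ennreal y" "y \<ge> 0" by (cases s; cases t) auto
      then have x_y: "x < y" using st by (simp add: ennreal_less_iff)
      have eq: "phi1 z = phi z" if z: "z \<ge> 0" "ennreal z < rho w" "Psi w (ennreal z) = 1" for z
      proof -
        have "phi z > 0" using z by (intro phi_pos less_rho_imp_summable)
        have "ennreal (phi1 z / phi z) = ennreal 1" using z Psi_less_rho Psi_quot_less_rho by simp
        moreover have "phi1 z \<ge> 0" unfolding phi1_def using z nonneg by (intro suminf_nonneg summable_k) auto
        ultimately have "phi1 z / phi z = 1" using \<open>phi z > 0\<close> by (subst (asm) ennreal_inj) auto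
        then show ?thesis using \<open>phi z > 0\<close> by simp
      qed
      define q where "q = x / y"
      have q: "0 \<le> q" "q < 1" using x_y xy by (auto simp: q_def)
      \<comment> \<open>Again \<open>(phi1 x - phi x) / x\<close> is increasing; the term for
        \<open>k = 0\<close> makes this strict because \<open>w 0 > 0\<close>.\<close>
      have bnd: "real k * w k * x ^ k - w k * x ^ k \<le> q * (real k * w k * y ^ k - w k * y ^ k) - (if k = 0 then w 0 * (1 - q) else 0)" for k
      proof (cases k)
        case 0
        then show ?thesis by (simp add: algebra_simps)
      next
        case (Suc j)
        have "x ^ j \<le> y ^ j" using x_y xy by (intro power_mono) auto
        then have "x ^ k \<le> q * y ^ k" using Suc x_y xy by (simp add: q_def mult_left_mono)
        then have "(real k - 1) * w k * x ^ k \<le> (real k - 1) * w k * (q * y ^ k)"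
          using Suc nonneg by (intro mult_left_mono) auto
        then show ?thesis using Suc by (simp add: algebra_simps)
      qed
      have s0: "(\<lambda>k. if k = 0 then w 0 * (1 - q) else 0) sums (w 0 * (1 - q))"
        using sums_single[of 0 "\<lambda>_. w 0 * (1 - q)"] by (simp cong: if_cong)
      have "phi1 x - phi x \<le> q * (phi1 y - phi y) - w 0 * (1 - q)"
      proof (rule sums_le)
        show "(\<lambda>k. real k * w k * x ^ k - w k * x ^ k) sums (phi1 x - phi x)"
          unfolding phi1_def phi_def using \<open>s < rho w\<close> xy
          by (intro sums_diff summable_sums summable_k less_rho_imp_summable) auto
        show "(\<lambda>k. q * (real k * w k * y ^ k - w k * y ^ k) - (if k = 0 then w 0 * (1 - q) else 0))
            sums (q * (phi1 y - phi y) - w 0 * (1 - q))"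
          unfolding phi1_def phi_def using st xy
          by (intro sums_diff sums_mult summable_sums summable_k less_rho_imp_summable s0) auto
      qed (rule bnd)
      moreover have "w 0 * (1 - q) > 0" using q pos0 by simp
      ultimately show False using eq[of x] eq[of y] xy st \<open>s < rho w\<close> by simp
    qed
    show ?thesis using less[of s t] less[of t s] that by (metis linorder_cases)
  qed
  have rho0: "rho w \<noteq> 0"
  proof
    assume 0: "rho w = 0"
    have sm: "summable (\<lambda>k. w k * 0 ^ k)" by (rule summable_comparison_test'[where N = 1 and g = "\<lambda>_. 0"]) auto
    have sm1: "summable (\<lambda>k. real k * w k * 0 ^ k)" by (rule summable_comparison_test'[where N = 1 and g = "\<lambda>_. 0"]) auto
    have "Phi w (ennreal 0) < \<infinity>" using sm by (subst Phi_finite_iff) auto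
    then have "nu w = Psi_quot w (ennreal 0)" using 0 by (auto simp: nu_def Psi_def)
    also have "\<dots> = ennreal (phi1 0 / phi 0)" by (intro Psi_quot_eq sm sm1) simp
    also have "phi1 0 = 0" unfolding phi1_def by (simp add: power_0_left if_distrib cong: if_cong)
    finally show False using nu by simp
  qed
  \<comment> \<open>If no mean below \<open>rho w\<close> exceeded 1, \<open>rho_real\<close> would
    bound the mean at \<open>rho w\<close> by 1, contrary to \<open>nu w > 1\<close>. The
    intermediate value theorem then yields a mean equal to 1.\<close>
  have "\<exists>x>0. ennreal x < rho w \<and> phi1 x > phi x"
  proof (rule ccontr)
    assume "\<not> ?thesis"
    then have le1: "\<And>x. x > 0 \<Longrightarrow> ennreal x < rho w \<Longrightarrow> phi1 x \<le> phi x" by (meson not_le)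
    obtain r where r: "r > 0" "rho w = ennreal r" "summable (\<lambda>k. w k * r ^ k)"
      "summable (\<lambda>k. real k * w k * r ^ k)" "phi1 r \<le> phi r"
      using rho_real[OF a rho0 le1] by blast
    have "Phi w (rho w) < \<infinity>" using r Phi_finite_iff[of r] by simp
    then have "nu w = Psi_quot w (ennreal r)" using r by (auto simp: nu_def Psi_def)
    also have "\<dots> = ennreal (phi1 r / phi r)" using r by (intro Psi_quot_eq) auto
    also have "\<dots> \<le> 1" using r phi_pos[of r] by (simp add: ennreal_le_1)
    finally show False using nu by simp
  qed
  then obtain b where b: "b > 0" "ennreal b < rho w" "phi1 b > phi b" by blast
  have "continuous_on {0..b} (\<lambda>x. phi1 x - phi x)"
    unfolding phi1_def phi_def using nonneg b
    by (intro continuous_intros power_series_continuous_on summable_k less_rho_imp_summable) auto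
  moreover have "phi1 0 - phi 0 \<le> 0"
  proof -
    have "phi1 0 = 0" unfolding phi1_def by (simp add: power_0_left if_distrib cong: if_cong)
    moreover have "phi 0 \<ge> 0" unfolding phi_def using b nonneg
      by (intro suminf_nonneg less_rho_imp_summable) (auto intro: le_less_trans)
    ultimately show ?thesis by simp
  qed
  ultimately obtain x where x: "0 \<le> x" "x \<le> b" "phi1 x - phi x = 0"
    using IVT'[of "\<lambda>x. phi1 x - phi x" 0 0 b] b by auto
  have xr: "ennreal x < rho w" using x b by (meson ennreal_leI le_less_trans)
  have "phi x > 0" using x xr by (intro phi_pos less_rho_imp_summable)
  then have "Psi w (ennreal x) = 1" using x xr by (simp add: Psi_less_rho Psi_quot_less_rho)
  then have "(THE s. s < rho w \<and> Psi w s = 1) = ennreal x"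
    using xr uniq by (intro the_equality) auto
  then have "tau w = ennreal x" using nu by (auto simp: tau_def)
  then have "sigma_sq w < \<infinity>" using xr by (auto simp: sigma_sq_def ennreal_mult_less_top)
  then show ?thesis by simp
qed

text \<open>If the second moment at \<open>r\<close> were finite, \<open>phi\<close>,
  \<open>phi1\<close> and \<open>phi2\<close> would be continuous up to \<open>r\<close>, and
  \<open>\<Psi>'\<close> would have a finite left limit there.\<close>

lemma sigma_infinite:
  assumes a: "a \<ge> 2" "w a > 0" and sigma: "sigma_sq w = \<infinity>"
    and r: "r > 0" "rho w = ennreal r" "summable (\<lambda>k. w k * r ^ k)"
      "summable (\<lambda>k. real k * w k * r ^ k)" and nu: "nu w \<le> 1"
  shows "\<not> summable (\<lambda>k. (real k)\<^sup>2 * (w k * r ^ k))"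
proof
  assume "summable (\<lambda>k. (real k)\<^sup>2 * (w k * r ^ k))"
  then have sm2: "summable (\<lambda>k. real k * (real k * w k) * r ^ k)" by (simp add: power2_eq_square mult_ac)
  have tau: "tau w = ennreal r" using nu r by (simp add: tau_def)
  have fr: "phi r > 0" using r by (intro phi_pos) auto
  \<comment> \<open>The quotient rule for \<open>phi1 / phi\<close>, where the derivatives of
    \<open>phi\<close> and \<open>phi1\<close> are \<open>phi1 x / x\<close> and
    \<open>phi2 x / x\<close>.\<close>
  let ?F = "\<lambda>x. (phi2 x / x * phi x - phi1 x * (phi1 x / x)) / (phi x * phi x)"
  have cont: "(phi \<longlongrightarrow> phi r) (at_left r)" "(phi1 \<longlongrightarrow> phi1 r) (at_left r)" "(phi2 \<longlongrightarrow> phi2 r) (at_left r)"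
    using power_series_continuous_on[of w r] power_series_continuous_on[of "\<lambda>k. real k * w k" r]
      power_series_continuous_on[of "\<lambda>k. real k * (real k * w k)" r] nonneg r sm2
    unfolding phi_def[abs_def] phi1_def[abs_def] phi2_def[abs_def] continuous_on_def
    by (auto simp: at_within_Icc_at_left[OF r(1), symmetric])
  have lim: "(?F \<longlongrightarrow> ?F r) (at_left r)"
    using fr r by (intro tendsto_intros cont) auto
  have ev: "eventually (\<lambda>x. Psi_deriv w x = ?F x) (at_left r)"
    unfolding eventually_at_left[OF r(1)]
  proof (intro exI[of _ 0] conjI allI impI)
    fix x assume x: "0 < x" "x < r"
    have smw: "summable (\<lambda>k. w k * y ^ k)" "summable (\<lambda>k. real k * w k * y ^ k)" if "0 \<le> y" "y < r" for y
      using that summable_mono[of y r w] summable_mono[of y r "\<lambda>k. real k * w k"] r nonneg by auto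
    have df: "(phi has_real_derivative phi1 x / x) (at x)"
      unfolding phi_def[abs_def] phi1_def[abs_def] using x by (intro power_series_deriv(2)[of r] smw) auto
    have df1: "(phi1 has_real_derivative phi2 x / x) (at x)"
      unfolding phi1_def[abs_def] phi2_def[abs_def] using x by (intro power_series_deriv(2)[of r] smw) auto
    have fx: "phi x > 0" using x smw by (intro phi_pos) auto
    have d: "((\<lambda>y. phi1 y / phi y) has_real_derivative ?F x) (at x)"
      using fx by (intro DERIV_divide df df1) auto
    have "eventually (\<lambda>y. y \<in> {0<..<r}) (nhds x)" using x by (intro eventually_nhds_in_open) auto
    then have "eventually (\<lambda>y. enn2real (Psi w (ennreal y)) = phi1 y / phi y) (nhds x)"
    proof eventually_elim
      case (elim y)
      then have y: "0 \<le> y" "ennreal y < rho w" using r by (auto simp: ennreal_less_iff)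
      have "phi1 y \<ge> 0" unfolding phi1_def using y nonneg by (intro suminf_nonneg summable_k) auto
      moreover have "phi y > 0" using y by (intro phi_pos less_rho_imp_summable)
      ultimately show ?case using y by (simp add: Psi_less_rho Psi_quot_less_rho)
    qed
    then have "Psi_deriv w x = deriv (\<lambda>y. phi1 y / phi y) x"
      unfolding Psi_deriv_def by (intro deriv_cong_ev) auto
    then show "Psi_deriv w x = ?F x" using DERIV_imp_deriv[OF d] by simp
  qed (rule r(1))
  have "((\<lambda>x. ennreal (Psi_deriv w x)) \<longlongrightarrow> ennreal (?F r)) (at_left r)"
    using lim ev by (intro tendsto_ennrealI) (simp add: tendsto_cong)
  then have "Lim (at_left r) (\<lambda>x. ennreal (Psi_deriv w x)) = ennreal (?F r)"
    by (intro tendsto_Lim) auto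
  then have "sigma_sq w = ennreal r * ennreal (?F r)"
    using tau r by (simp add: sigma_sq_def)
  also have "\<dots> < \<infinity>" by (simp add: ennreal_mult_less_top)
  finally show False using sigma by simp
qed

end

section \<open>Convergence\<close>

text \<open>Either hypothesis gives \<open>nu w \<le> 1\<close>. A zero radius is separate because
  it leaves no point \<open>s > 0\<close> at which to tilt; otherwise the tilt is at the radius
  \<open>r\<close>.\<close>

lemma (in weights) typical_cases:
  assumes a: "a \<ge> 2" "w a > 0" and hyp: "sigma_sq w = \<infinity> \<or> nu w < 1"
  shows typical
proof -
  have nu: "nu w \<le> 1"
    using hyp sigma_finite_nu_gt_1[OF a] by (meson less_imp_le not_le)
  show ?thesis
  proof (cases "rho w = 0")
    case True
    show ?thesis
    proof (rule typical_zero_radius)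
      fix x :: real assume "x > 0"
      then show "\<not> summable (\<lambda>k. w k * x ^ k)"
        using summable_imp_le_rho[of x] True by auto
    qed
  next
    case False
    obtain r where r: "r > 0" "rho w = ennreal r" "summable (\<lambda>k. w k * r ^ k)"
      "summable (\<lambda>k. real k * w k * r ^ k)" "phi1 r \<le> phi r" and nu_eq: "nu w = ennreal (phi1 r / phi r)"
      using nu_le_1_cases[OF a nu False] by blast
    have sums: "(\<lambda>k. w k * r ^ k) sums phi r" unfolding phi_def using r(3) by (rule summable_sums)
    note max = minimizer[OF r]
    from hyp show ?thesis
    proof
      assume "sigma_sq w = \<infinity>"
      from sigma_infinite[OF a this r(1-4) nu] show ?thesis
        using typical_infinite_variance[OF a r(1) sums max] by simp
    next
      assume "nu w < 1"
      have fr: "phi r > 0" using r by (intro phi_pos) auto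
      have "phi1 r \<ge> 0" unfolding phi1_def using r nonneg by (intro suminf_nonneg) auto
      then have "phi1 r / phi r < 1" using \<open>nu w < 1\<close> fr unfolding nu_eq by (simp add: ennreal_less_one_iff)
      then have "phi1 r < phi r" using fr by simp
      then show ?thesis
        using r(4) by (intro typical_subcritical[OF a r(1) sums max]) (simp_all add: phi1_def mult.assoc)
    qed
  qed
qed

theorem theorem19:
  fixes w :: "nat \<Rightarrow> real"
  assumes "\<forall>k. w k \<ge> 0"
    and "w 0 > 0"
    and "\<exists>k\<ge>2. w k > 0"
    and "sigma_sq w = \<infinity> \<or> nu w < 1"
  shows "(\<forall>\<epsilon>::real. \<epsilon> > 0 \<longrightarrow>
            ((\<lambda>n. measure_pmf.prob (sg_tree w n)
                    {t. \<bar>real (height t) / sqrt (real n)\<bar> > \<epsilon>}) \<longlongrightarrow> 0)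
              (inf sequentially (principal {n. Z w n > 0})))
       \<and> ((\<lambda>n. measure_pmf.expectation (sg_tree w n)
                 (\<lambda>t. real (height t) / sqrt (real n))) \<longlongrightarrow> 0)
            (inf sequentially (principal {n. Z w n > 0}))"
proof -
  interpret weights w by unfold_locales (use assms in auto)
  obtain a where a: "a \<ge> 2" "w a > 0" using assms(3) by blast
  have is_typical: typical by (rule typical_cases[OF a assms(4)])
  let ?F = "inf sequentially (principal {n. Z w n > 0})"
  let ?E = "\<lambda>n. measure_pmf.expectation (sg_tree w n) (\<lambda>t. real (height t) / sqrt (real n))"
  have supp: "set_pmf (sg_tree w n) \<subseteq> {t. nv t = n}" if "Z w n > 0" for n
    using pmf_sg_tree[OF nonneg that] by (auto simp: set_pmf_iff split: if_splits)
  have expect: "?E n = tree_gf w (\<lambda>t. real (height t)) $ n / (Z w n * sqrt (real n))" if "Z w n > 0" for n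
  proof -
    have "?E n = (\<Sum>t | nv t = n. pmf (sg_tree w n) t * (real (height t) / sqrt (real n)))"
      by (subst integral_measure_pmf[OF finite_trees[of n]]) (use supp[OF that] in auto)
    also have "\<dots> = (\<Sum>t | nv t = n. tree_weight w t * real (height t) / (Z w n * sqrt (real n)))"
      by (intro sum.cong refl) (simp add: pmf_sg_tree[OF nonneg that])
    finally show ?thesis by (simp add: tree_gf_def sum_divide_distrib)
  qed
  have nonneg_E: "?E n \<ge> 0" for n by (intro Bochner_Integration.integral_nonneg) auto
  have lim: "(?E \<longlongrightarrow> 0) ?F"
  proof (rule order_tendstoI)
    fix \<delta> :: real assume "\<delta> < 0"
    then show "eventually (\<lambda>n. \<delta> < ?E n) ?F"
      using nonneg_E by (intro always_eventually) (auto intro: less_le_trans)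
  next
    fix \<delta> :: real assume \<delta>: "0 < \<delta>"
    have "eventually (\<lambda>n. tree_gf w (\<lambda>t. real (height t)) $ n \<le> \<delta> / 2 * sqrt (real n) * Z w n) sequentially"
      using \<delta> by (intro typical_imp_height_small is_typical) auto
    then have "eventually (\<lambda>n. 0 < Z w n \<longrightarrow> ?E n < \<delta>) sequentially"
      using eventually_gt_at_top[of 0]
    proof eventually_elim
      case (elim n)
      show ?case
      proof
        assume Zn: "0 < Z w n"
        have "?E n \<le> \<delta> / 2"
          unfolding expect[OF Zn] using elim Zn by (simp add: pos_divide_le_eq mult_ac)
        also have "\<dots> < \<delta>" using \<delta> by simp
        finally show "?E n < \<delta>" .
      qed
    qed
    then show "eventually (\<lambda>n. ?E n < \<delta>) ?F"
      by (simp add: eventually_inf_principal)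
  qed
  \<comment> \<open>Convergence in probability follows from convergence in expectation by Markov's
    inequality, as the height is nonnegative.\<close>
  have "((\<lambda>n. measure_pmf.prob (sg_tree w n) {t. \<bar>real (height t) / sqrt (real n)\<bar> > \<epsilon>}) \<longlongrightarrow> 0) ?F"
    if \<epsilon>: "\<epsilon> > 0" for \<epsilon> :: real
  proof (rule tendsto_sandwich[OF always_eventually _ tendsto_const])
    show "eventually (\<lambda>n. measure_pmf.prob (sg_tree w n) {t. \<bar>real (height t) / sqrt (real n)\<bar> > \<epsilon>} \<le> ?E n / \<epsilon>) ?F"
      unfolding eventually_inf_principal
    proof (intro always_eventually allI impI)
      fix n assume "n \<in> {n. 0 < Z w n}"
      then have Zn: "Z w n > 0" by simp
      have fin: "finite (set_pmf (sg_tree w n))"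
        using supp[OF Zn] finite_trees by (rule finite_subset)
      have "measure_pmf.prob (sg_tree w n) {t. \<bar>real (height t) / sqrt (real n)\<bar> > \<epsilon>}
          \<le> measure_pmf.prob (sg_tree w n) {t \<in> space (measure_pmf (sg_tree w n)). \<epsilon> \<le> real (height t) / sqrt (real n)}"
        by (intro measure_pmf.finite_measure_mono) auto
      also have "\<dots> \<le> ?E n / \<epsilon>"
        using \<epsilon> fin by (intro integral_Markov_inequality_measure[where A = "{}"] integrable_measure_pmf_finite) auto
      finally show "measure_pmf.prob (sg_tree w n) {t. \<bar>real (height t) / sqrt (real n)\<bar> > \<epsilon>} \<le> ?E n / \<epsilon>" .
    qed
    show "((\<lambda>n. ?E n / \<epsilon>) \<longlongrightarrow> 0) ?F"
      using tendsto_divide[OF lim tendsto_const[of \<epsilon>]] \<epsilon> by simp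
  qed simp
  with lim show ?thesis by blast
qed

end
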